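(* Let $d=2$, $\Delta=\mathrm{conv}\{e_0,e_1,e_2,-3e_0-e_1-e_2\}$, and let $h=h_0$ be the trivial height function. Let $\nu=c\,\nu_N$ with $c=\mu_M(A)/\nu_N(B)$. Then the equation $\mathrm{MA}(\Psi|_{B^\circ})=\nu$ admits a solution $\Psi\in\mathcal P(\Delta)$, but $B\setminus\Sigma_\Psi$ is disconnected.
   Context: $M\cong\mathbb Z^3$ is a lattice with basis $e_0,e_1,e_2$, $N=\mathrm{Hom}(M,\mathbb Z)$, $M_{\mathbb R},N_{\mathbb R}$ the real vector spaces with pairing $\langle\cdot,\cdot\rangle$. $h_0(0)=0$, $h_0(m)=1$ for $0\ne m\in\Delta\cap M$. $\Delta^\vee=\{n:\langle m,n\rangle\le1\ \forall m\in\Delta\}$, $A=\partial\Delta$, $B=\partial\Delta^\vee$; $B^\circ$ is the union of the relative interiors $\tau^\circ$ of facets $\tau$ of $\Delta^\vee$ and $B_{d-1}=B\setminus B^\circ$. For a facet $\sigma$ of $\Delta$, $n_\sigma\in N$ is its primitive outward normal and $\sigma^\circ$ its relative interior; for a facet $\tau$ of $\Delta^\vee$, $m_\tau\in M$ is its primitive outward normal. $\mu_M$ (resp. $\nu_N$) is the measure on $A$ (resp. $B$) equal on each facet $\sigma$ (resp. $\tau$) to Lebesgue measure normalized by the lattice $n_\sigma^\perp\cap M$ (resp. $m_\tau^\perp\cap N$). $\mathcal P(\Delta)$ is the set of convex $\Psi:N_{\mathbb R}\to\mathbb R$ with $\sup_n|\Psi(n)-\sup_{m\in\Delta\cap M}\langle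 m,n\rangle|<\infty$. $\beta_\sigma(n)=(\langle m_1,n\rangle,\langle m_2,n\rangle)$ for a $\mathbb Z$-basis $m_1,m_2$ of $n_\sigma^\perp\cap M$. $\mathrm{MA}(\Psi|_{B^\circ})=\nu$ means: for every facet $\tau$ of $\Delta^\vee$, facet $\sigma$ of $\Delta$ with $m_\tau\in\sigma$, and measurable $E\subset\tau^\circ$, $|\partial(\Psi\circ\beta_\sigma^{-1})(\beta_\sigma(E))|=\nu(E)$, where $\beta_\sigma^{-1}$ is the inverse of $\beta_\sigma|_{\tau^\circ}$, $\partial$ is the subgradient of the convex function on $\beta_\sigma(\tau^\circ)$ and $|\cdot|$ is Lebesgue measure. The solution is unique on $B$ up to constants. $\Psi^c(m)=\sup_{n\in B}\langle m,n\rangle-\Psi(n)$ for $m\in A$; $\partial^c\Psi^c(m)=\{n\in B:\Psi^c(m')\ge\Psi^c(m)+\langle m'-m,n\rangle\ \forall m'\in A\}$; $U_\sigma=B\setminus\partial^c\Psi^c(A\setminus\sigma^\circ)$ for each facet $\sigma$ of $\Delta$; $\Sigma_\Psi=B_{d-1}\setminus\bigcup_\sigma U_\sigma$. *)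

theory Defs
  imports "HOL-Analysis.Analysis"
begin

text \<open>
  The lattice M with its basis \<open>e\<^sub>0, e\<^sub>1, e\<^sub>2\<close> is identified with the integer points of
  \<open>real^3\<close>, where \<open>e\<^sub>i = axis i 1\<close> (the index type \<open>3\<close> has the elements 0, 1, 2), and N
  with the integer points of a second copy of \<open>real^3\<close> by means of the dual basis. The
  pairing is then the standard inner product. By convention a letter \<open>m\<close> denotes a point of
  \<open>M\<^sub>R\<close> and \<open>n\<close> a point of \<open>N\<^sub>R\<close>.
\<close>

definition int_lattice :: "(real^3) set" where
  "int_lattice = {x. \<forall>i. x $ i \<in> \<int>}"

definition primitive :: "real^3 \<Rightarrow> bool" where
  "primitive n \<longleftrightarrow> n \<in> int_lattice \<and>
     (\<forall>n'\<in>int_lattice. \<forall>k::int. n = of_int k *\<^sub>R n' \<longrightarrow> \<bar>k\<bar> = 1)"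

definition primitive_normal :: "(real^3) set \<Rightarrow> (real^3) set \<Rightarrow> real^3" where
  "primitive_normal P F = (THE n. primitive n \<and>
     (\<exists>b. (\<forall>x\<in>P. n \<bullet> x \<le> b) \<and> F = {x \<in> P. n \<bullet> x = b}))"

definition perp_lattice :: "real^3 \<Rightarrow> (real^3) set" where
  "perp_lattice n = {m \<in> int_lattice. m \<bullet> n = 0}"

definition Z_basis :: "(real^3) set \<Rightarrow> real^3 \<Rightarrow> real^3 \<Rightarrow> bool" where
  "Z_basis L b1 b2 \<longleftrightarrow> b1 \<in> L \<and> b2 \<in> L \<and>
     (\<forall>x\<in>L. \<exists>!(i::int, j::int). x = of_int i *\<^sub>R b1 + of_int j *\<^sub>R b2)"

definition dual_polytope :: "(real^3) set \<Rightarrow> (real^3) set" where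
  "dual_polytope P = {n. \<forall>m\<in>P. m \<bullet> n \<le> 1}"

definition facet_interiors :: "(real^3) set \<Rightarrow> (real^3) set" where
  "facet_interiors P = (\<Union>F\<in>{F. F facet_of P}. rel_interior F)"

text \<open>
  An affine parametrization of the plane of a facet that carries the standard lattice of
  \<open>real^2\<close> to a translate of the lattice of the plane. Two choices of base point and
  \<open>\<int>\<close>-basis differ by a translation and an element of \<open>GL(2,\<int>)\<close>, so the measure defined
  from it below does not depend on the choice.
\<close>

definition facet_chart :: "(real^3) set \<Rightarrow> (real^3) set \<Rightarrow> real^2 \<Rightarrow> real^3" where
  "facet_chart P F p =
     (let (x, b1, b2) = (SOME (x, b1, b2).
            x \<in> F \<and> Z_basis (perp_lattice (primitive_normal P F)) b1 b2)
      in x + p $ 1 *\<^sub>R b1 + p $ 2 *\<^sub>R b2)"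

text \<open>
  The lattice-normalized measure on the boundary of a polytope, as a Borel measure on the
  ambient space. Distinct facets meet in null sets, so on each facet it is the
  lattice-normalized Lebesgue measure of that facet.
\<close>

definition boundary_measure :: "(real^3) set \<Rightarrow> (real^3) measure" where
  "boundary_measure P = measure_of UNIV (sets borel)
     (\<lambda>E. \<Sum>F\<in>{F. F facet_of P}. emeasure lborel (facet_chart P F -` (E \<inter> F)))"

lemma facet_chart_measurable [measurable]: "facet_chart P F \<in> borel_measurable borel"
  unfolding facet_chart_def[abs_def]
  by (auto simp: Let_def split_beta intro!: borel_measurable_continuous_onI continuous_intros)

lemma sets_boundary_measure [simp, measurable_cong]: "sets (boundary_measure P) = sets borel"
  unfolding boundary_measure_def
  using sets.sigma_sets_eq[of "borel :: (real^3) measure"] by simp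

lemma emeasure_boundary_measure:
  assumes "closed P" "convex P" "E \<in> sets borel"
  shows "emeasure (boundary_measure P) E =
    (\<Sum>F\<in>{F. F facet_of P}. emeasure lborel (facet_chart P F -` (E \<inter> F)))"
proof (rule emeasure_measure_of[OF boundary_measure_def])
  have F: "F \<in> sets borel" if "F facet_of P" for F
    using that assms by (meson borel_closed facet_of_imp_face_of face_of_imp_closed)
  show "countably_additive (sets (boundary_measure P))
    (\<lambda>E. \<Sum>F\<in>{F. F facet_of P}. emeasure lborel (facet_chart P F -` (E \<inter> F)))"
  proof (rule countably_additiveI)
    fix A :: "nat \<Rightarrow> (real^3) set"
    assume A: "range A \<subseteq> sets (boundary_measure P)" "disjoint_family A"
    have "(\<Sum>i. emeasure lborel (facet_chart P F -` (A i \<inter> F)))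
        = emeasure lborel (facet_chart P F -` ((\<Union>i. A i) \<inter> F))" if "F facet_of P" for F
    proof -
      have "facet_chart P F -` (A i \<inter> F) \<in> sets lborel" for i
        using measurable_sets[OF facet_chart_measurable, of "A i \<inter> F" P F] A(1) F[OF that]
        by auto
      then have "(\<Sum>i. emeasure lborel (facet_chart P F -` (A i \<inter> F)))
          = emeasure lborel (\<Union>i. facet_chart P F -` (A i \<inter> F))"
        using A(2) by (intro suminf_emeasure) (auto simp: disjoint_family_on_def)
      also have "(\<Union>i. facet_chart P F -` (A i \<inter> F)) = facet_chart P F -` ((\<Union>i. A i) \<inter> F)"
        by auto
      finally show ?thesis .
    qed
    then show "(\<Sum>i. \<Sum>F\<in>{F. F facet_of P}. emeasure lborel (facet_chart P F -` (A i \<inter> F)))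
        = (\<Sum>F\<in>{F. F facet_of P}. emeasure lborel (facet_chart P F -` ((\<Union>i. A i) \<inter> F)))"
      by (subst suminf_sum) (auto intro!: sum.cong)
  qed
qed (use assms in \<open>auto simp: positive_def\<close>)

definition P_class :: "(real^3) set \<Rightarrow> (real^3 \<Rightarrow> real) set" where
  "P_class \<Delta> = {\<Psi>. convex_on UNIV \<Psi> \<and>
     bdd_above (range (\<lambda>n. \<bar>\<Psi> n - (SUP m\<in>\<Delta> \<inter> int_lattice. m \<bullet> n)\<bar>))}"

definition subgradient :: "(real^2) set \<Rightarrow> (real^2 \<Rightarrow> real) \<Rightarrow> real^2 \<Rightarrow> (real^2) set" where
  "subgradient D u x = {p. \<forall>y\<in>D. u y \<ge> u x + p \<bullet> (y - x)}"

definition beta :: "real^3 \<Rightarrow> real^3 \<Rightarrow> real^3 \<Rightarrow> real^2" where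
  "beta m1 m2 n = vector [m1 \<bullet> n, m2 \<bullet> n]"

text \<open>
  The equation \<open>MA(\<Psi>|B\<degree>) = \<nu>\<close>. It is imposed for every \<open>\<int>\<close>-basis, a change of basis
  acting by an element of \<open>GL(2,\<int>)\<close>, which preserves areas. Since \<open>emeasure\<close> is 0 on
  non-measurable sets, measurability of the subgradient image is stated explicitly.
\<close>

definition MA_equation :: "(real^3) set \<Rightarrow> (real^3 \<Rightarrow> real) \<Rightarrow> (real^3) measure \<Rightarrow> bool" where
  "MA_equation \<Delta> \<Psi> \<nu> \<longleftrightarrow>
     (\<forall>\<tau> \<sigma> m1 m2 E.
        \<tau> facet_of dual_polytope \<Delta> \<longrightarrow> \<sigma> facet_of \<Delta> \<longrightarrow>
        primitive_normal (dual_polytope \<Delta>) \<tau> \<in> \<sigma> \<longrightarrow>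
        Z_basis (perp_lattice (primitive_normal \<Delta> \<sigma>)) m1 m2 \<longrightarrow>
        E \<in> sets borel \<longrightarrow> E \<subseteq> rel_interior \<tau> \<longrightarrow>
        (let \<beta> = beta m1 m2;
             u = \<Psi> \<circ> inv_into (rel_interior \<tau>) \<beta>;
             S = (\<Union>x\<in>\<beta> ` E. subgradient (\<beta> ` rel_interior \<tau>) u x)
         in S \<in> sets lebesgue \<and> emeasure lebesgue S = emeasure \<nu> E))"

definition c_transform :: "(real^3) set \<Rightarrow> (real^3 \<Rightarrow> real) \<Rightarrow> real^3 \<Rightarrow> real" where
  "c_transform \<Delta> \<Psi> m = (SUP n\<in>frontier (dual_polytope \<Delta>). m \<bullet> n - \<Psi> n)"

definition c_subgradient :: "(real^3) set \<Rightarrow> (real^3 \<Rightarrow> real) \<Rightarrow> real^3 \<Rightarrow> (real^3) set" where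
  "c_subgradient \<Delta> \<Psi> m = {n \<in> frontier (dual_polytope \<Delta>).
     \<forall>m'\<in>frontier \<Delta>. c_transform \<Delta> \<Psi> m' \<ge> c_transform \<Delta> \<Psi> m + (m' - m) \<bullet> n}"

definition U_set :: "(real^3) set \<Rightarrow> (real^3 \<Rightarrow> real) \<Rightarrow> (real^3) set \<Rightarrow> (real^3) set" where
  "U_set \<Delta> \<Psi> \<sigma> = frontier (dual_polytope \<Delta>) -
     (\<Union>m\<in>frontier \<Delta> - rel_interior \<sigma>. c_subgradient \<Delta> \<Psi> m)"

definition singular_set :: "(real^3) set \<Rightarrow> (real^3 \<Rightarrow> real) \<Rightarrow> (real^3) set" where
  "singular_set \<Delta> \<Psi> =
     (frontier (dual_polytope \<Delta>) - facet_interiors (dual_polytope \<Delta>)) -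
     (\<Union>\<sigma>\<in>{\<sigma>. \<sigma> facet_of \<Delta>}. U_set \<Delta> \<Psi> \<sigma>)"

end

theory Submission
  imports Defs "HOL-Complex_Analysis.Great_Picard" "HOL-Analysis.Cross3"
begin

text \<open>
  Let \<open>a\<^sub>0 = e\<^sub>0\<close>, \<open>a\<^sub>1 = e\<^sub>1\<close>, \<open>a\<^sub>2 = e\<^sub>2\<close> and \<open>a\<^sub>3 = - 3 e\<^sub>0 - e\<^sub>1 - e\<^sub>2\<close> be the vertices of \<open>\<Delta>\<close>, let \<open>\<sigma>\<^sub>i\<close>
  be the facet opposite \<open>a\<^sub>i\<close>, and \<open>\<tau>\<^sub>i\<close> the facet of the dual polytope on which the pairing with
  \<open>a\<^sub>i\<close> is 1. The lattice areas of the \<open>\<tau>\<^sub>i\<close> are 18, 6, 6, 6 and the boundary of \<open>\<Delta>\<close> has area 3, so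
  \<open>\<nu>\<close> gives the masses 3/2, 1/2, 1/2, 1/2 to the \<open>\<tau>\<^sub>i\<close>. The slopes over \<open>\<tau>\<^sub>i\<close> of a function in \<open>P(\<Delta>)\<close>
  are defined modulo \<open>a\<^sub>i\<close> and lie in the image of \<open>\<Delta>\<close>, which is also the image of the star of \<open>a\<^sub>i\<close>,
  the union of the facets containing \<open>a\<^sub>i\<close>. For \<open>i = 0\<close> this image has area 3/2 (\<open>star_area\<close>), exactly
  the mass of \<open>\<tau>\<^sub>0\<close>. A solution therefore spends the whole star of \<open>a\<^sub>0\<close> on \<open>\<tau>\<^sub>0\<close>, and the other three
  facets are left with the slopes in \<open>\<sigma>\<^sub>0\<close>.

  Disconnectedness. Suppose that a point of \<open>\<tau>\<^sub>0 \<inter> \<tau>\<^sub>i\<close> has no supporting slope in \<open>\<sigma>\<^sub>0\<close>. By compactness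
  the same holds nearby, in particular on an open piece of \<open>\<tau>\<^sub>i\<close>. Its slopes have positive area, lie
  in the star of \<open>a\<^sub>0\<close>, and are almost all taken over the interior of \<open>\<tau>\<^sub>0\<close> as well. But the slopes that
  touch over the interiors of both \<open>\<tau>\<^sub>0\<close> and \<open>\<tau>\<^sub>i\<close> are negligible: by monotonicity of contacts this
  set is disjoint from its translates by positive multiples of \<open>a\<^sub>0 - a\<^sub>i\<close>
  (\<open>disjoint_facet_contacts_negligible\<close>). So every point of the relative boundary of \<open>\<tau>\<^sub>0\<close> has supporting
  slopes both in \<open>\<sigma>\<^sub>0\<close> (\<open>ridge_contact\<close>) and in the star of \<open>a\<^sub>0\<close>, hence lies in no \<open>U\<^sub>\<sigma>\<close>. The relative
  boundary of \<open>\<tau>\<^sub>0\<close> is contained in the singular set and separates the interior of \<open>\<tau>\<^sub>0\<close> from the other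
  facets (\<open>not_connected_complement_singular_set\<close>).

  Existence. The projection along the vertex of the dual polytope opposite \<open>\<tau>\<^sub>0\<close> maps \<open>\<tau>\<^sub>0\<close>, and also the
  union of the three other facets, bijectively onto one triangle of area 18. Dually, the star of \<open>a\<^sub>0\<close>
  and the facet \<open>\<sigma>\<^sub>0\<close> have the same image modulo \<open>a\<^sub>0\<close>, a triangle of area 3/2. A single potential \<open>u\<close> for
  the optimal transport between these two triangles, with uniform densities, therefore solves the
  equation on all facets (\<open>MA_solution_exists\<close>). This \<open>u\<close> is found as a minimiser of Kantorovich's dual
  functional (\<open>cost_minimiser_exists\<close>), and its Euler-Lagrange equation, derived with one-sided
  variations on compact sets, is the Monge-Ampere equation (\<open>contact_measure\<close>).
\<close>

section \<open>Slopes in contact with a function\<close>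

text \<open>
  For \<open>X\<close> a convex neighbourhood of \<open>x\<close> this says that \<open>p\<close> is a subgradient of \<open>u\<close> at \<open>x\<close>; for \<open>X\<close> the
  boundary of a polytope it is the contact relation behind the c-transform.
\<close>
definition supports :: "'a::euclidean_space set \<Rightarrow> ('a \<Rightarrow> real) \<Rightarrow> 'a \<Rightarrow> 'a \<Rightarrow> bool" where
  "supports X u p x \<longleftrightarrow> (\<forall>y\<in>X. u x + p \<bullet> (y - x) \<le> u y)"

definition contact_slopes :: "'a::euclidean_space set \<Rightarrow> ('a \<Rightarrow> real) \<Rightarrow> 'a set \<Rightarrow> 'a set" where
  "contact_slopes X u K = {p. \<exists>x\<in>K. supports X u p x}"

lemma supports_monotone:
  assumes "supports X u p x" "supports X u q y" "x \<in> X" "y \<in> X"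
  shows "0 \<le> (p - q) \<bullet> (x - y)"
  using assms unfolding supports_def by (force simp: inner_diff_left inner_diff_right)

text \<open>
  Compactness of \<open>K\<close> keeps a contact point in the limit of slopes.
\<close>
lemma closed_contact_slopes:
  fixes X :: "'a::euclidean_space set"
  assumes "compact K" "K \<subseteq> X" "continuous_on X u"
  shows "closed (contact_slopes X u K)"
proof -
  have "\<exists>p\<in>K. supports X u l p" if "\<forall>n. \<exists>x\<in>K. supports X u (f n) x" "f \<longlonglongrightarrow> l" for f :: "nat \<Rightarrow> 'a" and l
  proof -
    from that(1) obtain x where x: "\<And>n. x n \<in> K" "\<And>n. supports X u (f n) (x n)"
      by metis
    then obtain z r where z: "z \<in> K" "strict_mono r" "(x \<circ> r) \<longlonglongrightarrow> z"
      using assms(1) unfolding compact_def by metis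
    have f: "(f \<circ> r) \<longlonglongrightarrow> l"
      using LIMSEQ_subseq_LIMSEQ[OF that(2) z(2)] .
    have u: "(\<lambda>n. u (x (r n))) \<longlonglongrightarrow> u z"
      by (rule continuous_on_tendsto_compose[OF assms(3)])
        (use z x assms(2) in \<open>auto simp: o_def intro!: always_eventually\<close>)
    have "u z + l \<bullet> (y - z) \<le> u y" if "y \<in> X" for y
    proof (rule LIMSEQ_le_const2)
      show "(\<lambda>n. u (x (r n)) + (f (r n)) \<bullet> (y - x (r n))) \<longlonglongrightarrow> u z + l \<bullet> (y - z)"
        using u f z(3) by (intro tendsto_intros) (auto simp: o_def)
      show "\<exists>N. \<forall>n\<ge>N. u (x (r n)) + f (r n) \<bullet> (y - x (r n)) \<le> u y"
        using x(2) that unfolding supports_def by blast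
    qed
    then show ?thesis using z(1) unfolding supports_def by blast
  qed
  then show ?thesis
    unfolding contact_slopes_def closed_sequential_limits by blast
qed

text \<open>
  The translates of \<open>D\<close> by \<open>w / n\<close> are pairwise disjoint, of equal measure, and all inside one ball.
  This takes the place of Fubini's theorem in the proofs that slopes with two contacts are rare.
\<close>
lemma negligible_if_no_forward_translate:
  fixes D :: "'a::euclidean_space set"
  assumes D: "D \<in> sets borel" "bounded D" and w: "w \<noteq> 0"
    and no: "\<And>x t. x \<in> D \<Longrightarrow> 0 < t \<Longrightarrow> x + t *\<^sub>R w \<notin> D"
  shows "negligible D"
proof -
  define E where "E k = (+) ((1 / real (Suc k)) *\<^sub>R w) ` D" for k
  have Dm: "D \<in> lmeasurable"
    using D bounded_set_imp_lmeasurable by (metis sets_completionI_sets sets_lborel)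
  have Em: "E k \<in> lmeasurable" and Emeas: "measure lebesgue (E k) = measure lebesgue D" for k
    unfolding E_def using Dm by (auto simp: measurable_translation measure_translation)
  have disj: "disjoint_family E"
  unfolding disjoint_family_on_def
  proof (intro ballI impI)
    fix i j :: nat assume "i \<noteq> j"
    have *: "E i \<inter> E j = {}" if "i < j" for i j
    proof -
      { fix x y assume "x \<in> D" "y \<in> D" "(1 / real (Suc i)) *\<^sub>R w + x = (1 / real (Suc j)) *\<^sub>R w + y"
        then have "y = x + (1 / real (Suc i) - 1 / real (Suc j)) *\<^sub>R w"
          by (simp add: algebra_simps)
        moreover have "1 / real (Suc i) - 1 / real (Suc j) > 0"
          using that divide_strict_left_mono[of "real (Suc i)" "real (Suc j)" 1] by simp
        ultimately have False using no \<open>x \<in> D\<close> \<open>y \<in> D\<close> by blast }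
      then show ?thesis unfolding E_def by blast
    qed
    show "E i \<inter> E j = {}"
      using *[of i j] *[of j i] \<open>i \<noteq> j\<close> by (cases "i < j") auto
  qed
  obtain R where "\<forall>x\<in>D. norm x \<le> R" using D(2) unfolding bounded_iff by blast
  then have R: "D \<subseteq> cball 0 R" by auto
  have sub: "E k \<subseteq> cball 0 (norm w + R)" for k
  proof -
    have "norm ((1 / real (Suc k)) *\<^sub>R w) = (1 / real (Suc k)) * norm w" by simp
    also have "\<dots> \<le> 1 * norm w" by (intro mult_right_mono) auto
    finally have w: "norm ((1 / real (Suc k)) *\<^sub>R w) \<le> norm w" by simp
    show ?thesis
    proof
      fix y assume "y \<in> E k"
      then obtain x where x: "x \<in> D" "y = (1 / real (Suc k)) *\<^sub>R w + x" unfolding E_def by blast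
      have "norm y \<le> norm ((1 / real (Suc k)) *\<^sub>R w) + norm x" unfolding x(2) by (rule norm_triangle_ineq)
      moreover have "norm x \<le> R" using x(1) R by auto
      ultimately show "y \<in> cball 0 (norm w + R)" using w by simp
    qed
  qed
  let ?V = "measure lebesgue (cball (0::'a) (norm w + R))"
  have "real n * measure lebesgue D \<le> ?V" for n
  proof -
    have "measure lebesgue (\<Union>k\<in>{..<n}. E k) = (\<Sum>k<n. measure lebesgue (E k))"
      using disj fmeasurableD[OF Em] fmeasurableD2[OF Em]
      by (intro measure_finite_Union) (auto simp: disjoint_family_on_def)
    then have "real n * measure lebesgue D = measure lebesgue (\<Union>k\<in>{..<n}. E k)"
      by (simp add: Emeas)
    also have "\<dots> \<le> ?V"
      using sub Em by (intro measure_mono_fmeasurable) auto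
    finally show ?thesis .
  qed
  then have "measure lebesgue D \<le> 0"
    using reals_Archimedean3[of "measure lebesgue D"] by (metis not_le)
  then show ?thesis
    using Dm measure_nonneg[of lebesgue D] by (simp add: negligible_iff_measure)
qed

text \<open>
  A convex function is differentiable almost everywhere, stated for the transform of \<open>u\<close>. Two contact
  points are separated by rational bounds on some coordinate \<open>b\<close>. By monotonicity, moving the slope
  in direction \<open>b\<close> cannot decrease that coordinate of the contact point, so the slopes with contacts
  on both sides contain no forward translate.
\<close>
lemma negligible_double_contact:
  fixes X :: "'a::euclidean_space set"
  assumes X: "compact X" and u: "continuous_on X u" and Y: "bounded Y"
  shows "negligible {p \<in> Y. \<exists>x\<in>X. \<exists>y\<in>X. x \<noteq> y \<and> supports X u p x \<and> supports X u p y}"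
proof -
  obtain R where "\<forall>x\<in>Y. norm x \<le> R" using Y unfolding bounded_iff by blast
  then have R: "Y \<subseteq> cball 0 R" by auto
  define D where "D b r s = contact_slopes X u {x\<in>X. x \<bullet> b \<le> r} \<inter>
      contact_slopes X u {x\<in>X. s \<le> x \<bullet> b} \<inter> cball 0 R" for b r s
  have cl: "closed (contact_slopes X u {x\<in>X. x \<bullet> b \<le> r})"
           "closed (contact_slopes X u {x\<in>X. r \<le> x \<bullet> b})" for b r
  proof -
    have "compact (X \<inter> {x. x \<bullet> b \<le> r})"
      using X by (intro compact_Int_closed) (auto intro!: closed_Collect_le continuous_intros)
    moreover have "compact (X \<inter> {x. r \<le> x \<bullet> b})"
      using X by (intro compact_Int_closed) (auto intro!: closed_Collect_le continuous_intros)
    ultimately show "closed (contact_slopes X u {x\<in>X. x \<bullet> b \<le> r})"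
           "closed (contact_slopes X u {x\<in>X. r \<le> x \<bullet> b})"
      using u by (auto intro!: closed_contact_slopes simp: Int_def)
  qed
  have neg: "negligible (D b r s)" if b: "b \<in> Basis" and rs: "r < s" for b r s
  proof (rule negligible_if_no_forward_translate)
    show "D b r s \<in> sets borel" unfolding D_def using cl by (intro borel_closed closed_Int) auto
    show "bounded (D b r s)" unfolding D_def using bounded_cball by (rule bounded_subset) auto
    show "b \<noteq> 0" using b by auto
    fix p t assume p: "p \<in> D b r s" "0 < (t::real)"
    show "p + t *\<^sub>R b \<notin> D b r s"
    proof
      assume q: "p + t *\<^sub>R b \<in> D b r s"
      from p q obtain x y where x: "x \<in> X" "s \<le> x \<bullet> b" "supports X u p x"
        and y: "y \<in> X" "y \<bullet> b \<le> r" "supports X u (p + t *\<^sub>R b) y"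
        unfolding D_def contact_slopes_def by blast
      have "0 \<le> (t *\<^sub>R b) \<bullet> (y - x)"
        using supports_monotone[OF y(3) x(3) y(1) x(1)] by simp
      then have "0 \<le> t * (y \<bullet> b - x \<bullet> b)"
        by (simp add: inner_diff_right inner_commute)
      then show False
        using p(2) x(2) y(2) rs by (simp add: zero_le_mult_iff)
    qed
  qed
  have "{p \<in> Y. \<exists>x\<in>X. \<exists>y\<in>X. x \<noteq> y \<and> supports X u p x \<and> supports X u p y} \<subseteq>
    (\<Union>(b, r, s)\<in>{(b, r, s). b \<in> Basis \<and> r \<in> \<rat> \<and> s \<in> \<rat> \<and> r < s}. D b r s)" (is "?L \<subseteq> ?R")
  proof safe
    fix p x y assume p: "p \<in> Y" and xy: "x \<in> X" "y \<in> X" "x \<noteq> y" "supports X u p x" "supports X u p y"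
    have *: "p \<in> ?R" if xy: "x \<in> X" "y \<in> X" "supports X u p x" "supports X u p y"
      and b: "b \<in> Basis" "x \<bullet> b < y \<bullet> b" for x y b
    proof -
      obtain r where r: "r \<in> \<rat>" "x \<bullet> b < r" "r < y \<bullet> b" using Rats_dense_in_real[OF b(2)] by blast
      obtain s where s: "s \<in> \<rat>" "r < s" "s < y \<bullet> b" using Rats_dense_in_real[OF r(3)] by blast
      have "p \<in> D b r s"
        unfolding D_def contact_slopes_def using xy r s p R by force
      then show ?thesis using r s b(1) by blast
    qed
    from xy(3) obtain b where b: "b \<in> Basis" "x \<bullet> b \<noteq> y \<bullet> b" using euclidean_eqI by blast
    then show "p \<in> ?R" using *[of x y b] *[of y x b] xy by (cases "x \<bullet> b < y \<bullet> b") auto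
  qed
  moreover have "negligible ?R"
  proof (rule negligible_countable_Union)
    have "{(b::'a, r::real, s). b \<in> Basis \<and> r \<in> \<rat> \<and> s \<in> \<rat> \<and> r < s} \<subseteq> Basis \<times> \<rat> \<times> \<rat>" by auto
    moreover have "countable (Basis \<times> \<rat> \<times> \<rat> :: ('a \<times> real \<times> real) set)"
      by (intro countable_SIGMA countable_rat countable_finite) auto
    ultimately show "countable ((\<lambda>(b, r, s). D b r s) ` {(b, r, s). b \<in> Basis \<and> r \<in> \<rat> \<and> s \<in> \<rat> \<and> r < s})"
      by (meson countable_image countable_subset)
  qed (use neg in auto)
  ultimately show ?thesis by (rule negligible_subset[rotated])
qed

section \<open>Legendre transforms over compact sets\<close>

definition legendre :: "'a::euclidean_space set \<Rightarrow> ('a \<Rightarrow> real) \<Rightarrow> 'a \<Rightarrow> real" where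
  "legendre X f p = (SUP x\<in>X. p \<bullet> x - f x)"

lemma legendre_bdd_above:
  assumes "bounded X" "bdd_below (f ` X)"
  shows "bdd_above ((\<lambda>x. p \<bullet> x - f x) ` X)"
proof -
  obtain R where R: "\<And>x. x \<in> X \<Longrightarrow> norm x \<le> R" using assms(1) unfolding bounded_iff by blast
  obtain M where M: "\<And>x. x \<in> X \<Longrightarrow> M \<le> f x" using assms(2) unfolding bdd_below_def by auto
  show ?thesis
  proof (rule bdd_aboveI2)
    fix x assume x: "x \<in> X"
    have "p \<bullet> x \<le> norm p * norm x" by (rule norm_cauchy_schwarz)
    also have "\<dots> \<le> norm p * R" using R[OF x] by (simp add: mult_left_mono)
    finally show "p \<bullet> x - f x \<le> norm p * R - M" using M[OF x] by simp
  qed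
qed

lemma legendre_upper:
  assumes "bounded X" "bdd_below (f ` X)" "x \<in> X"
  shows "p \<bullet> x - f x \<le> legendre X f p"
  unfolding legendre_def using legendre_bdd_above[OF assms(1,2)] assms(3) by (rule cSUP_upper2) auto

lemma legendre_least:
  assumes "X \<noteq> {}" "\<And>x. x \<in> X \<Longrightarrow> p \<bullet> x - f x \<le> b"
  shows "legendre X f p \<le> b"
  unfolding legendre_def using assms by (rule cSUP_least)

lemma legendre_shift:
  assumes "bounded X" "bdd_below (f ` X)" "X \<noteq> {}"
  shows "legendre X (\<lambda>x. f x - a) p = legendre X f p + a"
proof (rule antisym)
  show "legendre X (\<lambda>x. f x - a) p \<le> legendre X f p + a"
    using legendre_upper[OF assms(1,2), of _ p] by (intro legendre_least[OF assms(3)]) force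
  obtain M where M: "\<And>x. x \<in> X \<Longrightarrow> M \<le> f x" using assms(2) unfolding bdd_below_def by auto
  have "bdd_below ((\<lambda>x. f x - a) ` X)"
    by (rule bdd_belowI2[where m = "M - a"]) (use M in auto)
  then have "legendre X f p \<le> legendre X (\<lambda>x. f x - a) p - a"
    using legendre_upper[OF assms(1), of "\<lambda>x. f x - a" _ p] by (intro legendre_least[OF assms(3)]) force
  then show "legendre X f p + a \<le> legendre X (\<lambda>x. f x - a) p" by simp
qed

lemma legendre_le_plus:
  assumes "bounded X" "bdd_below (f ` X)" "X \<noteq> {}" "\<And>x. x \<in> X \<Longrightarrow> f x \<le> g x + d"
  shows "legendre X g p \<le> legendre X f p + d"
  using legendre_upper[OF assms(1,2), of _ p] assms(4)
  by (intro legendre_least[OF assms(3)]) force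

lemma legendre_lipschitz:
  assumes "bdd_below (f ` X)" "X \<noteq> {}" "\<And>x. x \<in> X \<Longrightarrow> norm x \<le> R"
  shows "\<bar>legendre X f p - legendre X f q\<bar> \<le> R * norm (p - q)"
proof -
  have bd: "bounded X" using assms(3) unfolding bounded_iff by blast
  have *: "legendre X f p \<le> legendre X f q + R * norm (p - q)" for p q
  proof (rule legendre_least[OF assms(2)])
    fix x assume x: "x \<in> X"
    have "(p - q) \<bullet> x \<le> norm (p - q) * norm x" by (rule norm_cauchy_schwarz)
    also have "\<dots> \<le> norm (p - q) * R" using assms(3)[OF x] by (simp add: mult_left_mono)
    finally show "p \<bullet> x - f x \<le> legendre X f q + R * norm (p - q)"
      using legendre_upper[OF bd assms(1) x, of q] by (simp add: inner_diff_left mult.commute)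
  qed
  show ?thesis using *[of p q] *[of q p] by (simp add: norm_minus_commute abs_le_iff)
qed

lemma continuous_on_if_lipschitz:
  fixes f :: "'a::real_normed_vector \<Rightarrow> real"
  assumes "\<And>x y. x \<in> S \<Longrightarrow> y \<in> S \<Longrightarrow> \<bar>f x - f y\<bar> \<le> R * norm (x - y)"
  shows "continuous_on S f"
proof -
  have "(max R 0)-lipschitz_on S f"
  proof (rule lipschitz_onI)
    fix x y assume "x \<in> S" "y \<in> S"
    then have "\<bar>f x - f y\<bar> \<le> R * norm (x - y)" using assms by blast
    also have "\<dots> \<le> max R 0 * norm (x - y)" by (intro mult_right_mono) auto
    finally show "dist (f x) (f y) \<le> max R 0 * dist x y" by (simp add: dist_norm)
  qed auto
  then show ?thesis by (rule lipschitz_on_continuous_on)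
qed

lemma continuous_on_legendre:
  assumes "bounded X" "bdd_below (f ` X)" "X \<noteq> {}"
  shows "continuous_on S (legendre X f)"
proof -
  obtain R where R: "\<And>x. x \<in> X \<Longrightarrow> norm x \<le> R" using assms(1) unfolding bounded_iff by blast
  show ?thesis
    by (rule continuous_on_if_lipschitz) (rule legendre_lipschitz[OF assms(2,3) R])
qed

lemma bdd_below_image_compact:
  fixes f :: "'a::euclidean_space \<Rightarrow> real"
  assumes "compact X" "continuous_on X f"
  shows "bdd_below (f ` X)"
  by (intro bounded_imp_bdd_below compact_imp_bounded compact_continuous_image assms)

lemma legendre_attained:
  assumes "compact X" "X \<noteq> {}" "continuous_on X f"
  obtains x where "x \<in> X" "legendre X f p = p \<bullet> x - f x"
proof -
  have "continuous_on X (\<lambda>x. p \<bullet> x - f x)" using assms(3) by (intro continuous_intros)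
  then obtain x where x: "x \<in> X" "\<And>y. y \<in> X \<Longrightarrow> p \<bullet> y - f y \<le> p \<bullet> x - f x"
    using continuous_attains_sup[OF assms(1,2)] by blast
  have "legendre X f p = p \<bullet> x - f x"
    using legendre_least[OF assms(2) x(2)] x(1)
      legendre_upper[OF compact_imp_bounded[OF assms(1)] bdd_below_image_compact[OF assms(1,3)] x(1)]
    by (intro antisym) auto
  then show ?thesis using x(1) that by blast
qed

lemma supports_iff_legendre:
  assumes "compact X" "continuous_on X u" "x \<in> X"
  shows "supports X u p x \<longleftrightarrow> legendre X u p \<le> p \<bullet> x - u x"
proof
  assume "supports X u p x"
  then show "legendre X u p \<le> p \<bullet> x - u x"
    using assms(3) unfolding supports_def
    by (intro legendre_least) (auto simp: inner_diff_right algebra_simps)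
next
  assume *: "legendre X u p \<le> p \<bullet> x - u x"
  show "supports X u p x"
    unfolding supports_def
  proof
    fix y assume "y \<in> X"
    from legendre_upper[OF compact_imp_bounded[OF assms(1)] bdd_below_image_compact[OF assms(1,2)] this, of p] *
    show "u x + p \<bullet> (y - x) \<le> u y" by (simp add: inner_diff_right)
  qed
qed

lemma set_integrable_compact:
  fixes f :: "'a::euclidean_space \<Rightarrow> real"
  assumes "compact S" "continuous_on S f"
  shows "set_integrable lborel S f"
  unfolding set_integrable_def using borel_integrable_compact[OF assms]
  by (simp add: indicator_def if_distrib cong: if_cong)

text \<open>
  The form in which integrals of potentials are compared: a difference of potentials is bounded by
  a multiple of an indicator function.
\<close>
lemma set_integral_le_plus_indicator:
  fixes f g :: "'a::euclidean_space \<Rightarrow> real"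
  assumes S: "compact S" "continuous_on S f" "continuous_on S g" and K: "compact K" "K \<subseteq> S"
    and le: "\<And>x. x \<in> S \<Longrightarrow> f x \<le> g x + d * indicator K x"
  shows "(LINT x:S|lborel. f x) \<le> (LINT x:S|lborel. g x) + d * measure lborel K"
proof -
  have eq: "indicator S x *\<^sub>R (d * indicator K x) = d * indicator K x" for x
    using K(2) by (auto simp: indicator_def)
  have intK: "integrable lborel (\<lambda>x. d * indicator K x :: real)"
    using K(1) emeasure_compact_finite[OF K(1)] by (intro integrable_mult_right) (auto simp: borel_compact)
  have I: "set_integrable lborel S (\<lambda>x. d * indicator K x)"
    unfolding set_integrable_def eq by (rule intK)
  have "(LINT x:S|lborel. f x) \<le> (LINT x:S|lborel. g x + d * indicator K x)"
    using set_integrable_compact[OF S(1,2)] set_integral_add(1)[OF set_integrable_compact[OF S(1,3)] I] le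
    by (intro set_integral_mono) auto
  also have "\<dots> = (LINT x:S|lborel. g x) + (LINT x:S|lborel. d * indicator K x)"
    by (rule set_integral_add(2)[OF set_integrable_compact[OF S(1,3)] I])
  also have "(LINT x:S|lborel. d * indicator K x) = d * measure lborel K"
    unfolding set_lebesgue_integral_def eq by simp
  finally show ?thesis .
qed

section \<open>Optimal transport between compact sets\<close>

text \<open>
  Uniform densities on two compact sets, the density on the source being \<open>c\<close> times the one on
  the target, so that the masses agree.
\<close>
locale balanced_transport =
  fixes X Y :: "'a::euclidean_space set" and c :: real
  assumes X: "compact X" "X \<noteq> {}" and Y: "compact Y" "Y \<noteq> {}" and c: "0 \<le> c"
    and mass: "measure lborel Y = c * measure lborel X"
begin

text \<open>
  Kantorovich's dual functional for the cost \<open>- p \<bullet> x\<close>: its minimisers are the potentials of the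
  optimal transport.
\<close>
definition cost :: "('a \<Rightarrow> real) \<Rightarrow> real" where
  "cost f = c * (LINT x:X|lborel. f x) + (LINT p:Y|lborel. legendre X f p)"

lemma bounded_XY: "bounded X" "bounded Y"
  using X Y compact_imp_bounded by auto

lemma cont_legendre_X: "bdd_below (f ` X) \<Longrightarrow> continuous_on S (legendre X f)"
  and cont_legendre_Y: "bdd_below (f ` Y) \<Longrightarrow> continuous_on S (legendre Y f)"
  using continuous_on_legendre bounded_XY X Y by blast+

lemma cost_le_plus:
  assumes f: "continuous_on X f" and g: "continuous_on X g"
    and le: "\<And>x. x \<in> X \<Longrightarrow> \<bar>f x - g x\<bar> \<le> d"
  shows "cost f \<le> cost g + d * (c * measure lborel X + measure lborel Y)"
proof -
  note bf = bdd_below_image_compact[OF X(1) f] and bg = bdd_below_image_compact[OF X(1) g]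
  have "(LINT x:X|lborel. f x) \<le> (LINT x:X|lborel. g x) + d * measure lborel X"
    using le by (intro set_integral_le_plus_indicator[OF X(1) f g X(1)]) force+
  then have "c * (LINT x:X|lborel. f x) \<le> c * ((LINT x:X|lborel. g x) + d * measure lborel X)"
    using c by (rule mult_left_mono)
  moreover have "(LINT p:Y|lborel. legendre X f p) \<le> (LINT p:Y|lborel. legendre X g p) + d * measure lborel Y"
  proof (intro set_integral_le_plus_indicator[OF Y(1) cont_legendre_X[OF bf] cont_legendre_X[OF bg] Y(1) order_refl])
    fix p assume "p \<in> Y"
    have "legendre X f p \<le> legendre X g p + d"
      using le by (intro legendre_le_plus[OF bounded_XY(1) bg X(2)]) force
    then show "legendre X f p \<le> legendre X g p + d * indicator Y p" using \<open>p \<in> Y\<close> by simp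
  qed
  ultimately show ?thesis unfolding cost_def by (simp add: algebra_simps)
qed

text \<open>
  The masses agree, so a constant moved from the potential to its transform cancels. This makes it
  possible to normalise potentials at a point.
\<close>
lemma cost_shift:
  assumes f: "continuous_on X f"
  shows "cost (\<lambda>x. f x - a) = cost f"
proof -
  note bf = bdd_below_image_compact[OF X(1) f]
  have iX: "set_integrable lborel X (\<lambda>x. a)" and iY: "set_integrable lborel Y (\<lambda>x. a)"
    using set_integrable_compact X Y by (auto intro: continuous_on_const)
  have cX: "(LINT x:X|lborel. a) = a * measure lborel X"
    and cY: "(LINT x:Y|lborel. a) = a * measure lborel Y"
    unfolding set_lebesgue_integral_def by simp_all
  have A: "(LINT x:X|lborel. f x - a) = (LINT x:X|lborel. f x) - a * measure lborel X"
    using set_integral_diff(2)[OF set_integrable_compact[OF X(1) f] iX] cX by simp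
  have B: "(LINT p:Y|lborel. legendre X (\<lambda>x. f x - a) p) = (LINT p:Y|lborel. legendre X f p) + a * measure lborel Y"
    unfolding legendre_shift[OF bounded_XY(1) bf X(2)]
    using set_integral_add(2)[OF set_integrable_compact[OF Y(1) cont_legendre_X[OF bf]] iY] cY by simp
  show ?thesis unfolding cost_def A B mass by (simp add: algebra_simps)
qed

text \<open>
  Transforms of functions on \<open>Y\<close> are Lipschitz with a constant that depends only on \<open>Y\<close>. Normalised
  at a point of \<open>X\<close> they lie in a uniformly bounded, equicontinuous family, to which the theorem of
  Arzela and Ascoli applies; \<open>cost\<close> is continuous for uniform convergence.
\<close>
lemma cost_minimiser_exists:
  obtains u0 where "continuous_on X u0"
    "\<And>h. bdd_below (h ` Y) \<Longrightarrow> cost u0 \<le> cost (legendre Y h)"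
proof -
  obtain R1 where R1: "\<And>x. x \<in> X \<Longrightarrow> norm x \<le> R1" using bounded_XY(1) unfolding bounded_iff by blast
  obtain R where R: "\<And>p. p \<in> Y \<Longrightarrow> norm p \<le> R" using bounded_XY(2) unfolding bounded_iff by blast
  have R0: "0 \<le> R" "0 \<le> R1" using R R1 X(2) Y(2) by (meson norm_ge_zero order_trans ex_in_conv)+
  obtain x0 where x0: "x0 \<in> X" using X(2) by blast
  define L where "L = {f. (\<forall>x\<in>X. \<forall>y\<in>X. \<bar>f x - f y\<bar> \<le> R * norm (x - y)) \<and> f x0 = (0::real)}"
  have Lcont: "continuous_on X f" if "f \<in> L" for f
    using that unfolding L_def by (intro continuous_on_if_lipschitz[of _ _ R]) auto
  define M where "M = R * (R1 + R1)"
  have Lbound: "\<bar>f x\<bar> \<le> M" if "f \<in> L" "x \<in> X" for f x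
  proof -
    have "\<bar>f x - f x0\<bar> \<le> R * norm (x - x0)" using that x0 unfolding L_def by blast
    also have "norm (x - x0) \<le> R1 + R1"
      using norm_triangle_ineq4[of x x0] R1[OF that(2)] R1[OF x0] by simp
    finally show ?thesis using that(1) R0 unfolding L_def M_def by (simp add: mult_left_mono)
  qed
  have zeroL: "(\<lambda>x. 0) \<in> L" unfolding L_def using R0 by simp
  have bdd: "bdd_below (cost ` L)"
  proof (rule bdd_belowI2)
    fix f assume f: "f \<in> L"
    have "cost (\<lambda>x. 0) \<le> cost f + M * (c * measure lborel X + measure lborel Y)"
      using Lbound[OF f] by (intro cost_le_plus Lcont f zeroL) auto
    then show "cost (\<lambda>x. 0) - M * (c * measure lborel X + measure lborel Y) \<le> cost f" by simp
  qed
  define I where "I = (INF f\<in>L. cost f)"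
  have "\<exists>f\<in>L. cost f < I + 1 / real (Suc n)" for n
  proof -
    have "I < I + 1 / real (Suc n)" by simp
    then show ?thesis
      unfolding I_def using cINF_less_iff[OF _ bdd, of "I + 1 / real (Suc n)"] zeroL I_def by blast
  qed
  then obtain F where F: "\<And>n. F n \<in> L" "\<And>n. cost (F n) < I + 1 / real (Suc n)" by metis
  obtain g k where g: "continuous_on X g" "strict_mono (k :: nat \<Rightarrow> nat)"
    "\<And>e. 0 < e \<Longrightarrow> \<exists>N. \<forall>n x. N \<le> n \<and> x \<in> X \<longrightarrow> norm (F (k n) x - g x) < e"
  proof (rule Arzela_Ascoli[OF X(1), of F M])
    show "norm (F n x) \<le> M" if "x \<in> X" for n x using Lbound[OF F(1) that] by simp
    show "\<exists>d>0. \<forall>n y. y \<in> X \<and> norm (x - y) < d \<longrightarrow> norm (F n x - F n y) < e"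
      if "x \<in> X" "0 < e" for x e
    proof (intro exI conjI allI impI)
      show "0 < e / (R + 1)" using that R0 by simp
      fix n y assume y: "y \<in> X \<and> norm (x - y) < e / (R + 1)"
      have "\<bar>F n x - F n y\<bar> \<le> R * norm (x - y)" using F(1)[of n] y that unfolding L_def by blast
      also have "\<dots> \<le> (R + 1) * norm (x - y)" by (simp add: mult_right_mono)
      also have "\<dots> < e" using y R0 by (simp add: field_simps)
      finally show "norm (F n x - F n y) < e" by simp
    qed
  qed blast
  have near: "\<exists>f\<in>L. (\<forall>x\<in>X. \<bar>f x - g x\<bar> \<le> e) \<and> cost f \<le> I + e" if e: "0 < e" for e
  proof -
    obtain N where N: "\<forall>n x. N \<le> n \<and> x \<in> X \<longrightarrow> norm (F (k n) x - g x) < e" using g(3)[OF e] by blast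
    obtain n where n: "1 / real (Suc n) < e" using e nat_approx_posE by metis
    let ?n = "max N n"
    have "n \<le> k ?n" using seq_suble[OF g(2), of ?n] by simp
    then have "1 / real (Suc (k ?n)) \<le> 1 / real (Suc n)" by (intro divide_left_mono) auto
    then have "cost (F (k ?n)) \<le> I + e" using F(2)[of "k ?n"] n by linarith
    then show ?thesis using F(1)[of "k ?n"] N by (intro bexI[of _ "F (k ?n)"]) (auto intro: less_imp_le)
  qed
  have costg: "cost g \<le> I"
  proof (rule field_le_epsilon)
    fix e :: real assume e: "0 < e"
    define m where "m = c * measure lborel X + measure lborel Y"
    have m: "0 \<le> m" unfolding m_def using c by simp
    \<comment> \<open>\<open>d\<close> bounds the sup distance and the excess cost of \<open>f\<close>; together they cost \<open>d * (1 + m) = e\<close>\<close>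
    define d where "d = e / (1 + m)"
    have d: "0 < d" unfolding d_def using e m by simp
    obtain f where f: "f \<in> L" "\<forall>x\<in>X. \<bar>f x - g x\<bar> \<le> d" "cost f \<le> I + d" using near[OF d] by blast
    have "cost g \<le> cost f + d * m"
      unfolding m_def using f by (intro cost_le_plus Lcont g) (auto simp: abs_minus_commute)
    also have "\<dots> \<le> I + d * (1 + m)" using f(3) by (simp add: algebra_simps)
    also have "d * (1 + m) = e" unfolding d_def using m by simp
    finally show "cost g \<le> I + e" .
  qed
  show ?thesis
  proof
    show "continuous_on X g" by (rule g)
    fix h :: "'a \<Rightarrow> real" assume h: "bdd_below (h ` Y)"
    let ?v = "legendre Y h"
    have v: "continuous_on X ?v" by (rule cont_legendre_Y[OF h])
    have "(\<lambda>x. ?v x - ?v x0) \<in> L"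
      unfolding L_def using legendre_lipschitz[OF h Y(2) R] by auto
    then have "I \<le> cost (\<lambda>x. ?v x - ?v x0)" unfolding I_def using bdd by (intro cINF_lower) auto
    then show "cost g \<le> cost ?v" using costg cost_shift[OF v] by simp
  qed
qed

end

text \<open>
  A minimiser that is itself a transform, so that it is defined and convex on the whole space, and
  whose transform over \<open>X\<close> gives back \<open>g\<close>.
\<close>
locale transport_potential = balanced_transport +
  fixes u g :: "'a \<Rightarrow> real"
  assumes g: "continuous_on UNIV g" and u: "u = legendre Y g"
    and conjugate: "\<And>p. p \<in> Y \<Longrightarrow> legendre X u p = g p"
    and minimal: "\<And>h. bdd_below (h ` Y) \<Longrightarrow> cost u \<le> cost (legendre Y h)"
begin

lemma cont_u: "continuous_on S u"
  unfolding u by (rule cont_legendre_Y) (rule bdd_below_image_compact[OF Y(1) continuous_on_subset[OF g subset_UNIV]])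

lemma supports_iff: "x \<in> X \<Longrightarrow> p \<in> Y \<Longrightarrow> supports X u p x \<longleftrightarrow> g p \<le> p \<bullet> x - u x"
  using supports_iff_legendre[OF X(1) cont_u] conjugate by auto

lemma contact_slopes_eq_Int_near:
  assumes K: "compact K" "K \<subseteq> X" "K \<noteq> {}"
  shows "Y \<inter> contact_slopes X u K = {p \<in> Y. g p \<le> legendre K u p}"
proof -
  have "(\<exists>x\<in>K. supports X u p x) \<longleftrightarrow> g p \<le> legendre K u p" if p: "p \<in> Y" for p
  proof
    assume "\<exists>x\<in>K. supports X u p x"
    then obtain x where x: "x \<in> K" "g p \<le> p \<bullet> x - u x" using supports_iff p K(2) by blast
    then show "g p \<le> legendre K u p"
      using legendre_upper[OF compact_imp_bounded[OF K(1)] bdd_below_image_compact[OF K(1) cont_u] x(1), of p]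
      by simp
  next
    assume *: "g p \<le> legendre K u p"
    obtain x where "x \<in> K" "legendre K u p = p \<bullet> x - u x"
      using legendre_attained[OF K(1,3) cont_u] by blast
    then show "\<exists>x\<in>K. supports X u p x" using * supports_iff p K(2) by (intro bexI[of _ x]) auto
  qed
  then show ?thesis unfolding contact_slopes_def by blast
qed

text \<open>
  The first variation of the cost. Lower \<open>u\<close> by \<open>t\<close> on \<open>K\<close>: the first term of the cost drops by
  \<open>c * t\<close> times the measure of \<open>K\<close>, while the transform rises by at most \<open>t\<close>, and only at slopes
  that touch \<open>u\<close> over \<open>K\<close> up to an error \<open>t\<close>. The lowered function is not continuous, so it is
  replaced by its double transform \<open>v\<close>, which costs no more; minimality of \<open>u\<close> gives the bound.
\<close>
lemma near_contact_measure:
  assumes K: "compact K" "K \<subseteq> X" "K \<noteq> {}" and t: "0 < t"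
  shows "c * measure lborel K \<le> measure lborel {p \<in> Y. g p \<le> legendre K u p + t}"
proof -
  define f where "f x = u x - t * indicator K x" for x
  define h where "h = legendre X f"
  define v where "v = legendre Y h"
  define P where "P = {p \<in> Y. g p \<le> legendre K u p + t}"
  obtain m where m: "\<And>x. x \<in> X \<Longrightarrow> m \<le> u x"
    using bdd_below_image_compact[OF X(1) cont_u] unfolding bdd_below_def by auto
  have bf: "bdd_below (f ` X)"
  proof (rule bdd_belowI2)
    fix x assume "x \<in> X"
    then show "m - t \<le> f x" using m[of x] t by (simp add: f_def indicator_def)
  qed
  have ch: "continuous_on S h" for S unfolding h_def by (rule cont_legendre_X[OF bf])
  have bh: "bdd_below (h ` Y)" using bdd_below_image_compact[OF Y(1) ch] .
  have cv: "continuous_on S v" for S unfolding v_def by (rule cont_legendre_Y[OF bh])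
  have bKu: "bdd_below (u ` K)" using bdd_below_image_compact[OF K(1) cont_u] .
  have cKu: "continuous_on S (legendre K u)" for S
    using continuous_on_legendre[OF compact_imp_bounded[OF K(1)] bKu K(3)] .
  have h_upper: "p \<bullet> x - f x \<le> h p" if "x \<in> X" for p x
    unfolding h_def by (rule legendre_upper[OF bounded_XY(1) bf that])
  have vf: "v x \<le> u x + (- t) * indicator K x" if x: "x \<in> X" for x
  proof -
    have "v x \<le> f x" unfolding v_def
      using h_upper[OF x] by (intro legendre_least[OF Y(2)]) (simp add: inner_commute algebra_simps)
    then show ?thesis unfolding f_def by simp
  qed
  have "closed P"
    unfolding P_def using Y(1) continuous_on_subset[OF g subset_UNIV] cKu
    by (intro continuous_on_closed_Collect_le compact_imp_closed continuous_on_add continuous_on_const)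
  moreover have "Y \<inter> P = P" unfolding P_def by blast
  ultimately have P: "compact P" "P \<subseteq> Y" using compact_Int_closed[OF Y(1), of P] by auto
  have hg: "legendre X v p \<le> g p + t * indicator P p" if p: "p \<in> Y" for p
  proof -
    have "legendre X v p \<le> h p"
    proof (rule legendre_least[OF X(2)])
      fix x assume "x \<in> X"
      have "x \<bullet> p - h p \<le> v x" unfolding v_def by (rule legendre_upper[OF bounded_XY(2) bh p])
      then show "p \<bullet> x - v x \<le> h p" by (simp add: inner_commute)
    qed
    also have "h p \<le> g p + t * indicator P p"
      unfolding h_def
    proof (rule legendre_least[OF X(2)])
      fix x assume x: "x \<in> X"
      have 1: "p \<bullet> x - u x \<le> g p"
        using legendre_upper[OF bounded_XY(1) bdd_below_image_compact[OF X(1) cont_u] x] conjugate[OF p] by metis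
      have 2: "p \<bullet> x - u x \<le> legendre K u p" if "x \<in> K"
        using legendre_upper[OF compact_imp_bounded[OF K(1)] bKu that] .
      show "p \<bullet> x - f x \<le> g p + t * indicator P p"
        using 1 2 t p unfolding f_def P_def by (auto simp: indicator_def)
    qed
    finally show ?thesis .
  qed
  have bv: "bdd_below (v ` X)" using bdd_below_image_compact[OF X(1) cv] .
  have "cost v \<le> cost u - c * (t * measure lborel K) + t * measure lborel P"
  proof -
    have "(LINT x:X|lborel. v x) \<le> (LINT x:X|lborel. u x) + (- t) * measure lborel K"
      by (rule set_integral_le_plus_indicator[OF X(1) cv cont_u K(1,2) vf])
    then have "c * (LINT x:X|lborel. v x) \<le> c * ((LINT x:X|lborel. u x) + (- t) * measure lborel K)"
      using c by (rule mult_left_mono)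
    moreover have "(LINT p:Y|lborel. legendre X v p) \<le> (LINT p:Y|lborel. g p) + t * measure lborel P"
      by (rule set_integral_le_plus_indicator[OF Y(1) cont_legendre_X[OF bv] _ P hg])
        (rule continuous_on_subset[OF g subset_UNIV])
    moreover have "(LINT p:Y|lborel. g p) = (LINT p:Y|lborel. legendre X u p)"
      using conjugate Y(1) by (intro set_lebesgue_integral_cong) (auto simp: borel_compact)
    ultimately show ?thesis unfolding cost_def by (simp add: algebra_simps)
  qed
  then have "t * (c * measure lborel K) \<le> t * measure lborel P"
    using minimal[OF bh] unfolding v_def[symmetric] by (simp add: algebra_simps)
  then show ?thesis using t unfolding P_def by simp
qed

lemma compact_contact_slopes:
  assumes "compact K" "K \<subseteq> X"
  shows "compact (Y \<inter> contact_slopes X u K)"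
  using closed_contact_slopes[OF assms cont_u] Y(1) by (rule compact_Int_closed[rotated])

text \<open>
  As \<open>t\<close> tends to 0, the slopes that nearly touch over \<open>K\<close> decrease to those that touch.
\<close>
lemma contact_measure_compact:
  assumes K: "compact K" "K \<subseteq> X"
  shows "c * measure lborel K \<le> measure lborel (Y \<inter> contact_slopes X u K)"
proof (cases "K = {}")
  case False
  define P where "P n = {p \<in> Y. g p \<le> legendre K u p + 1 / real (Suc n)}" for n
  have cKu: "continuous_on S (legendre K u)" for S
    using continuous_on_legendre[OF compact_imp_bounded[OF K(1)] bdd_below_image_compact[OF K(1) cont_u] False] .
  have "closed (P n)" for n
    unfolding P_def using Y(1) continuous_on_subset[OF g subset_UNIV] cKu
    by (intro continuous_on_closed_Collect_le compact_imp_closed continuous_on_add continuous_on_const)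
  then have P: "P n \<in> sets lborel" for n by (simp add: borel_closed)
  have fin: "emeasure lborel (P n) \<noteq> \<infinity>" for n
  proof -
    have "emeasure lborel (P n) \<le> emeasure lborel Y"
      using Y(1) by (intro emeasure_mono) (auto simp: P_def borel_compact)
    then show ?thesis using emeasure_compact_finite[OF Y(1)] by (auto simp: top_unique)
  qed
  have dec: "decseq P"
  proof (rule decseq_SucI)
    fix n
    have "1 / real (Suc (Suc n)) \<le> 1 / real (Suc n)" by (intro divide_left_mono) auto
    then show "P (Suc n) \<subseteq> P n" unfolding P_def by auto
  qed
  have near_iff: "(\<forall>n. g p \<le> legendre K u p + 1 / real (Suc n)) \<longleftrightarrow> g p \<le> legendre K u p" for p
  proof
    assume *: "\<forall>n. g p \<le> legendre K u p + 1 / real (Suc n)"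
    show "g p \<le> legendre K u p"
    proof (rule field_le_epsilon)
      fix e :: real assume "0 < e"
      then obtain n where "1 / real (Suc n) < e" using nat_approx_posE by metis
      then show "g p \<le> legendre K u p + e" using *[rule_format, of n] by simp
    qed
  next
    assume "g p \<le> legendre K u p"
    then show "\<forall>n. g p \<le> legendre K u p + 1 / real (Suc n)" by (auto intro: order_trans)
  qed
  have "(\<Inter>n. P n) = {p \<in> Y. g p \<le> legendre K u p}"
    by (rule set_eqI) (simp add: P_def near_iff del: of_nat_Suc)
  then have "(\<lambda>n. measure lborel (P n)) \<longlonglongrightarrow> measure lborel (Y \<inter> contact_slopes X u K)"
    using Lim_measure_decseq[OF _ dec fin] P contact_slopes_eq_Int_near[OF K False] by auto
  moreover have "c * measure lborel K \<le> measure lborel (P n)" for n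
    unfolding P_def by (rule near_contact_measure[OF K False]) simp
  ultimately show ?thesis
    by (intro LIMSEQ_le_const) blast+
qed simp

end

lemma inner_compact_approx:
  fixes E :: "'a::euclidean_space set"
  assumes "E \<in> sets borel" "bounded E" "0 < e"
  obtains K where "compact K" "K \<subseteq> E" "measure lebesgue E - e \<le> measure lebesgue K"
proof -
  have E: "E \<in> lmeasurable"
    using bounded_set_imp_lmeasurable[OF assms(2)] assms(1) by simp
  obtain K where K: "closed K" "K \<subseteq> E" "E - K \<in> lmeasurable" "emeasure lebesgue (E - K) < ennreal e"
    using sets_lebesgue_inner_closed[OF fmeasurableD[OF E] assms(3)] by blast
  have cK: "compact K" using K(1,2) assms(2) bounded_subset compact_eq_bounded_closed by blast
  have "measure lebesgue (E - K) = measure lebesgue E - measure lebesgue K"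
    using cK K(2) E by (intro measurable_measure_Diff) (auto intro: fmeasurableD lmeasurable_compact)
  moreover have "measure lebesgue (E - K) \<le> e"
    using K(3,4) assms(3) by (simp add: emeasure_eq_measure2 less_imp_le ennreal_less_iff)
  ultimately show ?thesis using that[OF cK K(2)] by simp
qed

context transport_potential
begin

text \<open>
  Inner regularity. The compact sets also provide a Borel set of slopes, whereas the set of all
  slopes over \<open>E\<close> is not known to be measurable yet.
\<close>
lemma contact_measure_ge:
  assumes E: "E \<in> sets borel" "E \<subseteq> X"
  obtains A where "A \<in> sets borel" "A \<subseteq> Y \<inter> contact_slopes X u E" "c * measure lebesgue E \<le> measure lebesgue A"
proof -
  have bE: "bounded E" using E(2) bounded_XY(1) bounded_subset by blast
  have "\<exists>K. compact K \<and> K \<subseteq> E \<and> measure lebesgue E - 1 / real (Suc n) \<le> measure lebesgue K" for n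
    using inner_compact_approx[OF E(1) bE, of "1 / real (Suc n)"] by (metis of_nat_0_less_iff zero_less_Suc zero_less_divide_1_iff)
  then obtain K where K: "\<And>n. compact (K n)" "\<And>n. K n \<subseteq> E"
    "\<And>n. measure lebesgue E - 1 / real (Suc n) \<le> measure lebesgue (K n)" by metis
  define A where "A = (\<Union>n. Y \<inter> contact_slopes X u (K n))"
  have KX: "K n \<subseteq> X" for n using K(2) E(2) by blast
  have cS: "compact (Y \<inter> contact_slopes X u (K n))" for n by (rule compact_contact_slopes[OF K(1) KX])
  have A: "A \<in> sets borel"
    unfolding A_def by (intro sets.countable_UN) (auto intro!: borel_compact cS)
  have AY: "A \<subseteq> Y" unfolding A_def by blast
  then have Am: "A \<in> lmeasurable"
    using A bounded_set_imp_lmeasurable[OF bounded_subset[OF bounded_XY(2)]] by simp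
  have "c * (measure lebesgue E - 1 / real (Suc n)) \<le> measure lebesgue A" for n
  proof -
    have "c * (measure lebesgue E - 1 / real (Suc n)) \<le> c * measure lebesgue (K n)"
      using K(3) c by (rule mult_left_mono)
    also have "\<dots> \<le> measure lebesgue (Y \<inter> contact_slopes X u (K n))"
      using contact_measure_compact[OF K(1) KX, of n] K(1)[of n] cS[of n]
      by (simp add: measure_completion borel_compact)
    also have "\<dots> \<le> measure lebesgue A"
      using Am cS[of n] by (intro measure_mono_fmeasurable) (auto simp: A_def borel_compact)
    finally show ?thesis .
  qed
  moreover have "(\<lambda>n. c * (measure lebesgue E - 1 / real (Suc n))) \<longlonglongrightarrow> c * (measure lebesgue E - 0)"
    using LIMSEQ_inverse_real_of_nat by (intro tendsto_intros) (simp add: inverse_eq_divide)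
  ultimately have "c * (measure lebesgue E - 0) \<le> measure lebesgue A"
    by (intro LIMSEQ_le_const2) blast+
  moreover have "A \<subseteq> Y \<inter> contact_slopes X u E"
    unfolding A_def contact_slopes_def using K(2) by blast
  ultimately show ?thesis using that A by simp
qed

text \<open>
  The Monge-Ampere equation for \<open>u\<close>. The lower bound holds for \<open>E\<close> and for its complement. The two
  sets of slopes overlap only in a null set, and the lower bounds add up to the measure of \<open>Y\<close>, so
  both are equalities. Measurability follows because the slopes over \<open>E\<close> differ from a Borel set by
  a null set.
\<close>
theorem contact_measure:
  assumes E: "E \<in> sets borel" "E \<subseteq> X"
  shows "Y \<inter> contact_slopes X u E \<in> lmeasurable \<and>
    measure lebesgue (Y \<inter> contact_slopes X u E) = c * measure lebesgue E"
proof -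
  have F: "X - E \<in> sets borel" "X - E \<subseteq> X" using X(1) E by (auto simp: borel_compact)
  obtain A where A: "A \<in> sets borel" "A \<subseteq> Y \<inter> contact_slopes X u E" "c * measure lebesgue E \<le> measure lebesgue A"
    using contact_measure_ge[OF E] .
  obtain B where B: "B \<in> sets borel" "B \<subseteq> Y \<inter> contact_slopes X u (X - E)"
    "c * measure lebesgue (X - E) \<le> measure lebesgue B"
    using contact_measure_ge[OF F] .
  define N where "N = {p \<in> Y. \<exists>x\<in>X. \<exists>y\<in>X. x \<noteq> y \<and> supports X u p x \<and> supports X u p y}"
  have N: "negligible N"
    unfolding N_def by (rule negligible_double_contact[OF X(1) cont_u bounded_XY(2)])
  have common: "contact_slopes X u E \<inter> contact_slopes X u (X - E) \<inter> Y \<subseteq> N"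
  proof
    fix p assume "p \<in> contact_slopes X u E \<inter> contact_slopes X u (X - E) \<inter> Y"
    then obtain x y where "x \<in> E" "supports X u p x" "y \<in> X - E" "supports X u p y" "p \<in> Y"
      unfolding contact_slopes_def by auto
    moreover from this have "x \<in> X" "y \<in> X" "x \<noteq> y" using E(2) by auto
    ultimately show "p \<in> N" unfolding N_def by (intro CollectI conjI bexI[of _ x] bexI[of _ y])
  qed
  have lm: "S \<in> lmeasurable" if "S \<in> sets borel" "S \<subseteq> T" "bounded T" for S T :: "'a set"
    using bounded_set_imp_lmeasurable[OF bounded_subset[OF that(3,2)]] that(1) by simp
  have AY: "A \<subseteq> Y" and BY: "B \<subseteq> Y" using A(2) B(2) by auto
  note Am = lm[OF A(1) AY bounded_XY(2)] and Bm = lm[OF B(1) BY bounded_XY(2)]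
  have Ym: "Y \<in> lmeasurable" and Xm: "X \<in> lmeasurable" using X(1) Y(1) by (simp_all add: lmeasurable_compact)
  note Em = lm[OF E bounded_XY(1)]
  have AB0: "measure lebesgue (A \<inter> B) = 0"
    using negligible_subset[OF N, of "A \<inter> B"] common A(2) B(2) by (intro negligible_imp_measure0) blast
  have AB: "measure lebesgue (A \<union> B) = measure lebesgue A + measure lebesgue B"
    using measure_Un3[OF Am Bm] AB0 by simp
  have "measure lebesgue (A \<union> B) \<le> measure lebesgue Y"
    using A(2) B(2) Am Bm Ym by (intro measure_mono_fmeasurable) auto
  moreover have "measure lebesgue Y = c * (measure lebesgue E + measure lebesgue (X - E))"
  proof -
    have "measure lebesgue (X - E) = measure lebesgue X - measure lebesgue E"
      using Xm Em E(2) by (intro measurable_measure_Diff) (auto simp: fmeasurableD)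
    then show ?thesis using mass X(1) Y(1) by (simp add: measure_completion borel_compact)
  qed
  ultimately have eq: "measure lebesgue A = c * measure lebesgue E"
    and full: "measure lebesgue (A \<union> B) = measure lebesgue Y"
    using A(3) B(3) AB by (auto simp: algebra_simps)
  have "measure lebesgue (Y - (A \<union> B)) = 0"
    using measurable_measure_Diff[of Y lebesgue "A \<union> B"] A(2) B(2) Am Bm Ym full
    by (auto simp: fmeasurableD)
  then have "negligible (Y - (A \<union> B))"
    using Am Bm Ym by (simp add: negligible_iff_measure fmeasurable.Diff fmeasurable.Un)
  then have "negligible ((Y - (A \<union> B)) \<union> N)" using N by simp
  moreover have "(A - Y \<inter> contact_slopes X u E) \<union> (Y \<inter> contact_slopes X u E - A) \<subseteq> (Y - (A \<union> B)) \<union> N"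
    using A(2) B(2) common by blast
  ultimately have "negligible ((A - Y \<inter> contact_slopes X u E) \<union> (Y \<inter> contact_slopes X u E - A))"
    by (rule negligible_subset)
  then show ?thesis
    using lmeasurable_negligible_symdiff[OF Am] measure_negligible_symdiff[OF Am] eq by metis
qed

end

text \<open>
  Replacing a minimiser by its double transform over \<open>X\<close> and \<open>Y\<close> does not increase the cost.
\<close>
theorem transport_potential_exists:
  fixes X Y :: "'a::euclidean_space set"
  assumes "balanced_transport X Y c"
  obtains u g where "transport_potential X Y c u g"
proof -
  interpret balanced_transport X Y c by fact
  obtain u0 where u0: "continuous_on X u0" "\<And>h. bdd_below (h ` Y) \<Longrightarrow> cost u0 \<le> cost (legendre Y h)"
    by (rule cost_minimiser_exists) (rule that)
  define g where "g = legendre X u0"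
  define u where "u = legendre Y g"
  note b0 = bdd_below_image_compact[OF X(1) u0(1)]
  have cg: "continuous_on S g" for S unfolding g_def by (rule cont_legendre_X[OF b0])
  have bg: "bdd_below (g ` Y)" using bdd_below_image_compact[OF Y(1) cg] .
  have cu: "continuous_on S u" for S unfolding u_def by (rule cont_legendre_Y[OF bg])
  have bu: "bdd_below (u ` X)" using bdd_below_image_compact[OF X(1) cu] .
  have le: "u x \<le> u0 x" if x: "x \<in> X" for x
    unfolding u_def
  proof (rule legendre_least[OF Y(2)])
    fix p show "x \<bullet> p - g p \<le> u0 x"
      using legendre_upper[OF bounded_XY(1) b0 x, of p] unfolding g_def by (simp add: inner_commute)
  qed
  have conj: "legendre X u p = g p" if p: "p \<in> Y" for p
  proof (rule antisym)
    show "legendre X u p \<le> g p"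
    proof (rule legendre_least[OF X(2)])
      fix x show "p \<bullet> x - u x \<le> g p"
        using legendre_upper[OF bounded_XY(2) bg p, of x] unfolding u_def by (simp add: inner_commute)
    qed
    have "legendre X u0 p \<le> legendre X u p + 0"
      by (rule legendre_le_plus[OF bounded_XY(1) bu X(2)]) (simp add: le)
    then show "g p \<le> legendre X u p" unfolding g_def by simp
  qed
  have "cost u \<le> cost u0"
  proof -
    have "(LINT x:X|lborel. u x) \<le> (LINT x:X|lborel. u0 x) + 0 * measure lborel X"
      by (rule set_integral_le_plus_indicator[OF X(1) cu u0(1) X(1) order_refl]) (simp add: le)
    moreover have "(LINT p:Y|lborel. legendre X u p) = (LINT p:Y|lborel. legendre X u0 p)"
    proof (rule set_lebesgue_integral_cong)
      show "Y \<in> sets lborel" using borel_compact[OF Y(1)] by simp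
      show "\<forall>p. p \<in> Y \<longrightarrow> legendre X u p = legendre X u0 p"
        using conj unfolding g_def by blast
    qed
    ultimately show ?thesis unfolding cost_def using c by (simp add: mult_left_mono)
  qed
  then have "cost u \<le> cost (legendre Y h)" if "bdd_below (h ` Y)" for h
    using u0(2)[OF that] by simp
  then have "transport_potential X Y c u g"
    using cg u_def conj by unfold_locales
  then show ?thesis by (rule that)
qed

section \<open>Lattice bases of planes and unimodular triples\<close>

lemma inner_3: "x \<bullet> y = x $ 0 * y $ 0 + x $ 1 * y $ 1 + x $ 2 * y $ (2::3)" for x y :: "real^3"
proof -
  have "v $ 3 = v $ 0" for v :: "real^3" by (rule arg_cong[of 3 0 "($) v"]) simp
  then show ?thesis by (simp add: inner_vec_def sum_3)
qed

lemma int_lattice_inner: "x \<in> int_lattice \<Longrightarrow> y \<in> int_lattice \<Longrightarrow> x \<bullet> y \<in> \<int>"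
  unfolding int_lattice_def inner_3 by auto

lemma int_lattice_cross: "x \<in> int_lattice \<Longrightarrow> y \<in> int_lattice \<Longrightarrow> cross3 x y \<in> int_lattice"
  unfolding int_lattice_def by (auto simp: forall_3 cross_components)

definition triple :: "real^3 \<Rightarrow> real^3 \<Rightarrow> real^3 \<Rightarrow> real" where
  "triple x y z = x \<bullet> cross3 y z"

lemma triple_expand:
  "triple x y z *\<^sub>R v = (v \<bullet> cross3 y z) *\<^sub>R x + (v \<bullet> cross3 z x) *\<^sub>R y + (v \<bullet> cross3 x y) *\<^sub>R z"
  by (simp add: triple_def vec_eq_iff forall_3 cross_components inner_vec_def sum_3) algebra

lemma triple_expand_dual:
  "triple x y z *\<^sub>R v = (v \<bullet> x) *\<^sub>R cross3 y z + (v \<bullet> y) *\<^sub>R cross3 z x + (v \<bullet> z) *\<^sub>R cross3 x y"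
  by (simp add: triple_def vec_eq_iff forall_3 cross_components inner_vec_def sum_3) algebra

text \<open>
  Two of the three vectors dual to a unimodular triple \<open>x, y, n\<close>: pairing with \<open>x\<close> and \<open>y\<close> reads off
  integral coordinates.
\<close>
lemma Z_basis_cross_products:
  assumes "x \<in> int_lattice" "y \<in> int_lattice" "n \<in> int_lattice" and u: "\<bar>triple x y n\<bar> = 1"
  shows "Z_basis (perp_lattice n) (cross3 y n) (cross3 n x)"
  unfolding Z_basis_def
proof (intro conjI ballI)
  let ?\<delta> = "triple x y n"
  show "cross3 y n \<in> perp_lattice n" "cross3 n x \<in> perp_lattice n"
    using assms unfolding perp_lattice_def by (auto intro: int_lattice_cross simp: dot_cross_self)
  have dd: "?\<delta> * ?\<delta> = 1" using u by (metis abs_mult_self_eq mult_1)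
  have di: "?\<delta> \<in> \<int>" using assms unfolding triple_def by (intro int_lattice_inner int_lattice_cross)
  fix v assume "v \<in> perp_lattice n"
  then have v: "v \<in> int_lattice" "v \<bullet> n = 0" unfolding perp_lattice_def by auto
  obtain i :: int where i: "of_int i = ?\<delta> * (v \<bullet> x)"
    using di int_lattice_inner[OF v(1) assms(1)] by (metis Ints_cases Ints_mult)
  obtain j :: int where j: "of_int j = ?\<delta> * (v \<bullet> y)"
    using di int_lattice_inner[OF v(1) assms(2)] by (metis Ints_cases Ints_mult)
  show "\<exists>!(i::int, j::int). v = of_int i *\<^sub>R cross3 y n + of_int j *\<^sub>R cross3 n x"
  proof (rule ex1I[of _ "(i, j)"])
    have "(?\<delta> * ?\<delta>) *\<^sub>R v = ?\<delta> *\<^sub>R (?\<delta> *\<^sub>R v)" by simp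
    also have "?\<delta> *\<^sub>R v = (v \<bullet> x) *\<^sub>R cross3 y n + (v \<bullet> y) *\<^sub>R cross3 n x"
      using triple_expand_dual[of x y n v] v(2) by simp
    finally show "case (i, j) of (i, j) \<Rightarrow> v = of_int i *\<^sub>R cross3 y n + of_int j *\<^sub>R cross3 n x"
      using dd i j by (simp add: scaleR_right_distrib)
  next
    fix ij :: "int \<times> int"
    assume *: "case ij of (i, j) \<Rightarrow> v = of_int i *\<^sub>R cross3 y n + of_int j *\<^sub>R cross3 n x"
    obtain i' j' where ij: "ij = (i', j')" by (cases ij)
    then have ve: "v = of_int i' *\<^sub>R cross3 y n + of_int j' *\<^sub>R cross3 n x" using * by simp
    have "v \<bullet> x = of_int i' * ?\<delta>"
      unfolding ve triple_def by (simp add: inner_vec_def sum_3 cross_components algebra_simps)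
    moreover have "v \<bullet> y = of_int j' * ?\<delta>"
      unfolding ve triple_def by (simp add: inner_vec_def sum_3 cross_components algebra_simps)
    ultimately have "real_of_int i' = of_int i" "real_of_int j' = of_int j"
      using i j dd by (simp_all add: mult.commute mult.left_commute)
    then show "ij = (i, j)" using ij by simp
  qed
qed

text \<open>
  Any two bases of the plane lattice differ by an integral matrix. Comparing the cross products
  for the basis from a unimodular triple shows that its determinant divides 1.
\<close>
lemma Z_basis_perp_cross:
  assumes "x \<in> int_lattice" "y \<in> int_lattice" "n \<in> int_lattice" and u: "\<bar>triple x y n\<bar> = 1"
    and Z: "Z_basis (perp_lattice n) c1 c2"
  shows "cross3 c1 c2 = n \<or> cross3 c1 c2 = - n"
proof -
  let ?\<delta> = "triple x y n"
  have d: "cross3 y n \<in> perp_lattice n" "cross3 n x \<in> perp_lattice n"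
    using Z_basis_cross_products[OF assms(1-4)] unfolding Z_basis_def by auto
  have c: "c1 \<in> int_lattice" "c2 \<in> int_lattice" using Z unfolding Z_basis_def perp_lattice_def by auto
  have "\<exists>i j. v = of_int i *\<^sub>R c1 + of_int j *\<^sub>R c2" if "v \<in> perp_lattice n" for v
    using Z that unfolding Z_basis_def by fast
  then obtain i j k l where d1: "cross3 y n = of_int i *\<^sub>R c1 + of_int j *\<^sub>R c2"
    and d2: "cross3 n x = of_int k *\<^sub>R c1 + of_int l *\<^sub>R c2" using d by metis
  define D where "D = i * l - j * k"
  have "?\<delta> *\<^sub>R n = cross3 (cross3 y n) (cross3 n x)"
    by (simp add: triple_def vec_eq_iff forall_3 cross_components inner_vec_def sum_3) algebra
  also have "\<dots> = of_int D *\<^sub>R cross3 c1 c2"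
    unfolding d1 d2 D_def by (simp add: vec_eq_iff forall_3 cross_components algebra_simps)
  finally have eq: "?\<delta> *\<^sub>R n = of_int D *\<^sub>R cross3 c1 c2" .
  have "triple x y (cross3 c1 c2) \<in> \<int>"
    using assms c unfolding triple_def by (intro int_lattice_inner int_lattice_cross)
  then obtain t where t: "triple x y (cross3 c1 c2) = of_int t" by (auto elim: Ints_cases)
  have lin: "triple x y (s *\<^sub>R v) = s * triple x y v" for s v
    unfolding triple_def by (simp add: cross_mult_right)
  have dd: "?\<delta> * ?\<delta> = 1" using u by (metis abs_mult_self_eq mult_1)
  have "1 = of_int D * triple x y (cross3 c1 c2)" using arg_cong[OF eq, of "triple x y"] dd unfolding lin by simp
  then have "1 = D * t" unfolding t by (metis of_int_1 of_int_eq_iff of_int_mult)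
  then have "D = 1 \<or> D = -1" by (metis zmult_eq_1_iff)
  moreover have "?\<delta> = 1 \<or> ?\<delta> = -1" using u by linarith
  ultimately show ?thesis using eq by auto
qed

text \<open>
  If \<open>n\<close> is a multiple of a lattice vector, the factor divides \<open>triple x y n\<close>.
\<close>
lemma primitive_if_unimodular:
  assumes "x \<in> int_lattice" "y \<in> int_lattice" "n \<in> int_lattice" and u: "\<bar>triple x y n\<bar> = 1"
  shows "primitive n"
  unfolding primitive_def
proof (intro conjI ballI allI impI)
  fix n' k assume n': "n' \<in> int_lattice" "n = of_int k *\<^sub>R n'"
  have "triple x y n' \<in> \<int>" unfolding triple_def using assms n' by (intro int_lattice_inner int_lattice_cross)
  then obtain t where t: "triple x y n' = of_int t" by (auto elim: Ints_cases)
  have "triple x y n = of_int k * triple x y n'" unfolding n'(2) triple_def by (simp add: cross_mult_right)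
  then have "real_of_int \<bar>k * t\<bar> = 1" using u t by simp
  then have "\<bar>k * t\<bar> = 1" by linarith
  then show "\<bar>k\<bar> = 1" by (auto simp: abs_mult zmult_eq_1_iff)
qed (use assms in simp)

lemma affine2_vimage_measure:
  fixes z u v :: "real^2" and S :: "(real^2) set"
  assumes det: "\<bar>u $ 1 * v $ 2 - u $ 2 * v $ 1\<bar> = 1" and S: "S \<in> lmeasurable"
  shows "{p :: real^2. z + p $ 1 *\<^sub>R u + p $ 2 *\<^sub>R v \<in> S} \<in> lmeasurable"
    and "measure lebesgue {p :: real^2. z + p $ 1 *\<^sub>R u + p $ 2 *\<^sub>R v \<in> S} = measure lebesgue S"
proof -
  define \<delta> where "\<delta> = u $ 1 * v $ 2 - u $ 2 * v $ 1"
  define g :: "real^2 \<Rightarrow> real^2" where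
    "g q = (\<chi> i. if i = 1 then (v $ 2 * q $ 1 - v $ 1 * q $ 2) / \<delta> else (u $ 1 * q $ 2 - u $ 2 * q $ 1) / \<delta>)" for q
  have d0: "\<delta> \<noteq> 0" using det \<delta>_def by auto
  have ling: "linear g"
    by (rule linearI) (simp_all add: g_def vec_eq_iff add_divide_distrib diff_divide_distrib algebra_simps)
  have gq: "g q $ 1 = (v $ 2 * q $ 1 - v $ 1 * q $ 2) / \<delta>" "g q $ 2 = (u $ 1 * q $ 2 - u $ 2 * q $ 1) / \<delta>" for q
    by (simp_all add: g_def)
  have fg: "g q $ 1 *\<^sub>R u + g q $ 2 *\<^sub>R v = q" for q
    using d0 unfolding gq by (simp add: vec_eq_iff forall_2 field_simps) (simp add: \<delta>_def algebra_simps)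
  have gf: "g (p $ 1 *\<^sub>R u + p $ 2 *\<^sub>R v) = p" for p
    using d0 by (simp add: vec_eq_iff forall_2 gq field_simps) (simp add: \<delta>_def algebra_simps)
  have eq: "{p :: real^2. z + p $ 1 *\<^sub>R u + p $ 2 *\<^sub>R v \<in> S} = g ` ((+) (- z) ` S)"
  proof (intro set_eqI iffI)
    fix p :: "real^2" assume "p \<in> {p :: real^2. z + p $ 1 *\<^sub>R u + p $ 2 *\<^sub>R v \<in> S}"
    then have "p $ 1 *\<^sub>R u + p $ 2 *\<^sub>R v \<in> (+) (- z) ` S" by (auto simp: image_iff algebra_simps intro!: bexI)
    then show "p \<in> g ` ((+) (- z) ` S)" using gf[of p] by (metis image_eqI)
  next
    fix p :: "real^2" assume "p \<in> g ` ((+) (- z) ` S)"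
    then obtain s where s: "s \<in> S" "p = g (- z + s)" by blast
    then show "p \<in> {p :: real^2. z + p $ 1 *\<^sub>R u + p $ 2 *\<^sub>R v \<in> S}"
      using fg[of "- z + s"] by (simp add: add.assoc)
  qed
  have T: "(+) (- z) ` S \<in> lmeasurable" "measure lebesgue ((+) (- z) ` S) = measure lebesgue S"
    by (rule measurable_translation[OF S], rule measure_translation)
  show "{p :: real^2. z + p $ 1 *\<^sub>R u + p $ 2 *\<^sub>R v \<in> S} \<in> lmeasurable"
    unfolding eq by (rule measurable_linear_image[OF ling T(1)])
  have "det (matrix g) = 1 / \<delta>"
    using d0 by (simp add: det_2 matrix_def gq axis_def field_simps) (simp add: \<delta>_def algebra_simps)
  then show "measure lebesgue {p :: real^2. z + p $ 1 *\<^sub>R u + p $ 2 *\<^sub>R v \<in> S} = measure lebesgue S"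
    unfolding eq measure_linear_image[OF ling T(1)] T(2) using det by (simp add: \<delta>_def[symmetric])
qed

section \<open>Tetrahedra given by vertices and facet normals\<close>

lemma convex_combination_in_hull:
  assumes "\<And>i. 0 \<le> c i" "sum c (UNIV::'i::finite set) = 1" "\<And>i. c i \<noteq> 0 \<Longrightarrow> a i \<in> S"
  shows "(\<Sum>i\<in>UNIV. c i *\<^sub>R a i) \<in> convex hull S"
proof -
  have "(\<Sum>i\<in>UNIV. c i *\<^sub>R a i) = (\<Sum>i\<in>{i. c i \<noteq> 0}. c i *\<^sub>R a i)"
    by (rule sum.mono_neutral_right) auto
  moreover have "sum c UNIV = sum c {i. c i \<noteq> 0}" by (rule sum.mono_neutral_right) auto
  moreover have "(\<Sum>i\<in>{i. c i \<noteq> 0}. c i *\<^sub>R a i) \<in> convex hull S"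
    using calculation assms by (intro convex_sum) (auto intro: hull_inc)
  ultimately show ?thesis by simp
qed

text \<open>
  A tetrahedron with vertices \<open>a i\<close>. The facet opposite \<open>a i\<close> lies in the plane where the pairing with
  \<open>b i\<close> is 1, and \<open>k i\<close> is the lattice distance of \<open>a i\<close> from that plane. The functions
  \<open>(1 - x \<bullet> b i) / k i\<close> are the barycentric coordinates. The last assumption makes \<open>b i\<close> primitive, in
  a form suited to determinants. The polar tetrahedron is an instance with \<open>a\<close> and \<open>b\<close> exchanged.
\<close>
locale tetrahedron =
  fixes a b :: "4 \<Rightarrow> real^3" and k :: "4 \<Rightarrow> real"
  assumes pairing: "a j \<bullet> b i = (if i = j then 1 - k i else 1)"
    and k: "1 < k i"
    and bary: "(\<Sum>i\<in>UNIV. (1 - x \<bullet> b i) / k i) = 1"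
    and bary_sum: "(\<Sum>i\<in>UNIV. ((1 - x \<bullet> b i) / k i) *\<^sub>R a i) = x"
    and lattice: "a i \<in> int_lattice" "b i \<in> int_lattice"
    and complement: "\<exists>x\<in>int_lattice. \<exists>y\<in>int_lattice. \<bar>triple x y (b i)\<bar> = 1"
begin

definition P :: "(real^3) set" where
  "P = convex hull range a"

definition face :: "4 \<Rightarrow> (real^3) set" where
  "face i = {x \<in> P. x \<bullet> b i = 1}"

lemma k_pos: "0 < k i" using k[of i] by simp

lemma inj_a: "inj a"
proof (rule injI)
  fix i j assume "a i = a j"
  then have "a i \<bullet> b i = a j \<bullet> b i" by simp
  then show "i = j" using pairing[of i i] pairing[of j i] k_pos[of i] by (auto split: if_splits)
qed

lemma P_eq: "P = {x. \<forall>i. x \<bullet> b i \<le> 1}"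
proof
  have "convex {x. \<forall>i. x \<bullet> b i \<le> 1}"
  proof -
    have "{x. \<forall>i. x \<bullet> b i \<le> 1} = (\<Inter>i. {x. b i \<bullet> x \<le> 1})" by (auto simp: inner_commute)
    then show ?thesis by (auto intro!: convex_INT convex_halfspace_le)
  qed
  moreover have "range a \<subseteq> {x. \<forall>i. x \<bullet> b i \<le> 1}" using pairing k_pos[THEN less_imp_le] by auto
  ultimately show "P \<subseteq> {x. \<forall>i. x \<bullet> b i \<le> 1}" unfolding P_def by (rule hull_minimal[rotated])
  show "{x. \<forall>i. x \<bullet> b i \<le> 1} \<subseteq> P"
  proof safe
    fix x assume x: "\<forall>i. x \<bullet> b i \<le> 1"
    have "(\<Sum>i\<in>UNIV. ((1 - x \<bullet> b i) / k i) *\<^sub>R a i) \<in> convex hull range a"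
      using x bary k_pos by (intro convex_combination_in_hull) (auto intro!: divide_nonneg_pos)
    then show "x \<in> P" unfolding P_def bary_sum .
  qed
qed

lemma a_in_P: "a i \<in> P"
  unfolding P_def by (rule hull_inc) simp

lemma compact_P: "compact P" and convex_P: "convex P" and closed_P: "closed P"
proof -
  show "compact P" unfolding P_def by (intro finite_imp_compact_convex_hull) simp
  then show "closed P" by (rule compact_imp_closed)
  show "convex P" unfolding P_def by simp
qed

lemma b_nonzero: "b i \<noteq> 0"
proof
  assume "b i = 0"
  then show False using pairing[of _ i] by (metis inner_zero_right k less_irrefl diff_0_right diff_eq_diff_eq zero_neq_one eq_iff_diff_eq_0)
qed

lemma interior_P: "interior P = {x. \<forall>i. x \<bullet> b i < 1}"
proof
  show "interior P \<subseteq> {x. \<forall>i. x \<bullet> b i < 1}"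
  proof safe
    fix x i assume x: "x \<in> interior P"
    have "interior P \<subseteq> interior {x. b i \<bullet> x \<le> 1}"
      by (rule interior_mono) (auto simp: P_eq inner_commute)
    then show "x \<bullet> b i < 1" using x interior_halfspace_le[OF b_nonzero, of i 1] by (auto simp: inner_commute)
  qed
  have "{x. \<forall>i. x \<bullet> b i < 1} = (\<Inter>i. {x. b i \<bullet> x < 1})" by (auto simp: inner_commute)
  then have "open {x. \<forall>i. x \<bullet> b i < 1}" by (auto intro!: open_INT open_halfspace_lt)
  then show "{x. \<forall>i. x \<bullet> b i < 1} \<subseteq> interior P"
    by (rule interior_maximal[rotated]) (auto simp: P_eq intro: less_imp_le)
qed

lemma frontier_P: "frontier P = {x \<in> P. \<exists>i. x \<bullet> b i = 1}"
proof -
  have "frontier P = P - interior P" unfolding frontier_def using closed_P by simp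
  moreover have "(\<exists>i. x \<bullet> b i = 1) \<longleftrightarrow> \<not> (\<forall>i. x \<bullet> b i < 1)" if "x \<in> P" for x
    using that unfolding P_eq mem_Collect_eq by (metis le_less less_irrefl)
  ultimately show ?thesis unfolding interior_P by blast
qed

lemma frontier_eq_faces: "frontier P = (\<Union>i. face i)"
  unfolding frontier_P face_def by auto

lemma affine_independent: "\<not> affine_dependent (range a)"
proof
  assume "affine_dependent (range a)"
  then obtain U where U: "sum U (range a) = 0" "\<exists>v\<in>range a. U v \<noteq> 0" "(\<Sum>v\<in>range a. U v *\<^sub>R v) = 0"
    using affine_dependent_explicit_finite[of "range a"] by auto
  have "U (a i) = 0" for i
  proof -
    have 1: "(\<Sum>j\<in>UNIV. U (a j)) = 0" using U(1) inj_a by (simp add: sum.reindex)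
    have 2: "(\<Sum>j\<in>UNIV. U (a j) *\<^sub>R a j) = 0" using U(3) inj_a by (simp add: sum.reindex)
    have "(\<Sum>j\<in>UNIV. U (a j) * (a j \<bullet> b i)) = (\<Sum>j\<in>UNIV. U (a j) *\<^sub>R a j) \<bullet> b i"
      by (simp add: inner_sum_left)
    then have "(\<Sum>j\<in>UNIV. U (a j) * (a j \<bullet> b i)) = 0" unfolding 2 by simp
    then have "(\<Sum>j\<in>UNIV. U (a j) * (1 - a j \<bullet> b i)) = 0"
      using 1 by (simp add: algebra_simps sum_subtractf)
    moreover have "(\<Sum>j\<in>UNIV. U (a j) * (1 - a j \<bullet> b i)) = (\<Sum>j\<in>UNIV. if j = i then U (a i) * k i else 0)"
      by (rule sum.cong) (auto simp: pairing)
    ultimately show ?thesis using k_pos[of i] by simp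
  qed
  then show False using U(2) by auto
qed

lemma face_eq_hull: "face i = convex hull (a ` (- {i}))"
proof
  show "convex hull (a ` (- {i})) \<subseteq> face i"
  proof (rule hull_minimal)
    show "a ` (- {i}) \<subseteq> face i" unfolding face_def P_def by (auto simp: pairing intro: hull_inc)
    have "face i = P \<inter> {x. b i \<bullet> x = 1}" unfolding face_def by (auto simp: inner_commute)
    then show "convex (face i)" using convex_P by (auto intro: convex_Int convex_hyperplane)
  qed
  show "face i \<subseteq> convex hull (a ` (- {i}))"
  proof
    fix x assume x: "x \<in> face i"
    have "(\<Sum>j\<in>UNIV. ((1 - x \<bullet> b j) / k j) *\<^sub>R a j) \<in> convex hull (a ` (- {i}))"
    proof (rule convex_combination_in_hull)
      show "0 \<le> (1 - x \<bullet> b j) / k j" for j using x k_pos[of j] by (auto simp: face_def P_eq)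
      show "a j \<in> a ` (- {i})" if "(1 - x \<bullet> b j) / k j \<noteq> 0" for j
        using that x by (cases "j = i") (auto simp: face_def)
    qed (rule bary)
    then show "x \<in> convex hull (a ` (- {i}))" unfolding bary_sum .
  qed
qed

lemma facet_of_P: "F facet_of P \<longleftrightarrow> (\<exists>i. F = face i)"
proof -
  have "range a - {a i} = a ` (- {i})" for i using inj_a by (auto dest: injD)
  moreover have "a ` (- {i}) \<noteq> {}" for i
  proof -
    have "i + 1 \<in> - {i}" by simp
    then show ?thesis by blast
  qed
  ultimately show ?thesis
    unfolding P_def facet_of_convex_hull_affine_independent[OF affine_independent] face_eq_hull
    by (auto simp: convex_hull_eq_empty)
qed

lemma inj_face: "face i = face j \<Longrightarrow> i = j"
proof (rule ccontr)
  assume eq: "face i = face j" and ne: "i \<noteq> j"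
  have "a j \<in> face i" using ne a_in_P unfolding face_def by (auto simp: pairing)
  then have "a j \<in> face j" using eq by simp
  then show False using k_pos[of j] by (simp add: face_def pairing)
qed

lemma facets_P: "{F. F facet_of P} = range face" and inj_on_face: "inj face"
  using facet_of_P inj_face by (auto intro: injI)

lemma rel_interior_face: "rel_interior (face i) = {x. x \<bullet> b i = 1 \<and> (\<forall>j. j \<noteq> i \<longrightarrow> x \<bullet> b j < 1)}"
proof -
  have "\<not> affine_dependent (a ` (- {i}))"
    using affine_independent affine_independent_subset by (metis image_mono subset_UNIV)
  note ri = rel_interior_convex_hull_explicit[OF this]
  have injm: "inj_on a (- {i})" using inj_a by (rule inj_on_subset) simp
  show ?thesis
  proof (intro set_eqI iffI)
    fix x assume "x \<in> rel_interior (face i)"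
    then obtain u where u: "\<And>y. y \<in> a ` (- {i}) \<Longrightarrow> 0 < u y" "sum u (a ` (- {i})) = 1"
      "(\<Sum>y\<in>a ` (- {i}). u y *\<^sub>R y) = x" unfolding face_eq_hull ri by blast
    have s1: "(\<Sum>j\<in>- {i}. u (a j)) = 1" using u(2) injm by (simp add: sum.reindex)
    have xs: "x = (\<Sum>j\<in>- {i}. u (a j) *\<^sub>R a j)" using u(3) injm by (simp add: sum.reindex)
    have xb: "x \<bullet> b l = 1 - (if l \<noteq> i then u (a l) * k l else 0)" for l
    proof -
      have "x \<bullet> b l = (\<Sum>j\<in>- {i}. u (a j) * (a j \<bullet> b l))" unfolding xs by (simp add: inner_sum_left)
      also have "\<dots> = (\<Sum>j\<in>- {i}. u (a j) - (if j = l then u (a l) * k l else 0))"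
        by (rule sum.cong) (auto simp: pairing algebra_simps)
      also have "\<dots> = 1 - (\<Sum>j\<in>- {i}. if j = l then u (a l) * k l else 0)" by (simp add: sum_subtractf s1)
      also have "(\<Sum>j\<in>- {i}. if j = l then u (a l) * k l else 0) = (if l \<noteq> i then u (a l) * k l else 0)"
        by (subst sum.delta) auto
      finally show ?thesis .
    qed
    have "0 < u (a j) * k j" if "j \<noteq> i" for j using u(1) that k_pos by (intro mult_pos_pos) auto
    then show "x \<in> {x. x \<bullet> b i = 1 \<and> (\<forall>j. j \<noteq> i \<longrightarrow> x \<bullet> b j < 1)}" using xb by auto
  next
    fix x assume x: "x \<in> {x. x \<bullet> b i = 1 \<and> (\<forall>j. j \<noteq> i \<longrightarrow> x \<bullet> b j < 1)}"
    define u where "u y = (1 - x \<bullet> b (inv a y)) / k (inv a y)" for y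
    have ua: "u (a j) = (1 - x \<bullet> b j) / k j" for j unfolding u_def using inj_a by simp
    have zero: "(1 - x \<bullet> b i) / k i = 0" using x by simp
    have "(\<Sum>y\<in>a ` (- {i}). u y) = 1"
    proof -
      have "(\<Sum>y\<in>a ` (- {i}). u y) = (\<Sum>j\<in>- {i}. (1 - x \<bullet> b j) / k j)" using injm by (simp add: sum.reindex ua)
      also have "\<dots> = (\<Sum>j\<in>UNIV. (1 - x \<bullet> b j) / k j)" using zero by (intro sum.mono_neutral_left) auto
      finally show ?thesis using bary by simp
    qed
    moreover have "(\<Sum>y\<in>a ` (- {i}). u y *\<^sub>R y) = x"
    proof -
      have "(\<Sum>y\<in>a ` (- {i}). u y *\<^sub>R y) = (\<Sum>j\<in>- {i}. ((1 - x \<bullet> b j) / k j) *\<^sub>R a j)" using injm by (simp add: sum.reindex ua)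
      also have "\<dots> = (\<Sum>j\<in>UNIV. ((1 - x \<bullet> b j) / k j) *\<^sub>R a j)" using zero by (intro sum.mono_neutral_left) auto
      finally show ?thesis using bary_sum by simp
    qed
    moreover have "\<forall>y\<in>a ` (- {i}). 0 < u y" using x k_pos by (auto simp: ua)
    ultimately show "x \<in> rel_interior (face i)" unfolding face_eq_hull ri by blast
  qed
qed

lemma primitive_b: "primitive (b i)"
  using complement[of i] primitive_if_unimodular lattice(2) by blast

text \<open>
  A linear function that is maximal exactly on the facet is determined by its value \<open>\<beta>\<close> on the facet
  through barycentric coordinates, hence a positive multiple of \<open>b i\<close>. The factor is integral because
  \<open>b i\<close> belongs to a unimodular triple.
\<close>
lemma primitive_normal_face: "primitive_normal P (face i) = b i"
  unfolding primitive_normal_def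
proof (rule the_equality)
  show "primitive (b i) \<and> (\<exists>\<beta>. (\<forall>x\<in>P. b i \<bullet> x \<le> \<beta>) \<and> face i = {x \<in> P. b i \<bullet> x = \<beta>})"
    using primitive_b by (auto simp: P_eq face_def inner_commute)
next
  fix n assume "primitive n \<and> (\<exists>\<beta>. (\<forall>x\<in>P. n \<bullet> x \<le> \<beta>) \<and> face i = {x \<in> P. n \<bullet> x = \<beta>})"
  then obtain \<beta> where n: "primitive n" "\<And>x. x \<in> P \<Longrightarrow> n \<bullet> x \<le> \<beta>" "face i = {x \<in> P. n \<bullet> x = \<beta>}" by blast
  have nj: "n \<bullet> a j = \<beta>" if "j \<noteq> i" for j
  proof -
    have "a j \<in> face i" using that a_in_P unfolding face_def by (auto simp: pairing)
    then show ?thesis unfolding n(3) by simp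
  qed
  have "a i \<notin> face i" using k_pos[of i] by (auto simp: face_def pairing)
  then have "a i \<notin> {x \<in> P. n \<bullet> x = \<beta>}" using n(3) by simp
  then have ni: "n \<bullet> a i < \<beta>" using n(2)[OF a_in_P[of i]] a_in_P[of i] by simp
  have nx: "n \<bullet> x = \<beta> - ((1 - x \<bullet> b i) / k i) * (\<beta> - n \<bullet> a i)" for x
  proof -
    have "n \<bullet> x = n \<bullet> (\<Sum>j\<in>UNIV. ((1 - x \<bullet> b j) / k j) *\<^sub>R a j)" by (simp add: bary_sum)
    also have "\<dots> = (\<Sum>j\<in>UNIV. ((1 - x \<bullet> b j) / k j) * (n \<bullet> a j))" by (simp add: inner_sum_right)
    also have "\<dots> = (\<Sum>j\<in>UNIV. ((1 - x \<bullet> b j) / k j) * \<beta> - (if j = i then ((1 - x \<bullet> b i) / k i) * (\<beta> - n \<bullet> a i) else 0))"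
    proof (rule sum.cong)
      fix j show "(1 - x \<bullet> b j) / k j * (n \<bullet> a j)
        = (1 - x \<bullet> b j) / k j * \<beta> - (if j = i then (1 - x \<bullet> b i) / k i * (\<beta> - n \<bullet> a i) else 0)"
        by (cases "j = i") (simp_all add: nj right_diff_distrib)
    qed simp
    also have "\<dots> = (\<Sum>j\<in>UNIV. (1 - x \<bullet> b j) / k j) * \<beta> - ((1 - x \<bullet> b i) / k i) * (\<beta> - n \<bullet> a i)"
      by (simp add: sum_subtractf sum_distrib_right)
    finally show ?thesis by (simp add: bary)
  qed
  define \<gamma> where "\<gamma> = (\<beta> - n \<bullet> a i) / k i"
  have \<gamma>pos: "0 < \<gamma>" unfolding \<gamma>_def using ni k_pos[of i] by simp
  have n\<gamma>: "n \<bullet> x = \<beta> - (1 - x \<bullet> b i) * \<gamma>" for x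
    unfolding \<gamma>_def nx[of x] by (simp only: times_divide_eq_left times_divide_eq_right)
  have \<gamma>: "\<gamma> = \<beta>" using n\<gamma>[of 0] by simp
  have \<beta>pos: "0 < \<beta>" using \<gamma>pos \<gamma> by simp
  have "n \<bullet> x = (\<beta> *\<^sub>R b i) \<bullet> x" for x
    unfolding n\<gamma> \<gamma> by (simp add: algebra_simps inner_commute)
  then have nb: "n = \<beta> *\<^sub>R b i" by (rule vector_eq_rdot[THEN iffD1, OF allI])
  obtain x y where xy: "x \<in> int_lattice" "y \<in> int_lattice" "\<bar>triple x y (b i)\<bar> = 1" using complement by blast
  have "n \<in> int_lattice" using n(1) unfolding primitive_def by blast
  then have "triple x y n \<in> \<int>" unfolding triple_def using xy by (intro int_lattice_inner int_lattice_cross)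
  moreover have "triple x y n = \<beta> * triple x y (b i)" unfolding nb triple_def by (simp add: cross_mult_right)
  ultimately have "\<beta> * triple x y (b i) \<in> \<int>" by simp
  moreover have "triple x y (b i) = 1 \<or> triple x y (b i) = - 1" using xy(3) by linarith
  ultimately have "\<beta> \<in> \<int>" by (elim disjE) (simp_all add: minus_in_Ints_iff)
  then obtain m where m: "\<beta> = of_int m" by (rule Ints_cases)
  have "\<forall>n'\<in>int_lattice. \<forall>k::int. n = of_int k *\<^sub>R n' \<longrightarrow> \<bar>k\<bar> = 1"
    using n(1) unfolding primitive_def by simp
  from this[rule_format, OF lattice(2), of m i] have "\<bar>m\<bar> = 1" using nb unfolding m by simp
  then have "\<beta> = 1" using \<beta>pos unfolding m by linarith
  then show "n = b i" using nb by simp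
qed

lemma dual_polytope_P: "dual_polytope P = {n. \<forall>i. n \<bullet> a i \<le> 1}"
proof
  show "dual_polytope P \<subseteq> {n. \<forall>i. n \<bullet> a i \<le> 1}"
  proof safe
    fix n i assume "n \<in> dual_polytope P"
    then have "a i \<bullet> n \<le> 1" using a_in_P unfolding dual_polytope_def by simp
    then show "n \<bullet> a i \<le> 1" by (simp add: inner_commute)
  qed
  show "{n. \<forall>i. n \<bullet> a i \<le> 1} \<subseteq> dual_polytope P"
  proof safe
    fix n assume n: "\<forall>i. n \<bullet> a i \<le> 1"
    have "range a \<subseteq> {x. n \<bullet> x \<le> 1}" using n by blast
    then have sub: "P \<subseteq> {x. n \<bullet> x \<le> 1}"
      unfolding P_def by (rule hull_minimal) (rule convex_halfspace_le)
    show "n \<in> dual_polytope P"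
      unfolding dual_polytope_def
    proof (intro CollectI ballI)
      fix m assume "m \<in> P"
      then have "n \<bullet> m \<le> 1" using sub by blast
      then show "m \<bullet> n \<le> 1" by (simp add: inner_commute)
    qed
  qed
qed

end

section \<open>Planar charts of facets and of slopes\<close>

lemma beta_components: "beta m1 m2 n $ 1 = m1 \<bullet> n" "beta m1 m2 n $ 2 = m2 \<bullet> n"
  unfolding beta_def by (simp_all add: vector_2)

lemma linear_beta: "linear (beta m1 m2)"
  by (rule linearI) (simp_all add: vec_eq_iff forall_2 beta_components inner_add_right)

lemma inner_beta: "p \<bullet> beta m1 m2 n = (p $ 1 *\<^sub>R m1 + p $ 2 *\<^sub>R m2) \<bullet> n"
  by (simp add: inner_vec_def[of p] sum_2 beta_components inner_add_left)

text \<open>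
  By Cramer's rule, the inverse of \<open>beta w1 w2\<close> on the plane where the pairing with \<open>n\<close> is 1.
\<close>
definition plane_section :: "real^3 \<Rightarrow> real^3 \<Rightarrow> real^3 \<Rightarrow> real^2 \<Rightarrow> real^3" where
  "plane_section w1 w2 n q =
    (1 / triple w1 w2 n) *\<^sub>R (q $ 1 *\<^sub>R cross3 w2 n + q $ 2 *\<^sub>R cross3 n w1 + cross3 w1 w2)"

lemma plane_section_beta:
  assumes "triple w1 w2 n \<noteq> 0" "y \<bullet> n = 1"
  shows "plane_section w1 w2 n (beta w1 w2 y) = y"
proof -
  have "plane_section w1 w2 n (beta w1 w2 y) = (1 / triple w1 w2 n) *\<^sub>R (triple w1 w2 n *\<^sub>R y)"
    unfolding plane_section_def triple_expand_dual[of w1 w2 n y] beta_components assms(2)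
    by (simp add: inner_commute)
  then show ?thesis using assms(1) by simp
qed

lemma plane_section_in_plane:
  assumes "triple w1 w2 n \<noteq> 0"
  shows "plane_section w1 w2 n q \<bullet> n = 1"
proof -
  have "cross3 w1 w2 \<bullet> n = triple w1 w2 n"
    by (simp add: triple_def inner_vec_def sum_3 cross_components algebra_simps)
  then show ?thesis using assms unfolding plane_section_def
    by (simp add: inner_add_left dot_cross_self)
qed

lemma beta_plane_section:
  assumes "triple w1 w2 n \<noteq> 0"
  shows "beta w1 w2 (plane_section w1 w2 n q) = q"
proof -
  have "w1 \<bullet> cross3 w2 n = triple w1 w2 n" "w2 \<bullet> cross3 n w1 = triple w1 w2 n"
    by (simp_all add: triple_def inner_vec_def sum_3 cross_components algebra_simps)
  then show ?thesis using assms
    by (simp add: vec_eq_iff forall_2 beta_components plane_section_def inner_add_right dot_cross_self)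
qed

lemma beta_image_eq:
  assumes "triple w1 w2 n \<noteq> 0" "\<And>y. y \<in> E \<Longrightarrow> y \<bullet> n = 1"
  shows "beta w1 w2 ` E = plane_section w1 w2 n -` E"
  using plane_section_beta[OF assms(1)] beta_plane_section[OF assms(1)] assms(2)
  by (auto simp: image_iff) (metis)

lemma continuous_plane_section: "continuous_on S (plane_section w1 w2 n)"
  unfolding plane_section_def by (intro continuous_intros)

lemma beta_image_borel:
  assumes "triple w1 w2 n \<noteq> 0" "\<And>y. y \<in> E \<Longrightarrow> y \<bullet> n = 1" "E \<in> sets borel"
  shows "beta w1 w2 ` E \<in> sets borel"
proof -
  have "plane_section w1 w2 n \<in> borel_measurable borel"
    by (intro borel_measurable_continuous_onI continuous_plane_section)
  from measurable_sets[OF this assms(3)] show ?thesis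
    by (subst beta_image_eq[where n = n, OF assms(1,2)]) simp_all
qed

lemma beta_image_lmeasurable:
  assumes "triple w1 w2 n \<noteq> 0" "\<And>y. y \<in> E \<Longrightarrow> y \<bullet> n = 1" "E \<in> sets borel" "bounded E"
  shows "beta w1 w2 ` E \<in> lmeasurable"
proof -
  have "bounded (beta w1 w2 ` E)" using assms(4) linear_beta
    by (intro bounded_linear_image) (simp_all add: linear_conv_bounded_linear)
  then show ?thesis using beta_image_borel[OF assms(1-3)] by (intro bounded_set_imp_lmeasurable) simp_all
qed

text \<open>
  The set whose measure the Monge-Ampere equation prescribes, in terms of slopes in \<open>real^3\<close>.
\<close>
definition slope_set :: "(real^3 \<Rightarrow> real) \<Rightarrow> (real^3) set \<Rightarrow> (real^3) set \<Rightarrow> real^3 \<Rightarrow> real^3 \<Rightarrow> (real^2) set" where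
  "slope_set \<Psi> R E m1 m2 = {p. \<exists>n\<in>E. supports R \<Psi> (p $ 1 *\<^sub>R m1 + p $ 2 *\<^sub>R m2) n}"

lemma subgradients_eq_slope_set:
  assumes inj: "inj_on (beta m1 m2) R" and E: "E \<subseteq> R"
  shows "(\<Union>x\<in>beta m1 m2 ` E. subgradient (beta m1 m2 ` R) (\<Psi> \<circ> inv_into R (beta m1 m2)) x) = slope_set \<Psi> R E m1 m2"
proof -
  have inv: "inv_into R (beta m1 m2) (beta m1 m2 n) = n" if "n \<in> R" for n
    using inj that by (rule inv_into_f_f)
  have "p \<in> subgradient (beta m1 m2 ` R) (\<Psi> \<circ> inv_into R (beta m1 m2)) (beta m1 m2 n)
      \<longleftrightarrow> supports R \<Psi> (p $ 1 *\<^sub>R m1 + p $ 2 *\<^sub>R m2) n" if "n \<in> E" for p n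
    using that E inv unfolding subgradient_def supports_def
    by (auto simp: linear_diff[OF linear_beta, symmetric] inner_beta)
  then show ?thesis unfolding slope_set_def by blast
qed

text \<open>
  On \<open>R\<close> only slopes modulo \<open>a\<close> matter, and both \<open>m1, m2\<close> and \<open>k1, k2\<close> are unimodular coordinates on
  that quotient; \<open>co\<close> writes the first pair in terms of the second.
\<close>
lemma slope_set_chart_change:
  assumes R: "\<And>y. y \<in> R \<Longrightarrow> y \<bullet> a = 1" and E: "E \<subseteq> R"
    and m: "\<bar>triple m1 m2 a\<bar> = 1" and k: "\<bar>triple k1 k2 a\<bar> = 1"
    and S: "slope_set \<Psi> R E k1 k2 \<in> lmeasurable"
  shows "slope_set \<Psi> R E m1 m2 \<in> lmeasurable"
    and "measure lebesgue (slope_set \<Psi> R E m1 m2) = measure lebesgue (slope_set \<Psi> R E k1 k2)"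
proof -
  define t where "t = triple k1 k2 a"
  have tt: "t * t = 1" using k unfolding t_def by (metis abs_mult_self_eq mult_1)
  define co :: "real^3 \<Rightarrow> real^2" where "co m = t *\<^sub>R beta (cross3 k2 a) (cross3 a k1) m" for m
  have co: "m \<bullet> y = (co m $ 1 *\<^sub>R k1 + co m $ 2 *\<^sub>R k2) \<bullet> y" if "y \<bullet> a = 0" for m y
  proof -
    have "m \<bullet> y = (t * t) * (m \<bullet> y)" using tt by simp
    also have "\<dots> = t * ((t *\<^sub>R m) \<bullet> y)" by simp
    also have "t *\<^sub>R m = (m \<bullet> cross3 k2 a) *\<^sub>R k1 + (m \<bullet> cross3 a k1) *\<^sub>R k2 + (m \<bullet> cross3 k1 k2) *\<^sub>R a"
      unfolding t_def by (rule triple_expand)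
    also have "t * (\<dots> \<bullet> y) = (co m $ 1 *\<^sub>R k1 + co m $ 2 *\<^sub>R k2) \<bullet> y"
      using that by (simp add: co_def beta_components inner_add_left inner_commute algebra_simps)
    finally show ?thesis .
  qed
  have colin: "co (r *\<^sub>R x + s *\<^sub>R y) = r *\<^sub>R co x + s *\<^sub>R co y" for r s x y
    unfolding co_def using linear_beta[of "cross3 k2 a" "cross3 a k1"]
    by (simp add: linear_add linear_scale scaleR_right_distrib mult.commute)
  have supp: "supports R \<Psi> (p $ 1 *\<^sub>R m1 + p $ 2 *\<^sub>R m2) n \<longleftrightarrow>
      supports R \<Psi> ((0 + p $ 1 *\<^sub>R co m1 + p $ 2 *\<^sub>R co m2) $ 1 *\<^sub>R k1 + (0 + p $ 1 *\<^sub>R co m1 + p $ 2 *\<^sub>R co m2) $ 2 *\<^sub>R k2) n"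
    if "n \<in> E" for p :: "real^2" and n
  proof -
    have "(y - n) \<bullet> a = 0" if "y \<in> R" for y using R[OF that] R[of n] \<open>n \<in> E\<close> E by (auto simp: inner_diff_left)
    from co[OF this, of _ "p $ 1 *\<^sub>R m1 + p $ 2 *\<^sub>R m2"] show ?thesis
      unfolding supports_def by (simp add: colin)
  qed
  have eq: "slope_set \<Psi> R E m1 m2 = {p. 0 + p $ 1 *\<^sub>R co m1 + p $ 2 *\<^sub>R co m2 \<in> slope_set \<Psi> R E k1 k2}"
    unfolding slope_set_def using supp by auto
  have "co m1 $ 1 * co m2 $ 2 - co m1 $ 2 * co m2 $ 1 = (t * t) *
     ((cross3 k2 a \<bullet> m1) * (cross3 a k1 \<bullet> m2) - (cross3 a k1 \<bullet> m1) * (cross3 k2 a \<bullet> m2))"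
    by (simp add: co_def beta_components algebra_simps)
  also have "\<dots> = (cross3 k2 a \<bullet> m1) * (cross3 a k1 \<bullet> m2) - (cross3 a k1 \<bullet> m1) * (cross3 k2 a \<bullet> m2)"
    unfolding tt by simp
  also have "\<dots> = triple k1 k2 a * triple m1 m2 a"
    unfolding triple_def inner_vec_def sum_3 cross_components inner_real_def by algebra
  finally have det: "\<bar>co m1 $ 1 * co m2 $ 2 - co m1 $ 2 * co m2 $ 1\<bar> = 1"
    using m k by (simp add: abs_mult)
  show "slope_set \<Psi> R E m1 m2 \<in> lmeasurable"
    unfolding eq by (rule affine2_vimage_measure(1)[OF det S])
  show "measure lebesgue (slope_set \<Psi> R E m1 m2) = measure lebesgue (slope_set \<Psi> R E k1 k2)"
    unfolding eq by (rule affine2_vimage_measure(2)[OF det S])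
qed

context tetrahedron
begin

lemma face_plane: "y \<in> face i \<Longrightarrow> y \<bullet> b i = 1"
  unfolding face_def by simp

lemma compact_face: "compact (face i)"
  unfolding face_eq_hull by (intro finite_imp_compact_convex_hull) simp

text \<open>
  The lattice area of a piece of a facet is the area of its image under any unimodular projection
  \<open>beta w1 w2\<close>, whichever chart the choice operator picks.
\<close>
lemma emeasure_facet_chart:
  assumes w: "\<bar>triple w1 w2 (b i)\<bar> = 1" and E: "E \<in> sets borel" "E \<subseteq> face i"
  shows "emeasure lborel (facet_chart P (face i) -` E) = ennreal (measure lebesgue (beta w1 w2 ` E))"
proof -
  define Q where "Q = (\<lambda>(x, c1, c2). x \<in> face i \<and> Z_basis (perp_lattice (b i)) c1 c2)"
  have "\<exists>t. Q t"
  proof -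
    have "a (i + 1) \<in> face i" using a_in_P unfolding face_def by (simp add: pairing)
    moreover obtain x y where "x \<in> int_lattice" "y \<in> int_lattice" "\<bar>triple x y (b i)\<bar> = 1" using complement[of i] by auto
    note Z_basis_cross_products[OF this(1,2) lattice(2) this(3)]
    ultimately show ?thesis unfolding Q_def by auto
  qed
  then have "Q (Eps Q)" by (rule someI_ex)
  moreover obtain x c1 c2 where s: "Eps Q = (x, c1, c2)" by (rule prod_cases3)
  ultimately have x: "x \<in> face i" and Z: "Z_basis (perp_lattice (b i)) c1 c2"
    unfolding Q_def by auto
  have chart: "facet_chart P (face i) p = x + p $ 1 *\<^sub>R c1 + p $ 2 *\<^sub>R c2" for p
    using s unfolding facet_chart_def primitive_normal_face Q_def by simp
  have c: "c1 \<bullet> b i = 0" "c2 \<bullet> b i = 0" using Z unfolding Z_basis_def perp_lattice_def by auto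
  have chart_plane: "facet_chart P (face i) p \<bullet> b i = 1" for p
    unfolding chart using c face_plane[OF x] by (simp add: inner_add_left)
  have t0: "triple w1 w2 (b i) \<noteq> 0" using w by auto
  have EP: "y \<bullet> b i = 1" if "y \<in> E" for y using E(2) that face_plane by blast
  define z u v where "z = beta w1 w2 x" and "u = beta w1 w2 c1" and "v = beta w1 w2 c2"
  have bc: "beta w1 w2 (facet_chart P (face i) p) = z + p $ 1 *\<^sub>R u + p $ 2 *\<^sub>R v" for p
    unfolding chart z_def u_def v_def using linear_beta[of w1 w2] by (simp add: linear_add linear_scale)
  have eq: "facet_chart P (face i) -` E = {p. z + p $ 1 *\<^sub>R u + p $ 2 *\<^sub>R v \<in> beta w1 w2 ` E}"
  proof (intro set_eqI iffI)
    fix p assume "p \<in> facet_chart P (face i) -` E"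
    then show "p \<in> {p. z + p $ 1 *\<^sub>R u + p $ 2 *\<^sub>R v \<in> beta w1 w2 ` E}"
      using imageI[of "facet_chart P (face i) p" E "beta w1 w2"] bc[of p] by simp
  next
    fix p :: "real^2" assume "p \<in> {p. z + p $ 1 *\<^sub>R u + p $ 2 *\<^sub>R v \<in> beta w1 w2 ` E}"
    then obtain y where y: "y \<in> E" "beta w1 w2 (facet_chart P (face i) p) = beta w1 w2 y" using bc[of p] by auto
    have "facet_chart P (face i) p = plane_section w1 w2 (b i) (beta w1 w2 (facet_chart P (face i) p))"
      by (rule plane_section_beta[OF t0 chart_plane, symmetric])
    also have "\<dots> = y" unfolding y(2) by (rule plane_section_beta[OF t0 EP[OF y(1)]])
    finally show "p \<in> facet_chart P (face i) -` E" using y(1) by simp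
  qed
  have bE: "bounded E" using E(2) compact_imp_bounded[OF compact_face] bounded_subset by blast
  have S: "beta w1 w2 ` E \<in> lmeasurable" by (rule beta_image_lmeasurable[OF t0 EP E(1) bE])
  obtain x' y' where xy: "x' \<in> int_lattice" "y' \<in> int_lattice" "\<bar>triple x' y' (b i)\<bar> = 1" using complement[of i] by auto
  have "u $ 1 * v $ 2 - u $ 2 * v $ 1 = cross3 w1 w2 \<bullet> cross3 c1 c2"
    unfolding u_def v_def beta_components dot_cross by (simp add: mult.commute)
  moreover have "cross3 c1 c2 = b i \<or> cross3 c1 c2 = - b i"
    by (rule Z_basis_perp_cross[OF xy(1,2) lattice(2) xy(3) Z])
  moreover have "cross3 w1 w2 \<bullet> b i = triple w1 w2 (b i)"
    by (simp add: triple_def inner_vec_def sum_3 cross_components algebra_simps)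
  ultimately have det: "\<bar>u $ 1 * v $ 2 - u $ 2 * v $ 1\<bar> = 1" using w by auto
  note T = affine2_vimage_measure[OF det S, of z, folded eq]
  have Tb: "facet_chart P (face i) -` E \<in> sets lborel"
    using measurable_sets[OF facet_chart_measurable E(1), of P "face i"] by simp
  have "emeasure lborel (facet_chart P (face i) -` E) = emeasure lebesgue (facet_chart P (face i) -` E)"
    using Tb by simp
  also have "\<dots> = ennreal (measure lebesgue (facet_chart P (face i) -` E))"
    by (rule emeasure_eq_measure2[OF T(1)])
  finally show ?thesis unfolding T(2) .
qed

lemma emeasure_boundary_sum:
  assumes "E \<in> sets borel"
  shows "emeasure (boundary_measure P) E = (\<Sum>j\<in>UNIV. emeasure lborel (facet_chart P (face j) -` (E \<inter> face j)))"
  unfolding emeasure_boundary_measure[OF closed_P convex_P assms] facets_P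
  by (subst sum.reindex[OF inj_on_face]) simp

lemma emeasure_boundary_face:
  assumes w: "\<bar>triple w1 w2 (b i)\<bar> = 1" and E: "E \<in> sets borel" "E \<subseteq> rel_interior (face i)"
  shows "emeasure (boundary_measure P) E = ennreal (measure lebesgue (beta w1 w2 ` E))"
proof -
  have Ef: "E \<subseteq> face i" using E(2) rel_interior_subset by blast
  have "E \<inter> face j = {}" if "j \<noteq> i" for j
  proof -
    have "y \<bullet> b j < 1" if "y \<in> E" for y using E(2) that \<open>j \<noteq> i\<close> unfolding rel_interior_face by blast
    then show ?thesis using face_plane[of _ j] by fastforce
  qed
  then have "emeasure (boundary_measure P) E = (\<Sum>j\<in>UNIV. if j = i then emeasure lborel (facet_chart P (face i) -` E) else 0)"
    unfolding emeasure_boundary_sum[OF E(1)] using Ef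
    by (intro sum.cong refl) (simp add: Int_absorb2 del: vimage_Int)
  also have "\<dots> = emeasure lborel (facet_chart P (face i) -` E)" by simp
  finally show ?thesis using emeasure_facet_chart[OF w E(1) Ef] by simp
qed

lemma emeasure_boundary_frontier:
  assumes w: "\<And>i. \<bar>triple w1 w2 (b i)\<bar> = 1"
  shows "emeasure (boundary_measure P) (frontier P) = ennreal (\<Sum>i\<in>UNIV. measure lebesgue (beta w1 w2 ` face i))"
proof -
  have "frontier P \<in> sets borel" by (simp add: borel_closed)
  moreover have "frontier P \<inter> face j = face j" for j unfolding frontier_eq_faces by blast
  moreover have "face j \<in> sets borel" for j using compact_face by (simp add: borel_compact)
  ultimately show ?thesis
    using emeasure_facet_chart[OF w] by (simp add: emeasure_boundary_sum sum_ennreal)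
qed

end

section \<open>The equation on a polar pair of tetrahedra\<close>

locale polar_tetrahedra = D: tetrahedron a b k + N: tetrahedron b a k for a b :: "4 \<Rightarrow> real^3" and k
begin

lemma dual_P: "dual_polytope D.P = N.P"
  unfolding D.dual_polytope_P N.P_eq ..

lemma vertex_in_face: "a i \<in> D.face j \<longleftrightarrow> i \<noteq> j"
  using D.a_in_P D.k_pos[of j] unfolding D.face_def by (auto simp: D.pairing)

lemma triple_Z_basis:
  assumes "j \<noteq> i" "Z_basis (perp_lattice (b j)) m1 m2"
  shows "\<bar>triple m1 m2 (a i)\<bar> = 1"
proof -
  obtain x y where xy: "x \<in> int_lattice" "y \<in> int_lattice" "\<bar>triple x y (b j)\<bar> = 1"
    using D.complement[of j] by auto
  have "cross3 m1 m2 = b j \<or> cross3 m1 m2 = - b j"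
    by (rule Z_basis_perp_cross[OF xy(1,2) D.lattice(2) xy(3) assms(2)])
  moreover have "triple m1 m2 (a i) = a i \<bullet> cross3 m1 m2"
    by (simp add: triple_def inner_vec_def sum_3 cross_components algebra_simps)
  ultimately show ?thesis using D.pairing[of i j] assms(1) by auto
qed

abbreviation (input) facet_interior :: "4 \<Rightarrow> (real^3) set" where
  "facet_interior i \<equiv> rel_interior (N.face i)"

lemma facet_interior_plane: "y \<in> facet_interior i \<Longrightarrow> y \<bullet> a i = 1"
  unfolding N.rel_interior_face by simp

lemma inj_on_beta:
  assumes "\<bar>triple m1 m2 (a i)\<bar> = 1"
  shows "inj_on (beta m1 m2) (facet_interior i)"
proof (rule inj_on_inverseI)
  fix y assume "y \<in> facet_interior i"
  moreover have "triple m1 m2 (a i) \<noteq> 0" using assms by auto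
  ultimately show "plane_section m1 m2 (a i) (beta m1 m2 y) = y"
    using plane_section_beta facet_interior_plane by blast
qed

text \<open>
  The facets and their normals are known, so the equation becomes a statement about slope sets in
  which \<open>i\<close> and \<open>j\<close> number the facets \<open>\<tau>\<close> and \<open>\<sigma>\<close>.
\<close>
lemma MA_equation_iff:
  "MA_equation D.P \<Psi> \<nu> \<longleftrightarrow> (\<forall>i j m1 m2 E. j \<noteq> i \<longrightarrow> Z_basis (perp_lattice (b j)) m1 m2 \<longrightarrow>
     E \<in> sets borel \<longrightarrow> E \<subseteq> facet_interior i \<longrightarrow>
     slope_set \<Psi> (facet_interior i) E m1 m2 \<in> sets lebesgue \<and>
     emeasure lebesgue (slope_set \<Psi> (facet_interior i) E m1 m2) = emeasure \<nu> E)"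
proof -
  let ?S = "\<lambda>\<tau> m1 m2 E. \<Union>x\<in>beta m1 m2 ` E.
    subgradient (beta m1 m2 ` rel_interior \<tau>) (\<Psi> \<circ> inv_into (rel_interior \<tau>) (beta m1 m2)) x"
  have eq: "?S (N.face i) m1 m2 E = slope_set \<Psi> (facet_interior i) E m1 m2"
    if "j \<noteq> i" "Z_basis (perp_lattice (b j)) m1 m2" "E \<subseteq> facet_interior i" for i j m1 m2 E
    by (rule subgradients_eq_slope_set[OF inj_on_beta[OF triple_Z_basis[OF that(1,2)]] that(3)])
  show ?thesis
    unfolding MA_equation_def dual_P D.facet_of_P N.facet_of_P Let_def
  proof (intro iffI allI impI; (elim exE)?)
    fix i j m1 m2 E
    assume MA: "\<forall>\<tau> \<sigma> m1 m2 E. (\<exists>i. \<tau> = N.face i) \<longrightarrow> (\<exists>i. \<sigma> = D.face i) \<longrightarrow> primitive_normal N.P \<tau> \<in> \<sigma> \<longrightarrow>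
        Z_basis (perp_lattice (primitive_normal D.P \<sigma>)) m1 m2 \<longrightarrow> E \<in> sets borel \<longrightarrow> E \<subseteq> rel_interior \<tau> \<longrightarrow>
        (?S \<tau> m1 m2 E) \<in> sets lebesgue \<and>
        emeasure lebesgue (?S \<tau> m1 m2 E) = emeasure \<nu> E"
    assume A: "j \<noteq> i" "Z_basis (perp_lattice (b j)) m1 m2" "E \<in> sets borel" "E \<subseteq> facet_interior i"
    have 1: "\<exists>i'. N.face i = N.face i'" and 2: "\<exists>i'. D.face j = D.face i'" by auto
    have 3: "primitive_normal N.P (N.face i) \<in> D.face j"
      unfolding N.primitive_normal_face vertex_in_face using A(1) by simp
    have 4: "Z_basis (perp_lattice (primitive_normal D.P (D.face j))) m1 m2"
      unfolding D.primitive_normal_face by (rule A(2))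
    show "slope_set \<Psi> (facet_interior i) E m1 m2 \<in> sets lebesgue \<and>
      emeasure lebesgue (slope_set \<Psi> (facet_interior i) E m1 m2) = emeasure \<nu> E"
      using MA[rule_format, OF 1 2 3 4 A(3,4)] unfolding eq[OF A(1,2,4)] .
  next
    fix \<tau> \<sigma> m1 m2 E i j
    assume R: "\<forall>i j m1 m2 E. j \<noteq> i \<longrightarrow> Z_basis (perp_lattice (b j)) m1 m2 \<longrightarrow>
       E \<in> sets borel \<longrightarrow> E \<subseteq> facet_interior i \<longrightarrow>
       slope_set \<Psi> (facet_interior i) E m1 m2 \<in> sets lebesgue \<and>
       emeasure lebesgue (slope_set \<Psi> (facet_interior i) E m1 m2) = emeasure \<nu> E"
    assume A: "primitive_normal N.P \<tau> \<in> \<sigma>" "Z_basis (perp_lattice (primitive_normal D.P \<sigma>)) m1 m2"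
      "E \<in> sets borel" "E \<subseteq> rel_interior \<tau>" "\<tau> = N.face i" "\<sigma> = D.face j"
    have ij: "j \<noteq> i" using A(1) unfolding A(5,6) N.primitive_normal_face vertex_in_face by simp
    have Z: "Z_basis (perp_lattice (b j)) m1 m2" using A(2) unfolding A(6) D.primitive_normal_face .
    show "(?S \<tau> m1 m2 E) \<in> sets lebesgue \<and>
        emeasure lebesgue (?S \<tau> m1 m2 E) = emeasure \<nu> E"
      using R[rule_format, OF ij Z A(3)] A(4) unfolding A(5) eq[OF ij Z A(4)[unfolded A(5)]] by blast
  qed
qed

text \<open>
  By \<open>slope_set_chart_change\<close>, one pair \<open>g1, g2\<close> serves for all facets, even where it is not a basis
  attached to one of the facets allowed in the equation.
\<close>
lemma MA_imp_slope_measure: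
  assumes MA: "MA_equation D.P \<Psi> \<nu>" and E: "E \<in> sets borel" "E \<subseteq> facet_interior i"
    and fin: "emeasure \<nu> E = ennreal r" "0 \<le> r" and g: "\<bar>triple g1 g2 (a i)\<bar> = 1"
  shows "slope_set \<Psi> (facet_interior i) E g1 g2 \<in> lmeasurable"
    and "measure lebesgue (slope_set \<Psi> (facet_interior i) E g1 g2) = r"
proof -
  have ij: "i + 1 \<noteq> i" by simp
  obtain x y where xy: "x \<in> int_lattice" "y \<in> int_lattice" "\<bar>triple x y (b (i + 1))\<bar> = 1"
    using D.complement[of "i + 1"] by auto
  define m1 m2 where "m1 = cross3 y (b (i + 1))" and "m2 = cross3 (b (i + 1)) x"
  have Z: "Z_basis (perp_lattice (b (i + 1))) m1 m2"
    unfolding m1_def m2_def by (rule Z_basis_cross_products[OF xy(1,2) D.lattice(2) xy(3)])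
  have S: "slope_set \<Psi> (facet_interior i) E m1 m2 \<in> sets lebesgue"
    "emeasure lebesgue (slope_set \<Psi> (facet_interior i) E m1 m2) = ennreal r"
    using MA[unfolded MA_equation_iff, rule_format, OF ij Z E] fin by simp_all
  have Sm: "slope_set \<Psi> (facet_interior i) E m1 m2 \<in> lmeasurable"
    using S by (simp add: fmeasurable_def)
  have "measure lebesgue (slope_set \<Psi> (facet_interior i) E m1 m2) = r"
    unfolding measure_def S(2) using fin(2) by simp
  with slope_set_chart_change[OF facet_interior_plane E(2) g triple_Z_basis[OF ij Z] Sm]
  show "slope_set \<Psi> (facet_interior i) E g1 g2 \<in> lmeasurable"
    "measure lebesgue (slope_set \<Psi> (facet_interior i) E g1 g2) = r" by simp_all
qed

lemma slope_measure_imp_MA: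
  assumes g: "\<And>i. \<bar>triple g1 g2 (a i)\<bar> = 1"
    and S: "\<And>i E. E \<in> sets borel \<Longrightarrow> E \<subseteq> facet_interior i \<Longrightarrow>
      slope_set \<Psi> (facet_interior i) E g1 g2 \<in> lmeasurable \<and>
      ennreal (measure lebesgue (slope_set \<Psi> (facet_interior i) E g1 g2)) = emeasure \<nu> E"
  shows "MA_equation D.P \<Psi> \<nu>"
  unfolding MA_equation_iff
proof (intro allI impI)
  fix i j m1 m2 E
  assume A: "j \<noteq> i" "Z_basis (perp_lattice (b j)) m1 m2" "E \<in> sets borel" "E \<subseteq> facet_interior i"
  note c = slope_set_chart_change[OF facet_interior_plane A(4) triple_Z_basis[OF A(1,2)] g, of \<Psi>]
  note S' = S[OF A(3,4)]
  have 1: "slope_set \<Psi> (facet_interior i) E m1 m2 \<in> lmeasurable" using c(1) S' by blast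
  have 2: "measure lebesgue (slope_set \<Psi> (facet_interior i) E m1 m2) = measure lebesgue (slope_set \<Psi> (facet_interior i) E g1 g2)"
    using c(2) S' by blast
  show "slope_set \<Psi> (facet_interior i) E m1 m2 \<in> sets lebesgue \<and>
    emeasure lebesgue (slope_set \<Psi> (facet_interior i) E m1 m2) = emeasure \<nu> E"
    using fmeasurableD[OF 1] emeasure_eq_measure2[OF 1] S' unfolding 2 by simp
qed

end

section \<open>Supporting slopes of convex functions\<close>

text \<open>
  The theorem of Hahn and Banach for subgradients, from a hyperplane that separates the strict
  epigraph of \<open>\<Psi>\<close> from the graph over \<open>C\<close> of the affine function with slope \<open>m0\<close> at \<open>n\<close>.
\<close>
lemma supports_extend:
  fixes \<Psi> :: "'a::euclidean_space \<Rightarrow> real"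
  assumes conv: "convex_on UNIV \<Psi>" and C: "convex C" and n: "n \<in> C" and sup: "supports C \<Psi> m0 n"
  obtains m where "supports UNIV \<Psi> m n" "\<And>y. y \<in> C \<Longrightarrow> m0 \<bullet> (y - n) \<le> m \<bullet> (y - n)"
proof -
  define G where "G = (\<lambda>y. (y, \<Psi> n + m0 \<bullet> (y - n))) ` C"
  define T where "T = {z :: 'a \<times> real. \<Psi> (fst z) < snd z}"
  have "convex G"
    unfolding convex_def
  proof (intro ballI allI impI)
    fix p q s t assume "p \<in> G" "q \<in> G" and st: "0 \<le> s" "0 \<le> t" "s + t = (1::real)"
    then obtain x y where xy: "x \<in> C" "p = (x, \<Psi> n + m0 \<bullet> (x - n))" "y \<in> C" "q = (y, \<Psi> n + m0 \<bullet> (y - n))"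
      unfolding G_def by auto
    have "s *\<^sub>R x + t *\<^sub>R y \<in> C" using convexD[OF C xy(1,3) st] .
    moreover have "s * (\<Psi> n + m0 \<bullet> (x - n)) + t * (\<Psi> n + m0 \<bullet> (y - n))
        = (s + t) * (\<Psi> n - m0 \<bullet> n) + m0 \<bullet> (s *\<^sub>R x + t *\<^sub>R y)"
      by (simp add: inner_diff_right inner_add_right algebra_simps)
    ultimately show "s *\<^sub>R p + t *\<^sub>R q \<in> G"
      unfolding xy G_def st(3) by (intro image_eqI[of _ _ "s *\<^sub>R x + t *\<^sub>R y"]) (auto simp: inner_diff_right)
  qed
  moreover have "convex T"
    unfolding convex_def
  proof (intro ballI allI impI)
    fix p q s t assume pq: "p \<in> T" "q \<in> T" and st: "0 \<le> s" "0 \<le> t" "s + t = (1::real)"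
    have "\<Psi> (s *\<^sub>R fst p + t *\<^sub>R fst q) \<le> s * \<Psi> (fst p) + t * \<Psi> (fst q)"
      using conv st unfolding convex_on_def by simp
    also have "\<dots> < s * snd p + t * snd q"
    proof (cases "s = 0")
      case True
      then show ?thesis using pq st by (simp add: T_def)
    next
      case False
      then have "s * \<Psi> (fst p) < s * snd p" using pq(1) st(1) by (simp add: T_def)
      moreover have "t * \<Psi> (fst q) \<le> t * snd q" using pq(2) st(2) by (intro mult_left_mono) (simp_all add: T_def)
      ultimately show ?thesis by simp
    qed
    finally show "s *\<^sub>R p + t *\<^sub>R q \<in> T" unfolding T_def by simp
  qed
  moreover have "G \<noteq> {}" using n unfolding G_def by blast
  moreover have "(n, \<Psi> n + 1) \<in> T" unfolding T_def by simp
  then have "T \<noteq> {}" by blast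
  moreover have "G \<inter> T = {}"
  proof -
    have "\<not> z \<in> T" if z: "z \<in> G" for z
    proof -
      obtain y where y: "y \<in> C" "z = (y, \<Psi> n + m0 \<bullet> (y - n))" using z unfolding G_def by blast
      then show ?thesis using sup unfolding supports_def T_def by auto
    qed
    then show ?thesis by blast
  qed
  ultimately obtain A c where A: "A \<noteq> 0" "\<And>z. z \<in> G \<Longrightarrow> A \<bullet> z \<le> c" "\<And>z. z \<in> T \<Longrightarrow> c \<le> A \<bullet> z"
    using separating_hyperplane_sets[of G T] by blast
  obtain \<alpha> \<beta> where A_eq: "A = (\<alpha>, \<beta>)" by (cases A)
  have G: "\<alpha> \<bullet> y + \<beta> * (\<Psi> n + m0 \<bullet> (y - n)) \<le> c" if "y \<in> C" for y
    using A(2)[of "(y, \<Psi> n + m0 \<bullet> (y - n))"] that unfolding G_def A_eq by auto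
  have T: "c \<le> \<alpha> \<bullet> x + \<beta> * t" if "\<Psi> x < t" for x t
    using A(3)[of "(x, t)"] that unfolding T_def A_eq by simp
  have Gn: "\<alpha> \<bullet> n + \<beta> * \<Psi> n \<le> c" using G[OF n] by simp
  have "0 \<le> \<beta>" using Gn T[of n "\<Psi> n + 1"] by (simp add: algebra_simps)
  moreover have "\<beta> \<noteq> 0"
  proof
    assume b0: "\<beta> = 0"
    have "c \<le> \<alpha> \<bullet> (n - \<alpha>)" using T[of "n - \<alpha>" "\<Psi> (n - \<alpha>) + 1"] b0 by simp
    then have "\<alpha> \<bullet> \<alpha> \<le> 0" using Gn b0 by (simp add: inner_diff_right)
    then have "\<alpha> = 0" by (metis inner_eq_zero_iff inner_ge_zero antisym)
    then show False using A(1) A_eq b0 by (simp add: zero_prod_def)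
  qed
  ultimately have \<beta>: "0 < \<beta>" by simp
  have Tle: "c \<le> \<alpha> \<bullet> x + \<beta> * \<Psi> x" for x
  proof (rule field_le_epsilon)
    fix e :: real assume "0 < e"
    then have "c \<le> \<alpha> \<bullet> x + \<beta> * (\<Psi> x + e / \<beta>)" using \<beta> by (intro T) simp
    then show "c \<le> \<alpha> \<bullet> x + \<beta> * \<Psi> x + e" using \<beta> by (simp add: distrib_left)
  qed
  define m where "m = - (1 / \<beta>) *\<^sub>R \<alpha>"
  have mi: "\<beta> * (m \<bullet> v) = - (\<alpha> \<bullet> v)" for v unfolding m_def using \<beta> by simp
  show ?thesis
  proof
    show "supports UNIV \<Psi> m n"
      unfolding supports_def
    proof
      fix x
      have "\<beta> * (\<Psi> n + m \<bullet> (x - n)) \<le> \<beta> * \<Psi> x"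
        using Gn Tle[of x] unfolding distrib_left mi inner_diff_right[of \<alpha>] by simp
      then show "\<Psi> n + m \<bullet> (x - n) \<le> \<Psi> x" using \<beta> by simp
    qed
    fix y assume y: "y \<in> C"
    have "\<beta> * (m0 \<bullet> (y - n)) \<le> \<beta> * (m \<bullet> (y - n))"
      using G[OF y] Tle[of n] unfolding distrib_left mi inner_diff_right[of \<alpha>] by simp
    then show "m0 \<bullet> (y - n) \<le> m \<bullet> (y - n)" using \<beta> by simp
  qed
qed

lemma supports_open_imp_UNIV:
  fixes u :: "'a::euclidean_space \<Rightarrow> real"
  assumes conv: "convex_on UNIV u" and D: "open D" "x \<in> D" and sup: "supports D u p x"
  shows "supports UNIV u p x"
  unfolding supports_def
proof
  fix y
  obtain e where e: "0 < e" "ball x e \<subseteq> D" using D open_contains_ball by blast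
  define N where "N = norm (y - x) + 1"
  have np: "0 < N" "norm (y - x) \<le> N" unfolding N_def by (simp_all add: add_nonneg_pos)
  define t where "t = min 1 (e / (2 * N))"
  have t: "0 < t" "t \<le> 1" unfolding t_def using e(1) np by auto
  have "norm (t *\<^sub>R (y - x)) < e"
  proof -
    have "t * norm (y - x) \<le> (e / (2 * N)) * N"
      unfolding t_def using np e(1) by (intro mult_mono) auto
    also have "\<dots> = e / 2" using np by simp
    finally show ?thesis using t e(1) by simp
  qed
  then have "x + t *\<^sub>R (y - x) \<in> D" using e(2) by (auto simp: dist_norm)
  then have "u x + p \<bullet> (t *\<^sub>R (y - x)) \<le> u (x + t *\<^sub>R (y - x))" using sup unfolding supports_def by force
  also have "x + t *\<^sub>R (y - x) = (1 - t) *\<^sub>R x + t *\<^sub>R y" by (simp add: algebra_simps)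
  also have "u \<dots> \<le> (1 - t) * u x + t * u y" using conv t unfolding convex_on_def by simp
  finally have "t * (u x + p \<bullet> (y - x)) \<le> t * u y" by (simp add: algebra_simps)
  then show "u x + p \<bullet> (y - x) \<le> u y" using t(1) by simp
qed

lemma supports_slope_le_growth:
  assumes sup: "supports UNIV \<Psi> m n" and g: "\<And>t. 0 < t \<Longrightarrow> \<Psi> (t *\<^sub>R d) \<le> t * s + C"
  shows "m \<bullet> d \<le> s"
proof (rule ccontr)
  assume "\<not> m \<bullet> d \<le> s"
  then have r: "0 < m \<bullet> d - s" by simp
  obtain t :: real where t: "0 < t" "C - \<Psi> n + m \<bullet> n < t * (m \<bullet> d - s)"
  proof
    define K where "K = (\<bar>C - \<Psi> n + m \<bullet> n\<bar> + 1) / (m \<bullet> d - s)"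
    show "0 < K" unfolding K_def using r by (intro divide_pos_pos) auto
    have "K * (m \<bullet> d - s) = \<bar>C - \<Psi> n + m \<bullet> n\<bar> + 1" unfolding K_def using r by simp
    then show "C - \<Psi> n + m \<bullet> n < K * (m \<bullet> d - s)" by simp
  qed
  have "\<Psi> n + m \<bullet> (t *\<^sub>R d - n) \<le> t * s + C"
    using sup g[OF t(1)] unfolding supports_def by (meson UNIV_I order_trans)
  then show False using t(2) by (simp add: inner_diff_right algebra_simps)
qed

context polar_tetrahedra
begin

lemma P_class_growth:
  assumes "\<Psi> \<in> P_class D.P"
  obtains C where "\<And>n s. (\<And>i. a i \<bullet> n \<le> s) \<Longrightarrow> \<Psi> n \<le> s + C"
proof -
  obtain C where C: "\<And>n. \<bar>\<Psi> n - (SUP m\<in>D.P \<inter> int_lattice. m \<bullet> n)\<bar> \<le> C"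
    using assms unfolding P_class_def bdd_above_def by auto
  have "\<Psi> n \<le> s + C" if s: "\<And>i. a i \<bullet> n \<le> s" for n s
  proof -
    have "range a \<subseteq> {m. n \<bullet> m \<le> s}" using s by (auto simp: inner_commute)
    then have sub: "D.P \<subseteq> {m. n \<bullet> m \<le> s}"
      unfolding D.P_def by (rule hull_minimal) (rule convex_halfspace_le)
    have "a 0 \<in> D.P \<inter> int_lattice" using D.a_in_P D.lattice by simp
    then have ne: "D.P \<inter> int_lattice \<noteq> {}" by blast
    have "(SUP m\<in>D.P \<inter> int_lattice. m \<bullet> n) \<le> s"
    proof (rule cSUP_least[OF ne])
      fix m assume "m \<in> D.P \<inter> int_lattice"
      then have "n \<bullet> m \<le> s" using sub by blast
      then show "m \<bullet> n \<le> s" by (simp add: inner_commute)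
    qed
    then show ?thesis using C[of n] by simp
  qed
  then show ?thesis by (rule that)
qed

lemma P_class_convex: "\<Psi> \<in> P_class D.P \<Longrightarrow> convex_on UNIV \<Psi>"
  unfolding P_class_def by simp

lemma P_class_continuous: "\<Psi> \<in> P_class D.P \<Longrightarrow> continuous_on S \<Psi>"
  using convex_on_continuous[OF open_UNIV P_class_convex] continuous_on_subset by blast

lemma P_class_slope_in_P:
  assumes \<Psi>: "\<Psi> \<in> P_class D.P" and sup: "supports UNIV \<Psi> m n"
  shows "m \<in> D.P"
proof -
  obtain C where C: "\<And>n s. (\<And>i. a i \<bullet> n \<le> s) \<Longrightarrow> \<Psi> n \<le> s + C" using P_class_growth[OF \<Psi>] by blast
  have "m \<bullet> b j \<le> 1" for j
  proof (rule supports_slope_le_growth[OF sup])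
    fix t :: real assume t: "0 < t"
    show "\<Psi> (t *\<^sub>R b j) \<le> t * 1 + C"
    proof (rule C)
      fix i
      have "a i \<bullet> b j \<le> 1" using D.pairing[of i j] D.k_pos[of j] by (cases "j = i") simp_all
      then show "a i \<bullet> (t *\<^sub>R b j) \<le> t * 1" using t by simp
    qed
  qed
  then show ?thesis unfolding D.P_eq by simp
qed

text \<open>
  Over the facet where the pairing with \<open>a i\<close> attains its maximum 1 on the dual polytope, adding a
  nonnegative multiple of \<open>a i\<close> to a supporting slope keeps it supporting. Moving in this direction one
  leaves the polytope through a facet that contains \<open>a i\<close>; \<open>s\<close> is the time at which this happens.
\<close>
lemma raise_to_boundary:
  assumes m: "m \<in> D.P" and n: "n \<in> N.face i" and sup: "supports N.P \<Psi> m n"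
  obtains s j where "0 \<le> s" "j \<noteq> i" "m + s *\<^sub>R a i \<in> D.P" "(m + s *\<^sub>R a i) \<bullet> b j = 1"
    "supports N.P \<Psi> (m + s *\<^sub>R a i) n"
proof -
  define s where "s = Min ((\<lambda>j. 1 - m \<bullet> b j) ` (- {i}))"
  have "i + 1 \<in> - {i}" by simp
  then have ne: "(\<lambda>j. 1 - m \<bullet> b j) ` (- {i}) \<noteq> {}" by blast
  have s_le: "s \<le> 1 - m \<bullet> b j" if "j \<noteq> i" for j unfolding s_def using that by (intro Min_le) auto
  have "s \<in> (\<lambda>j. 1 - m \<bullet> b j) ` (- {i})" unfolding s_def using ne by (intro Min_in) auto
  then obtain j where j: "j \<noteq> i" "s = 1 - m \<bullet> b j" by auto
  have s0: "0 \<le> s" using m unfolding j(2) D.P_eq by simp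
  have "(m + s *\<^sub>R a i) \<bullet> b l \<le> 1" for l
  proof (cases "l = i")
    case True
    have "s * (1 - k i) \<le> 0" using s0 D.k[of i] by (intro mult_nonneg_nonpos) auto
    then show ?thesis using True m unfolding D.P_eq by (simp add: inner_add_left D.pairing) (smt (verit))
  next
    case False
    then show ?thesis using s_le[OF False] by (simp add: inner_add_left D.pairing)
  qed
  then have 1: "m + s *\<^sub>R a i \<in> D.P" unfolding D.P_eq by simp
  have 2: "(m + s *\<^sub>R a i) \<bullet> b j = 1" using j by (simp add: inner_add_left D.pairing)
  have "supports N.P \<Psi> (m + s *\<^sub>R a i) n"
    unfolding supports_def
  proof
    fix y assume y: "y \<in> N.P"
    have "n \<bullet> a i = 1" using N.face_plane[OF n] .
    moreover have "y \<bullet> a i \<le> 1" using y unfolding N.P_eq by simp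
    ultimately have "a i \<bullet> (y - n) \<le> 0" by (simp add: inner_diff_right inner_commute)
    then have "(m + s *\<^sub>R a i) \<bullet> (y - n) \<le> m \<bullet> (y - n)"
      using s0 by (simp add: inner_add_left mult_nonneg_nonpos)
    then show "\<Psi> n + (m + s *\<^sub>R a i) \<bullet> (y - n) \<le> \<Psi> y" using sup y unfolding supports_def by force
  qed
  with s0 j(1) 1 2 show ?thesis by (rule that)
qed

text \<open>
  The facets containing \<open>a i\<close> form a graph over the quotient modulo \<open>a i\<close>.
\<close>
lemma boundary_lift_unique:
  assumes "m \<in> D.P" "m + s *\<^sub>R a i \<in> D.P" "m \<bullet> b j = 1" "j \<noteq> i" "(m + s *\<^sub>R a i) \<bullet> b l = 1" "l \<noteq> i"
  shows "s = 0"
proof -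
  have "(m + s *\<^sub>R a i) \<bullet> b j \<le> 1" "m \<bullet> b l \<le> 1" using assms(1,2) unfolding D.P_eq by blast+
  then show ?thesis using assms(3-6) by (simp add: inner_add_left D.pairing)
qed

text \<open>
  A slope \<open>m0\<close> over one facet interior is, modulo \<open>a i\<close>, the slope of a subgradient of \<open>\<Psi>\<close> on the whole
  space. Growth puts that subgradient into the polytope, and it can be raised to a facet containing
  \<open>a i\<close>.
\<close>
lemma slope_in_boundary:
  assumes \<Psi>: "\<Psi> \<in> P_class D.P" and n: "n \<in> facet_interior i"
    and sup: "supports (facet_interior i) \<Psi> m0 n"
  obtains s j where "j \<noteq> i" "m0 + s *\<^sub>R a i \<in> D.P" "(m0 + s *\<^sub>R a i) \<bullet> b j = 1"
    "supports N.P \<Psi> (m0 + s *\<^sub>R a i) n"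
proof -
  have conv: "convex (facet_interior i)"
    unfolding N.face_eq_hull by (intro convex_rel_interior convex_convex_hull)
  obtain m where m: "supports UNIV \<Psi> m n" "\<And>y. y \<in> facet_interior i \<Longrightarrow> m0 \<bullet> (y - n) \<le> m \<bullet> (y - n)"
    using supports_extend[OF P_class_convex[OF \<Psi>] conv n sup] by blast
  define w where "w = m0 - m"
  have na: "n \<bullet> a i = 1" using facet_interior_plane[OF n] .
  have a_ne: "a i \<noteq> 0" by (rule N.b_nonzero)
  \<comment> \<open>the component \<open>v\<close> of \<open>w\<close> in the plane of the facet vanishes, because the facet interior is open in
    that plane\<close>
  define v where "v = w - ((w \<bullet> a i) / (a i \<bullet> a i)) *\<^sub>R a i"
  have va: "v \<bullet> a i = 0" unfolding v_def using a_ne by (simp add: inner_diff_left)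
  have wv: "w \<bullet> v = v \<bullet> v" using va unfolding v_def by (simp add: inner_diff_left inner_diff_right inner_commute)
  have "\<exists>e>0. \<forall>j. j \<noteq> i \<longrightarrow> (n + e *\<^sub>R v) \<bullet> a j < 1"
  proof -
    have "\<forall>\<^sub>F e in at_right (0::real). \<forall>j\<in>- {i}. (n + e *\<^sub>R v) \<bullet> a j < 1"
    proof (rule eventually_ball_finite, simp, intro ballI)
      fix j assume "j \<in> - {i}"
      then have j: "n \<bullet> a j < 1" using n unfolding N.rel_interior_face by simp
      have "((\<lambda>e. (n + e *\<^sub>R v) \<bullet> a j) \<longlongrightarrow> (n + 0 *\<^sub>R v) \<bullet> a j) (at_right 0)"
        by (intro tendsto_intros)
      then show "\<forall>\<^sub>F e in at_right 0. (n + e *\<^sub>R v) \<bullet> a j < 1"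
        using j by (intro order_tendstoD(2)) auto
    qed
    then have "\<forall>\<^sub>F e in at_right (0::real). 0 < e \<and> (\<forall>j\<in>- {i}. (n + e *\<^sub>R v) \<bullet> a j < 1)"
      using eventually_at_right_less[of "0::real"] by eventually_elim auto
    from eventually_happens[OF this] show ?thesis by auto
  qed
  then obtain e where e: "0 < e" "\<And>j. j \<noteq> i \<Longrightarrow> (n + e *\<^sub>R v) \<bullet> a j < 1" by blast
  have "n + e *\<^sub>R v \<in> facet_interior i"
    unfolding N.rel_interior_face using e(2) na va by (simp add: inner_add_left)
  from m(2)[OF this] have "e * (w \<bullet> v) \<le> 0" unfolding w_def by (simp add: inner_diff_left algebra_simps)
  then have "v \<bullet> v \<le> 0" using e(1) unfolding wv by (simp add: mult_le_0_iff)
  then have "v = 0" by (metis inner_eq_zero_iff inner_ge_zero antisym)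
  then have "w = ((w \<bullet> a i) / (a i \<bullet> a i)) *\<^sub>R a i" unfolding v_def by simp
  then obtain q where "w = q *\<^sub>R a i" by blast
  then have "m = m0 - q *\<^sub>R a i" unfolding w_def by (metis diff_diff_eq2 add_diff_cancel_left')
  then have r: "m = m0 + (- q) *\<^sub>R a i" by simp
  have nf: "n \<in> N.face i" using n rel_interior_subset by blast
  have "supports N.P \<Psi> m n" using m(1) unfolding supports_def by blast
  then obtain s j where sj: "j \<noteq> i" "m + s *\<^sub>R a i \<in> D.P" "(m + s *\<^sub>R a i) \<bullet> b j = 1" "supports N.P \<Psi> (m + s *\<^sub>R a i) n"
    using raise_to_boundary[OF P_class_slope_in_P[OF \<Psi> m(1)] nf] by blast
  have "m + s *\<^sub>R a i = m0 + (s - q) *\<^sub>R a i" unfolding r by (simp add: scaleR_left_diff_distrib)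
  with sj show ?thesis by (intro that[of j "s - q"]) simp_all
qed

lemma contact_in_c_subgradient:
  assumes \<Psi>: "\<Psi> \<in> P_class D.P" and n: "n \<in> frontier N.P" and sup: "supports N.P \<Psi> m n"
  shows "n \<in> c_subgradient D.P \<Psi> m"
proof -
  have comp: "compact (frontier N.P)" using N.compact_P by (rule compact_frontier)
  have cont: "continuous_on (frontier N.P) \<Psi>" using P_class_continuous[OF \<Psi>] .
  have ct: "c_transform D.P \<Psi> m' = legendre (frontier N.P) \<Psi> m'" for m'
    unfolding c_transform_def legendre_def dual_P ..
  have "frontier N.P \<subseteq> N.P" using N.closed_P by (simp add: frontier_subset_closed)
  then have "supports (frontier N.P) \<Psi> m n" using sup unfolding supports_def by blast
  then have le: "c_transform D.P \<Psi> m \<le> m \<bullet> n - \<Psi> n"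
    unfolding ct using supports_iff_legendre[OF comp cont n] by simp
  have ge: "m' \<bullet> n - \<Psi> n \<le> c_transform D.P \<Psi> m'" for m'
    unfolding ct by (rule legendre_upper[OF compact_imp_bounded[OF comp] bdd_below_image_compact[OF comp cont] n])
  have "c_transform D.P \<Psi> m + (m' - m) \<bullet> n \<le> c_transform D.P \<Psi> m'" for m'
    using le ge[of m'] unfolding inner_diff_left by linarith
  then show ?thesis unfolding c_subgradient_def dual_P using n by simp
qed

end

section \<open>Ridges of a facet that carries all slopes of a star\<close>

text \<open>
  Together with \<open>plane_combination\<close>, \<open>coords_mod\<close> gives coordinates on the quotient modulo \<open>a\<close>.
\<close>
definition plane_combination :: "real^3 \<Rightarrow> real^3 \<Rightarrow> real^2 \<Rightarrow> real^3" where
  "plane_combination g1 g2 q = q $ 1 *\<^sub>R g1 + q $ 2 *\<^sub>R g2"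

definition coords_mod :: "real^3 \<Rightarrow> real^3 \<Rightarrow> real^3 \<Rightarrow> real^3 \<Rightarrow> real^2" where
  "coords_mod g1 g2 a m = (1 / triple g1 g2 a) *\<^sub>R beta (cross3 g2 a) (cross3 a g1) m"

lemma linear_plane_combination: "linear (plane_combination g1 g2)"
  by (rule linearI) (simp_all add: plane_combination_def algebra_simps)

lemma linear_coords_mod: "linear (coords_mod g1 g2 a)"
  unfolding coords_mod_def[abs_def] using linear_beta by (rule linear_compose_scale_right)

lemma coords_mod_decompose:
  assumes "triple g1 g2 a \<noteq> 0"
  obtains s where "m = plane_combination g1 g2 (coords_mod g1 g2 a m) + s *\<^sub>R a"
proof -
  let ?t = "triple g1 g2 a"
  have "m = (1 / ?t) *\<^sub>R (?t *\<^sub>R m)" using assms by simp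
  also have "\<dots> = plane_combination g1 g2 (coords_mod g1 g2 a m) + ((m \<bullet> cross3 g1 g2) / ?t) *\<^sub>R a"
    unfolding triple_expand[of g1 g2 a m] plane_combination_def coords_mod_def
    by (simp add: beta_components scaleR_right_distrib inner_commute)
  finally show ?thesis by (rule that)
qed

lemma coords_mod_combination:
  assumes "triple g1 g2 a \<noteq> 0"
  shows "coords_mod g1 g2 a (plane_combination g1 g2 q + s *\<^sub>R a) = q"
proof -
  have e: "cross3 g2 a \<bullet> g1 = triple g1 g2 a" "cross3 a g1 \<bullet> g2 = triple g1 g2 a"
    by (simp_all add: triple_def inner_vec_def sum_3 cross_components algebra_simps)
  show ?thesis using assms
    unfolding plane_combination_def coords_mod_def vec_eq_iff forall_2
    by (simp add: beta_components inner_add_right dot_cross_self e)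
qed

context polar_tetrahedra
begin

lemma facet_interior_borel: "facet_interior i \<in> sets borel"
proof -
  have "facet_interior i = N.face i - (\<Union>j\<in>- {i}. N.face j)"
  proof (intro set_eqI iffI)
    fix x assume "x \<in> facet_interior i"
    then have x: "x \<bullet> a i = 1" "\<And>j. j \<noteq> i \<Longrightarrow> x \<bullet> a j < 1" unfolding N.rel_interior_face by auto
    have "x \<bullet> a l \<le> 1" for l using x(1) x(2)[of l] by (cases "l = i") auto
    then have xi: "x \<in> N.face i" using x(1) unfolding N.face_def N.P_eq by simp
    have xj: "x \<notin> N.face j" if "j \<noteq> i" for j using x(2)[OF that] unfolding N.face_def by simp
    show "x \<in> N.face i - (\<Union>j\<in>- {i}. N.face j)" using xi xj by simp
  next
    fix x assume x: "x \<in> N.face i - (\<Union>j\<in>- {i}. N.face j)"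
    have "x \<bullet> a j < 1" if "j \<noteq> i" for j
    proof -
      have xP: "x \<in> N.P" and nj: "x \<notin> N.face j" using x that by (simp_all add: N.face_def)
      have "x \<bullet> a j \<le> 1" using xP unfolding N.P_eq by simp
      moreover have "x \<bullet> a j \<noteq> 1" using nj xP unfolding N.face_def by simp
      ultimately show ?thesis by simp
    qed
    moreover have "x \<bullet> a i = 1" using x by (simp add: N.face_def)
    ultimately show "x \<in> facet_interior i" unfolding N.rel_interior_face by simp
  qed
  moreover have "N.face j \<in> sets borel" for j using N.compact_face by (simp add: borel_compact)
  ultimately show ?thesis by auto
qed

lemma facet_interior_closure: "closure (facet_interior i) = N.face i"
proof -
  have "convex (N.face i)" unfolding N.face_eq_hull by (rule convex_convex_hull)
  from convex_closure_rel_interior[OF this] show ?thesis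
    using closure_closed[OF compact_imp_closed[OF N.compact_face]] by simp
qed

lemma open_beta_image:
  assumes g: "\<bar>triple g1 g2 (a i)\<bar> = 1" and U: "open U"
  shows "open (beta g1 g2 ` (U \<inter> facet_interior i))"
proof -
  let ?s = "plane_section g1 g2 (a i)"
  have t0: "triple g1 g2 (a i) \<noteq> 0" using g by auto
  have plane: "y \<bullet> a i = 1" if "y \<in> U \<inter> facet_interior i" for y
    using that by (intro facet_interior_plane) simp
  have "beta g1 g2 ` (U \<inter> facet_interior i) = ?s -` (U \<inter> facet_interior i)"
    by (rule beta_image_eq[where n = "a i", OF t0 plane])
  also have "\<dots> = ?s -` (U \<inter> (\<Inter>j\<in>- {i}. {x. a j \<bullet> x < 1}))"
    using plane_section_in_plane[OF t0] by (auto simp: N.rel_interior_face inner_commute[of "a _"])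
  finally have eq: "beta g1 g2 ` (U \<inter> facet_interior i) = ?s -` (U \<inter> (\<Inter>j\<in>- {i}. {x. a j \<bullet> x < 1}))" .
  show ?thesis unfolding eq
    using U by (intro open_vimage continuous_plane_section open_Int open_INT) (auto intro: open_halfspace_lt)
qed

lemma beta_relatively_open_positive:
  assumes g: "\<bar>triple g1 g2 (a i)\<bar> = 1" and U: "open U" "n \<in> U" "n \<in> N.face i"
  shows "0 < measure lebesgue (beta g1 g2 ` (U \<inter> facet_interior i))"
proof -
  have t0: "triple g1 g2 (a i) \<noteq> 0" using g by auto
  have "n \<in> closure (facet_interior i)" using U(3) facet_interior_closure by simp
  then have "U \<inter> closure (facet_interior i) \<noteq> {}" using U(2) by blast
  then have "U \<inter> facet_interior i \<noteq> {}" using open_Int_closure_eq_empty[OF U(1)] by simp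
  then have "beta g1 g2 ` (U \<inter> facet_interior i) \<noteq> {}" by simp
  then have nn: "\<not> negligible (beta g1 g2 ` (U \<inter> facet_interior i))"
    by (rule open_not_negligible[OF open_beta_image[OF g U(1)]])
  have "bounded (facet_interior i)"
    using compact_imp_bounded[OF N.compact_face] rel_interior_subset by (rule bounded_subset)
  then have bd: "bounded (U \<inter> facet_interior i)" by (rule bounded_subset) auto
  have plane: "y \<bullet> a i = 1" if "y \<in> U \<inter> facet_interior i" for y
    using that by (intro facet_interior_plane) simp
  have "U \<inter> facet_interior i \<in> sets borel" using U(1) facet_interior_borel by (auto simp: borel_open)
  then have "beta g1 g2 ` (U \<inter> facet_interior i) \<in> lmeasurable"
    using bd plane by (intro beta_image_lmeasurable[OF t0]) auto
  then show ?thesis using nn by (simp add: negligible_iff_measure zero_less_measure_iff)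
qed

text \<open>
  Here \<open>lift\<close> sends coordinates modulo \<open>a o'\<close> to the plane of the facet with normal \<open>b j\<close>, which contains
  \<open>a o'\<close> and \<open>a i\<close>. If a slope touches over both facet interiors, monotonicity forbids the same for its
  forward translates by \<open>a o' - a i\<close>, because this vector is positive on the interior of the facet of
  \<open>a o'\<close> and negative on that of \<open>a i\<close>. The sets \<open>G\<close> exhaust the interiors by compact sets.
\<close>
lemma disjoint_facet_contacts_negligible:
  assumes \<Psi>: "continuous_on N.P \<Psi>" and g: "\<bar>triple g1 g2 (a o')\<bar> = 1"
    and ij: "i \<noteq> o'" "j \<noteq> o'" "j \<noteq> i"
    and lift: "\<And>q. lift q = plane_combination g1 g2 q + (1 - plane_combination g1 g2 q \<bullet> b j) *\<^sub>R a o'"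
    and T: "compact T"
  shows "negligible {q \<in> T. (\<exists>n\<in>facet_interior i. supports N.P \<Psi> (lift q) n) \<and>
     (\<exists>n\<in>facet_interior o'. supports N.P \<Psi> (lift q) n)}"
proof -
  let ?K = "plane_combination g1 g2"
  have t0: "triple g1 g2 (a o') \<noteq> 0" using g by auto
  define d where "d = a o' - a i"
  define w where "w = coords_mod g1 g2 (a o') d"
  obtain r where r: "d = ?K w + r *\<^sub>R a o'" unfolding w_def by (rule coords_mod_decompose[OF t0])
  have db: "d \<bullet> b j = 0" using ij unfolding d_def by (simp add: inner_diff_left D.pairing)
  have ob: "a o' \<bullet> b j = 1" using ij by (simp add: D.pairing)
  have Kwb: "?K w \<bullet> b j = - r" using db unfolding r by (simp add: inner_add_left ob)
  have lift_add: "lift (q + t *\<^sub>R w) = lift q + t *\<^sub>R d" for q t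
  proof -
    have K: "?K (q + t *\<^sub>R w) = ?K q + t *\<^sub>R ?K w"
      using linear_plane_combination[of g1 g2] by (simp add: linear_add linear_scale)
    show ?thesis unfolding lift K r by (simp add: inner_add_left Kwb algebra_simps)
  qed
  have w0: "w \<noteq> 0"
  proof
    assume "w = 0"
    then have "?K w = 0" by (simp add: plane_combination_def)
    then have "r = 0" using Kwb by simp
    then have "d = 0" using r \<open>?K w = 0\<close> by simp
    then have "a o' = a i" unfolding d_def by simp
    then show False using D.inj_a ij(1) by (auto dest: injD)
  qed
  have cont_lift: "continuous_on S lift" for S
  proof -
    have "lift = (\<lambda>q. ?K q + (1 - ?K q \<bullet> b j) *\<^sub>R a o')" by (rule ext) (rule lift)
    then show ?thesis unfolding plane_combination_def by (auto intro!: continuous_intros)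
  qed
  define G where "G l l' k = {n \<in> N.face l. n \<bullet> a l' \<le> 1 - 1 / real (Suc k)}" for l l' k
  have cG: "compact (G l l' k)" for l l' k
  proof -
    have "G l l' k = N.face l \<inter> {n. a l' \<bullet> n \<le> 1 - 1 / real (Suc k)}" unfolding G_def by (auto simp: inner_commute)
    then show ?thesis using N.compact_face by (auto intro: compact_Int_closed closed_halfspace_le)
  qed
  have GP: "G l l' k \<subseteq> N.P" for l l' k unfolding G_def N.face_def by blast
  define Z where "Z k k' = T \<inter> (lift -` contact_slopes N.P \<Psi> (G i o' k) \<inter> lift -` contact_slopes N.P \<Psi> (G o' i k'))" for k k'
  have neg: "negligible (Z k k')" for k k'
  proof (rule negligible_if_no_forward_translate[OF _ _ w0])
    have "closed (lift -` contact_slopes N.P \<Psi> (G l l' k))" for l l' k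
      by (rule closed_vimage[OF closed_contact_slopes[OF cG GP \<Psi>] cont_lift])
    then have "closed (Z k k')" unfolding Z_def using compact_imp_closed[OF T] by (intro closed_Int)
    then show "Z k k' \<in> sets borel" by (rule borel_closed)
    show "bounded (Z k k')" using compact_imp_bounded[OF T] by (rule bounded_subset) (auto simp: Z_def)
    fix q t assume q: "q \<in> Z k k'" and t: "0 < (t::real)"
    show "q + t *\<^sub>R w \<notin> Z k k'"
    proof
      assume q': "q + t *\<^sub>R w \<in> Z k k'"
      have "lift q + t *\<^sub>R d \<in> contact_slopes N.P \<Psi> (G i o' k)" "lift q \<in> contact_slopes N.P \<Psi> (G o' i k')"
        using q q' unfolding Z_def lift_add[symmetric] by simp_all
      then obtain n n0 where n: "n \<in> G i o' k" "supports N.P \<Psi> (lift q + t *\<^sub>R d) n"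
        and n0: "n0 \<in> G o' i k'" "supports N.P \<Psi> (lift q) n0"
        unfolding contact_slopes_def by auto
      have "0 \<le> (lift q + t *\<^sub>R d - lift q) \<bullet> (n - n0)"
        by (rule supports_monotone[OF n(2) n0(2) subsetD[OF GP n(1)] subsetD[OF GP n0(1)]])
      then have "0 \<le> d \<bullet> (n - n0)" using t by (simp add: zero_le_mult_iff)
      moreover have "n \<bullet> a i = 1" "n \<bullet> a o' \<le> 1 - 1 / real (Suc k)" "n0 \<bullet> a o' = 1" "n0 \<bullet> a i \<le> 1 - 1 / real (Suc k')"
        using n(1) n0(1) unfolding G_def N.face_def by auto
      moreover have "0 < 1 / real (Suc k)" "0 < 1 / real (Suc k')" by simp_all
      ultimately show False unfolding d_def
        by (simp only: inner_diff_left inner_diff_right inner_commute[of "a _"])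
    qed
  qed
  have in_G: "\<exists>k. n \<in> G l l' k" if n: "n \<in> facet_interior l" and "l' \<noteq> l" for n l l'
  proof -
    have "0 < 1 - n \<bullet> a l'" using n \<open>l' \<noteq> l\<close> unfolding N.rel_interior_face by simp
    then obtain k where "1 / real (Suc k) < 1 - n \<bullet> a l'" using nat_approx_posE by metis
    moreover have "n \<in> N.face l" using n rel_interior_subset by blast
    ultimately show ?thesis unfolding G_def by (intro exI[of _ k]) simp
  qed
  have "{q \<in> T. (\<exists>n\<in>facet_interior i. supports N.P \<Psi> (lift q) n) \<and>
     (\<exists>n\<in>facet_interior o'. supports N.P \<Psi> (lift q) n)} \<subseteq> (\<Union>k. \<Union>k'. Z k k')" (is "?L \<subseteq> ?R")
  proof
    fix q assume q: "q \<in> ?L"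
    then have qT: "q \<in> T" and "\<exists>n\<in>facet_interior i. supports N.P \<Psi> (lift q) n"
      and "\<exists>n\<in>facet_interior o'. supports N.P \<Psi> (lift q) n" by simp_all
    then obtain n n0 where n: "n \<in> facet_interior i" "supports N.P \<Psi> (lift q) n"
      and n0: "n0 \<in> facet_interior o'" "supports N.P \<Psi> (lift q) n0" by (elim bexE)
    obtain k where k: "n \<in> G i o' k" using in_G[OF n(1) ij(1)[symmetric]] by (rule exE)
    obtain k' where k': "n0 \<in> G o' i k'" using in_G[OF n0(1) ij(1)] by (rule exE)
    have "lift q \<in> contact_slopes N.P \<Psi> (G i o' k)" "lift q \<in> contact_slopes N.P \<Psi> (G o' i k')"
      unfolding contact_slopes_def using k k' n(2) n0(2) by auto
    then have "q \<in> Z k k'" using qT unfolding Z_def by simp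
    then show "q \<in> ?R" by blast
  qed
  moreover have "negligible ?R"
    by (intro negligible_Union_nat neg)
  ultimately show ?thesis by (rule negligible_subset[rotated])
qed

lemma supporting_slope_exists:
  assumes \<Psi>: "\<Psi> \<in> P_class D.P"
  obtains m where "m \<in> D.P" "supports N.P \<Psi> m n"
proof -
  have "supports {n} \<Psi> 0 n" unfolding supports_def by simp
  then obtain m where m: "supports UNIV \<Psi> m n"
    using supports_extend[OF P_class_convex[OF \<Psi>] convex_singleton[of n], of n] by blast
  then have "supports N.P \<Psi> m n" unfolding supports_def by blast
  with P_class_slope_in_P[OF \<Psi> m] show ?thesis by (rule that)
qed

lemma slope_set_alt:
  "slope_set \<Psi> R E g1 g2 = {q. \<exists>n\<in>E. supports R \<Psi> (plane_combination g1 g2 q) n}"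
  unfolding slope_set_def plane_combination_def ..

text \<open>
  By \<open>full\<close>, almost every slope modulo \<open>a o'\<close> is taken over the facet of \<open>a o'\<close>. If \<open>n\<close> had no
  supporting slope in the facet opposite \<open>a o'\<close>, neither would any point near \<open>n\<close>. The nearby points of
  the adjacent facet form a set \<open>E\<close> of positive mass, whose slopes then lie in facets containing both
  \<open>a o'\<close> and \<open>a i\<close> and so are almost all taken over two facet interiors, which is impossible.
\<close>
theorem ridge_contact:
  assumes \<Psi>: "\<Psi> \<in> P_class D.P" and MA: "MA_equation D.P \<Psi> \<nu>"
    and g: "\<And>i. \<bar>triple g1 g2 (a i)\<bar> = 1"
    and \<nu>: "\<And>i E. E \<in> sets borel \<Longrightarrow> E \<subseteq> facet_interior i \<Longrightarrow>
      emeasure \<nu> E = ennreal (c * measure lebesgue (beta g1 g2 ` E))"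
    and c: "0 < c"
    and full: "measure lebesgue (coords_mod g1 g2 (a o') ` D.P) \<le> c * measure lebesgue (beta g1 g2 ` facet_interior o')"
    and n: "n \<in> N.face o'" "n \<in> N.face i" and i: "i \<noteq> o'"
  shows "\<exists>m\<in>D.face o'. supports N.P \<Psi> m n"
proof (rule ccontr)
  assume none: "\<not> (\<exists>m\<in>D.face o'. supports N.P \<Psi> m n)"
  let ?K = "plane_combination g1 g2" and ?co = "\<lambda>l. coords_mod g1 g2 (a l)"
  have t0: "triple g1 g2 (a l) \<noteq> 0" for l using g[of l] by auto
  have cont: "continuous_on S \<Psi>" for S by (rule P_class_continuous[OF \<Psi>])
  have nP: "n \<in> N.P" using n(1) unfolding N.face_def by simp
  define H where "H = {y \<in> N.P. \<exists>m\<in>D.face o'. supports N.P \<Psi> m y}"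
  have "closed H"
    unfolding closed_sequential_limits
  proof (intro allI impI, elim conjE)
    fix y l assume y: "\<forall>k. y k \<in> H" and l: "y \<longlonglongrightarrow> l"
    have "\<forall>k. \<exists>m. m \<in> D.face o' \<and> supports N.P \<Psi> m (y k)" using y unfolding H_def by auto
    from choice[OF this] obtain m where m: "\<And>k. m k \<in> D.face o'" "\<And>k. supports N.P \<Psi> (m k) (y k)"
      by auto
    obtain m' r where m': "m' \<in> D.face o'" "strict_mono r" "(m \<circ> r) \<longlonglongrightarrow> m'"
      using D.compact_face m(1) unfolding compact_def by metis
    have "\<And>k. y k \<in> N.P" using y unfolding H_def by simp
    then have lP: "l \<in> N.P" using closed_sequentially[OF N.closed_P _ l] by simp
    have yr: "(\<lambda>k. y (r k)) \<longlonglongrightarrow> l" using LIMSEQ_subseq_LIMSEQ[OF l m'(2)] by (simp add: o_def)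
    have mr: "(\<lambda>k. m (r k)) \<longlonglongrightarrow> m'" using m'(3) by (simp add: o_def)
    have ur: "(\<lambda>k. \<Psi> (y (r k))) \<longlonglongrightarrow> \<Psi> l"
      by (rule continuous_on_tendsto_compose[OF cont[of UNIV] yr]) simp_all
    have "\<Psi> l + m' \<bullet> (z - l) \<le> \<Psi> z" if z: "z \<in> N.P" for z
    proof (rule LIMSEQ_le_const2)
      show "(\<lambda>k. \<Psi> (y (r k)) + m (r k) \<bullet> (z - y (r k))) \<longlonglongrightarrow> \<Psi> l + m' \<bullet> (z - l)"
        by (intro tendsto_intros ur mr yr)
      show "\<exists>k0. \<forall>k\<ge>k0. \<Psi> (y (r k)) + m (r k) \<bullet> (z - y (r k)) \<le> \<Psi> z"
        using m(2) z unfolding supports_def by simp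
    qed
    then show "l \<in> H" using lP m'(1) unfolding H_def supports_def by blast
  qed
  then have openU: "open (- H)" by (rule open_Compl)
  have nU: "n \<in> - H" using none unfolding H_def by simp
  define E where "E = - H \<inter> facet_interior i"
  have Eb: "E \<in> sets borel" unfolding E_def using openU facet_interior_borel by (intro sets.Int) (simp_all add: borel_open)
  have Ei: "E \<subseteq> facet_interior i" unfolding E_def by simp
  have Epos: "0 < measure lebesgue (beta g1 g2 ` E)"
    unfolding E_def by (rule beta_relatively_open_positive[OF g openU nU n(2)])
  define Si where "Si = slope_set \<Psi> (facet_interior i) E g1 g2"
  have Si: "measure lebesgue Si = c * measure lebesgue (beta g1 g2 ` E)"
    unfolding Si_def using c by (intro MA_imp_slope_measure(2)[OF MA Eb Ei \<nu>[OF Eb Ei] _ g]) simp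
  \<comment> \<open>up to a null set, \<open>So\<close> is the whole image \<open>T\<close> of the polytope modulo \<open>a o'\<close>\<close>
  define T where "T = ?co o' ` D.P"
  have cT: "compact T" unfolding T_def
    using linear_continuous_on[of "?co o'"] linear_coords_mod[of g1 g2 "a o'"]
    by (intro compact_continuous_image D.compact_P) (simp add: linear_conv_bounded_linear)
  define So where "So = slope_set \<Psi> (facet_interior o') (facet_interior o') g1 g2"
  have So: "So \<in> lmeasurable" "measure lebesgue So = c * measure lebesgue (beta g1 g2 ` facet_interior o')"
    unfolding So_def using c
    by (intro MA_imp_slope_measure[OF MA facet_interior_borel order_refl \<nu>[OF facet_interior_borel order_refl] _ g], simp)+
  have SoT: "So \<subseteq> T"
  proof
    fix q assume "q \<in> So"
    then obtain y where y: "y \<in> facet_interior o'" "supports (facet_interior o') \<Psi> (?K q) y"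
      unfolding So_def slope_set_alt by blast
    obtain s j where "?K q + s *\<^sub>R a o' \<in> D.P" using slope_in_boundary[OF \<Psi> y] by metis
    then show "q \<in> T" unfolding T_def using coords_mod_combination[OF t0, of o' q s] by (metis image_eqI)
  qed
  have Tm: "T \<in> lmeasurable" using cT by (rule lmeasurable_compact)
  have "measure lebesgue (T - So) = measure lebesgue T - measure lebesgue So"
    using SoT by (intro measurable_measure_Diff Tm fmeasurableD[OF So(1)])
  also have "\<dots> \<le> 0" using full unfolding So(2) T_def by simp
  finally have "measure lebesgue (T - So) = 0" by (simp add: antisym)
  then have TSo: "negligible (T - So)"
    using Tm So(1) by (simp add: negligible_iff_measure fmeasurable.Diff)
  define lift where "lift j q = ?K q + (1 - ?K q \<bullet> b j) *\<^sub>R a o'" for j q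
  define Dj where "Dj j = {q. lift j q \<in> D.P \<and> (\<exists>y\<in>E. supports N.P \<Psi> (lift j q) y)}" for j
  have lift_b: "lift j q \<bullet> b j = 1" if "j \<noteq> o'" for j q
    using that unfolding lift_def by (simp add: inner_add_left D.pairing)
  have Dneg: "negligible (Dj j)" if j: "j \<noteq> o'" "j \<noteq> i" for j
  proof -
    let ?Z = "{q \<in> T. (\<exists>n\<in>facet_interior i. supports N.P \<Psi> (lift j q) n) \<and>
       (\<exists>n\<in>facet_interior o'. supports N.P \<Psi> (lift j q) n)}"
    have "negligible ?Z"
      by (rule disjoint_facet_contacts_negligible[OF cont g i j lift_def cT])
    then have "negligible ((T - So) \<union> ?Z)" using TSo by simp
    moreover have "Dj j \<subseteq> (T - So) \<union> ?Z"
    proof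
      fix q assume q: "q \<in> Dj j"
      then have lP: "lift j q \<in> D.P" unfolding Dj_def by blast
      have qT: "q \<in> T" unfolding T_def
        by (rule image_eqI[OF _ lP]) (simp add: lift_def coords_mod_combination[OF t0])
      show "q \<in> (T - So) \<union> ?Z"
      proof (cases "q \<in> So")
        case True
        then obtain y where y: "y \<in> facet_interior o'" "supports (facet_interior o') \<Psi> (?K q) y"
          unfolding So_def slope_set_alt by blast
        obtain s l where s: "l \<noteq> o'" "?K q + s *\<^sub>R a o' \<in> D.P" "(?K q + s *\<^sub>R a o') \<bullet> b l = 1"
          "supports N.P \<Psi> (?K q + s *\<^sub>R a o') y" using slope_in_boundary[OF \<Psi> y] by metis
        define s' where "s' = s - (1 - ?K q \<bullet> b j)"
        have eq: "?K q + s *\<^sub>R a o' = lift j q + s' *\<^sub>R a o'"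
          unfolding lift_def s'_def by (simp add: scaleR_left_diff_distrib)
        have "s' = 0"
          by (rule boundary_lift_unique[OF lP s(2)[unfolded eq] lift_b[OF j(1)] j(1) s(3)[unfolded eq] s(1)])
        then have sup: "supports N.P \<Psi> (lift j q) y" using s(4) unfolding eq by simp
        obtain y' where y': "y' \<in> E" "supports N.P \<Psi> (lift j q) y'" using q unfolding Dj_def by blast
        then have "y' \<in> facet_interior i" using Ei by blast
        then show ?thesis using qT y(1) sup y'(2) by blast
      next
        case False
        then show ?thesis using qT by blast
      qed
    qed
    ultimately show ?thesis by (rule negligible_subset)
  qed
  \<comment> \<open>\<open>h j\<close> is, up to a translation, the passage from coordinates modulo \<open>a o'\<close> to coordinates modulo
    \<open>a i\<close> on the facet with normal \<open>b j\<close>\<close>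
  define h where "h j q = ?co i (?K q - (?K q \<bullet> b j) *\<^sub>R a o')" for j q
  have lin_h: "linear (h j)" for j
  proof -
    have "linear (\<lambda>q. ?K q - (?K q \<bullet> b j) *\<^sub>R a o')"
      by (rule linearI) (simp_all add: plane_combination_def inner_add_left algebra_simps)
    then have "linear (?co i \<circ> (\<lambda>q. ?K q - (?K q \<bullet> b j) *\<^sub>R a o'))"
      using linear_coords_mod by (rule linear_compose)
    then show ?thesis unfolding h_def[abs_def] o_def .
  qed
  have co_lift: "?co i (lift j q) = ?co i (a o') + h j q" for j q
  proof -
    have "lift j q = a o' + (?K q - (?K q \<bullet> b j) *\<^sub>R a o')" unfolding lift_def by (simp add: algebra_simps)
    then show ?thesis unfolding h_def using linear_add[OF linear_coords_mod] by metis
  qed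
  have "negligible ((+) (?co i (a o')) ` (h j ` Dj j))" if "j \<noteq> o'" "j \<noteq> i" for j
    using Dneg[OF that] linear_imp_differentiable_on[OF lin_h]
    by (intro negligible_translation negligible_differentiable_image_negligible) simp_all
  then have "negligible (\<Union>j\<in>{j. j \<noteq> o' \<and> j \<noteq> i}. (+) (?co i (a o')) ` (h j ` Dj j))"
    by (intro negligible_Union finite_imageI) auto
  moreover have "Si \<subseteq> (\<Union>j\<in>{j. j \<noteq> o' \<and> j \<noteq> i}. (+) (?co i (a o')) ` (h j ` Dj j))"
  proof
    fix q assume "q \<in> Si"
    then obtain y where y: "y \<in> E" "supports (facet_interior i) \<Psi> (?K q) y"
      unfolding Si_def slope_set_alt by blast
    have yi: "y \<in> facet_interior i" using y(1) Ei by blast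
    obtain s j where s: "j \<noteq> i" "?K q + s *\<^sub>R a i \<in> D.P" "(?K q + s *\<^sub>R a i) \<bullet> b j = 1"
      "supports N.P \<Psi> (?K q + s *\<^sub>R a i) y" using slope_in_boundary[OF \<Psi> yi y(2)] by metis
    define m where "m = ?K q + s *\<^sub>R a i"
    have yP: "y \<in> N.P" using yi rel_interior_subset[of "N.face i"] unfolding N.face_def by blast
    have "y \<notin> H" using y(1) unfolding E_def by blast
    then have "m \<notin> D.face o'" using s(4) yP unfolding H_def m_def by blast
    then have jo: "j \<noteq> o'" using s(2,3) unfolding D.face_def m_def by blast
    define q' where "q' = ?co o' m"
    obtain r where r: "m = ?K q' + r *\<^sub>R a o'" unfolding q'_def by (rule coords_mod_decompose[OF t0])
    have "1 = ?K q' \<bullet> b j + r" using s(3) jo unfolding m_def[symmetric] r by (simp add: inner_add_left D.pairing)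
    then have "1 - ?K q' \<bullet> b j = r" by simp
    then have lm: "lift j q' = m" unfolding lift_def r by simp
    have "lift j q' \<in> D.P" "\<exists>y\<in>E. supports N.P \<Psi> (lift j q') y"
      unfolding lm using s(2,4) y(1) by (auto simp: m_def)
    then have "q' \<in> Dj j" unfolding Dj_def by simp
    moreover have "q = ?co i (a o') + h j q'"
      unfolding co_lift[symmetric] lm m_def by (rule coords_mod_combination[OF t0, symmetric])
    ultimately show "q \<in> (\<Union>j\<in>{j. j \<noteq> o' \<and> j \<noteq> i}. (+) (?co i (a o')) ` (h j ` Dj j))"
      using jo s(1) by blast
  qed
  ultimately have "negligible Si" by (rule negligible_subset)
  then have "measure lebesgue Si = 0" by (rule negligible_imp_measure0)
  then show False using Si Epos c by simp
qed

text \<open>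
  A point of a ridge of the facet of \<open>a o'\<close> has a supporting slope in a facet containing \<open>a o'\<close> and one
  in the facet opposite \<open>a o'\<close>. The first is outside the interior of the opposite facet, the second is
  outside the interior of every other facet, so the point is in no \<open>U_set\<close>. Hence all ridges of the
  facet are singular, and they separate it from the rest of the boundary.
\<close>
theorem not_connected_complement_singular_set:
  assumes \<Psi>: "\<Psi> \<in> P_class D.P" and MA: "MA_equation D.P \<Psi> \<nu>"
    and g: "\<And>i. \<bar>triple g1 g2 (a i)\<bar> = 1"
    and \<nu>: "\<And>i E. E \<in> sets borel \<Longrightarrow> E \<subseteq> facet_interior i \<Longrightarrow>
      emeasure \<nu> E = ennreal (c * measure lebesgue (beta g1 g2 ` E))"
    and c: "0 < c"
    and full: "measure lebesgue (coords_mod g1 g2 (a o') ` D.P) \<le> c * measure lebesgue (beta g1 g2 ` facet_interior o')"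
  shows "\<not> connected (frontier N.P - singular_set D.P \<Psi>)"
proof
  assume con: "connected (frontier N.P - singular_set D.P \<Psi>)"
  have intr: "facet_interiors N.P = (\<Union>i. facet_interior i)"
    unfolding facet_interiors_def N.facets_P by blast
  have sing: "singular_set D.P \<Psi> = frontier N.P - (\<Union>i. facet_interior i) - (\<Union>j. U_set D.P \<Psi> (D.face j))"
    unfolding singular_set_def dual_P intr D.facets_P by blast
  have ridge: "n \<in> singular_set D.P \<Psi>" if n: "n \<in> N.face o'" "n \<in> N.face i" "i \<noteq> o'" for n i
  proof -
    have nF: "n \<in> frontier N.P" using n(1) N.frontier_eq_faces by blast
    have "n \<notin> facet_interior l" for l
    proof
      assume "n \<in> facet_interior l"
      then have "\<And>j. j \<noteq> l \<Longrightarrow> n \<bullet> a j < 1" unfolding N.rel_interior_face by blast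
      then show False using N.face_plane[OF n(1)] N.face_plane[OF n(2)] n(3) by (metis less_irrefl)
    qed
    moreover have "n \<notin> U_set D.P \<Psi> (D.face j)" for j
    proof -
      have "\<exists>m\<in>frontier D.P - rel_interior (D.face j). supports N.P \<Psi> m n"
      proof (cases "j = o'")
        case True
        obtain m0 where m0: "m0 \<in> D.P" "supports N.P \<Psi> m0 n" using supporting_slope_exists[OF \<Psi>] by blast
        obtain s l where m: "l \<noteq> o'" "m0 + s *\<^sub>R a o' \<in> D.P" "(m0 + s *\<^sub>R a o') \<bullet> b l = 1"
          "supports N.P \<Psi> (m0 + s *\<^sub>R a o') n" using raise_to_boundary[OF m0(1) n(1) m0(2)] by metis
        have "m0 + s *\<^sub>R a o' \<in> frontier D.P" using m(2,3) unfolding D.frontier_P by blast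
        moreover have "m0 + s *\<^sub>R a o' \<notin> rel_interior (D.face j)"
          using m(1,3) unfolding True D.rel_interior_face by force
        ultimately show ?thesis using m(4) by blast
      next
        case False
        have "\<exists>m\<in>D.face o'. supports N.P \<Psi> m n"
          by (rule ridge_contact[OF \<Psi> MA g _ c full n]) (rule \<nu>)
        then obtain m where m: "m \<in> D.face o'" "supports N.P \<Psi> m n" by (elim bexE)
        have "m \<in> frontier D.P" using m(1) D.frontier_eq_faces by blast
        moreover have "m \<notin> rel_interior (D.face j)"
          using D.face_plane[OF m(1)] False unfolding D.rel_interior_face by force
        ultimately show ?thesis using m(2) by blast
      qed
      then obtain m where m: "m \<in> frontier D.P - rel_interior (D.face j)" "supports N.P \<Psi> m n" by blast
      have "n \<in> c_subgradient D.P \<Psi> m" by (rule contact_in_c_subgradient[OF \<Psi> nF m(2)])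
      then show ?thesis using m(1) unfolding U_set_def by blast
    qed
    ultimately show ?thesis unfolding sing using nF by blast
  qed
  define U where "U = (\<Inter>i\<in>- {o'}. {n. a i \<bullet> n < 1})"
  define V where "V = {n. a o' \<bullet> n < 1}"
  have oU: "open U" and oV: "open V" unfolding U_def V_def by (auto intro!: open_INT open_halfspace_lt)
  have U_iff: "n \<in> U \<longleftrightarrow> (\<forall>i. i \<noteq> o' \<longrightarrow> n \<bullet> a i < 1)" for n
    unfolding U_def by (simp add: inner_commute) auto
  have V_iff: "n \<in> V \<longleftrightarrow> n \<bullet> a o' < 1" for n
    unfolding V_def by (simp add: inner_commute)
  have UV: "U \<inter> V \<inter> (frontier N.P - singular_set D.P \<Psi>) = {}"
  proof (rule equals0I)
    fix n assume "n \<in> U \<inter> V \<inter> (frontier N.P - singular_set D.P \<Psi>)"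
    then have n: "n \<in> U" "n \<in> V" "n \<in> frontier N.P" by simp_all
    then have lt: "n \<bullet> a l < 1" for l using U_iff V_iff by (cases "l = o'") simp_all
    obtain l where "n \<bullet> a l = 1" using n(3) unfolding N.frontier_P by auto
    then show False using lt[of l] by simp
  qed
  have cover: "frontier N.P - singular_set D.P \<Psi> \<subseteq> U \<union> V"
  proof
    fix n assume n: "n \<in> frontier N.P - singular_set D.P \<Psi>"
    then have nP: "n \<in> N.P" unfolding N.frontier_P by blast
    have le: "n \<bullet> a l \<le> 1" for l using nP unfolding N.P_eq by simp
    show "n \<in> U \<union> V"
    proof (rule ccontr)
      assume "n \<notin> U \<union> V"
      then obtain i where i: "i \<noteq> o'" "\<not> n \<bullet> a i < 1" "\<not> n \<bullet> a o' < 1" using U_iff V_iff by auto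
      then have "n \<bullet> a i = 1" "n \<bullet> a o' = 1" using le[of i] le[of o'] by simp_all
      then have "n \<in> N.face i" "n \<in> N.face o'" unfolding N.face_def using nP by simp_all
      then show False using ridge[of n i] i(1) n by blast
    qed
  qed
  note disj = connectedD[OF con oU oV UV cover]
  have pt: "\<exists>n. n \<in> facet_interior l \<and> n \<in> frontier N.P - singular_set D.P \<Psi>" for l
  proof -
    have "b (l + 1) \<in> N.face l" using N.a_in_P by (simp add: N.face_def N.pairing)
    moreover have conv: "convex (N.face l)" unfolding N.face_eq_hull by (rule convex_convex_hull)
    ultimately have "facet_interior l \<noteq> {}" using rel_interior_eq_empty[OF conv] by auto
    then obtain n where n: "n \<in> facet_interior l" by auto
    then have "n \<in> N.face l" using rel_interior_subset by auto
    then have "n \<in> frontier N.P" unfolding N.frontier_eq_faces by auto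
    then show ?thesis using n unfolding sing by (intro exI[of _ n]) auto
  qed
  obtain n where n: "n \<in> facet_interior o'" "n \<in> frontier N.P - singular_set D.P \<Psi>" using pt by blast
  then have "n \<in> U" unfolding N.rel_interior_face U_iff by simp
  moreover obtain n' where n': "n' \<in> facet_interior (o' + 1)" "n' \<in> frontier N.P - singular_set D.P \<Psi>" using pt by blast
  then have "n' \<in> V" unfolding N.rel_interior_face V_iff by simp
  ultimately show False using disj n(2) n'(2) by blast
qed

end

section \<open>Existence of a solution by gluing\<close>

lemma legendre_slope_in_set:
  fixes Y :: "'a::euclidean_space set"
  assumes Y: "compact Y" "convex Y" "Y \<noteq> {}" and g: "continuous_on Y g"
    and sup: "supports UNIV (legendre Y g) p x"
  shows "p \<in> Y"
proof (rule ccontr)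
  assume "p \<notin> Y"
  obtain d s where d: "d \<bullet> p < s" "\<And>q. q \<in> Y \<Longrightarrow> s < d \<bullet> q"
    using separating_hyperplane_closed_point[OF Y(2) compact_imp_closed[OF Y(1)] \<open>p \<notin> Y\<close>] by blast
  obtain M where M: "\<And>q. q \<in> Y \<Longrightarrow> M \<le> g q"
    using bdd_below_image_compact[OF Y(1) g] unfolding bdd_below_def by auto
  have "p \<bullet> (- d) \<le> - s"
  proof (rule supports_slope_le_growth[OF sup])
    fix t :: real assume t: "0 < t"
    show "legendre Y g (t *\<^sub>R (- d)) \<le> t * (- s) + (- M)"
    proof (rule legendre_least[OF Y(3)])
      fix q assume q: "q \<in> Y"
      have "t * s \<le> t * (d \<bullet> q)" using t d(2)[OF q] by simp
      then show "t *\<^sub>R (- d) \<bullet> q - g q \<le> t * (- s) + (- M)" using M[OF q] by simp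
    qed
  qed
  then show False using d(1) by (simp add: inner_commute)
qed

lemma supports_mono: "supports X u p x \<Longrightarrow> D \<subseteq> X \<Longrightarrow> supports D u p x"
  unfolding supports_def by (simp add: subset_iff)

lemma mem_translation_iff: "q \<in> (+) (- r) ` S \<longleftrightarrow> r + q \<in> S" for q r :: "'a::ab_group_add"
proof
  assume "r + q \<in> S"
  then have "- r + (r + q) \<in> (+) (- r) ` S" by (rule imageI)
  then show "q \<in> (+) (- r) ` S" by simp
qed auto

lemma convex_on_legendre:
  assumes "bounded Y" "bdd_below (g ` Y)" "Y \<noteq> {}"
  shows "convex_on UNIV (legendre Y g)"
proof (rule convex_onI)
  fix t x y assume t: "0 < t" "t < (1::real)"
  show "legendre Y g ((1 - t) *\<^sub>R x + t *\<^sub>R y) \<le> (1 - t) * legendre Y g x + t * legendre Y g y"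
  proof (rule legendre_least[OF assms(3)])
    fix q assume q: "q \<in> Y"
    have "(1 - t) * (x \<bullet> q - g q) + t * (y \<bullet> q - g q) \<le> (1 - t) * legendre Y g x + t * legendre Y g y"
      using t legendre_upper[OF assms(1,2) q] by (intro add_mono mult_left_mono) auto
    then show "((1 - t) *\<^sub>R x + t *\<^sub>R y) \<bullet> q - g q \<le> (1 - t) * legendre Y g x + t * legendre Y g y"
      by (simp add: inner_add_left algebra_simps)
  qed
qed simp

context polar_tetrahedra
begin

lemma measure_beta_facet_interior:
  assumes g: "\<bar>triple g1 g2 (a i)\<bar> = 1"
  shows "measure lebesgue (beta g1 g2 ` facet_interior i) = measure lebesgue (beta g1 g2 ` N.face i)"
proof -
  let ?S = "beta g1 g2 ` facet_interior i"
  have op: "open ?S" using open_beta_image[OF g open_UNIV] by simp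
  have "convex (facet_interior i)"
    unfolding N.face_eq_hull by (intro convex_rel_interior convex_convex_hull)
  then have "convex ?S" by (rule convex_linear_image[OF linear_beta])
  then have fr: "negligible (frontier ?S)" by (rule negligible_convex_frontier)
  have cb: "continuous_on S (beta g1 g2)" for S
    using linear_continuous_on[of "beta g1 g2"] linear_beta by (simp add: linear_conv_bounded_linear)
  have "beta g1 g2 ` closure (facet_interior i) \<subseteq> closure ?S"
    by (rule image_closure_subset[OF cb closed_closure closure_subset])
  then have "beta g1 g2 ` N.face i \<subseteq> closure ?S" unfolding facet_interior_closure .
  moreover have "frontier ?S = closure ?S - ?S" unfolding frontier_def interior_open[OF op] ..
  ultimately have "beta g1 g2 ` N.face i - ?S \<subseteq> frontier ?S" by (simp add: Diff_mono)
  then have "negligible (beta g1 g2 ` N.face i - ?S)" by (rule negligible_subset[OF fr])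
  moreover have "?S - beta g1 g2 ` N.face i = {}"
    using image_mono[OF rel_interior_subset[of "N.face i"]] by (simp add: Diff_eq_empty_iff)
  ultimately have neg: "negligible ((?S - beta g1 g2 ` N.face i) \<union> (beta g1 g2 ` N.face i - ?S))" by simp
  have "bounded (facet_interior i)"
    using compact_imp_bounded[OF N.compact_face] rel_interior_subset by (rule bounded_subset)
  moreover have "triple g1 g2 (a i) \<noteq> 0" using g by auto
  ultimately have "?S \<in> lmeasurable"
    using facet_interior_borel facet_interior_plane by (intro beta_image_lmeasurable[where n = "a i"])
  from measure_negligible_symdiff[OF this neg] show ?thesis by simp
qed

text \<open>
  \<open>beta g1 g2\<close> projects along \<open>b o'\<close>. Translating a point of the boundary along \<open>b o'\<close> reaches the
  facet of \<open>a o'\<close>.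
\<close>
lemma projected_faces_subset:
  assumes perp: "g1 \<bullet> b o' = 0" "g2 \<bullet> b o' = 0" and k2: "k o' = 2"
  shows "beta g1 g2 ` N.face i \<subseteq> beta g1 g2 ` N.face o'"
proof
  fix x assume "x \<in> beta g1 g2 ` N.face i"
  then obtain n where n: "n \<in> N.face i" "x = beta g1 g2 n" by blast
  have le: "n \<bullet> a j \<le> 1" for j using n(1) unfolding N.face_def N.P_eq by simp
  define s where "s = n \<bullet> a o' - 1"
  have s: "s \<le> 0" unfolding s_def using le by simp
  have "(n + s *\<^sub>R b o') \<bullet> a j \<le> 1" for j
    using le[of j] s by (cases "j = o'") (simp_all add: inner_add_left N.pairing k2 s_def)
  moreover have "(n + s *\<^sub>R b o') \<bullet> a o' = 1" by (simp add: inner_add_left N.pairing k2 s_def)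
  ultimately have "n + s *\<^sub>R b o' \<in> N.face o'" unfolding N.face_def N.P_eq by simp
  moreover have "beta g1 g2 (n + s *\<^sub>R b o') = x"
    unfolding n(2) by (simp add: vec_eq_iff forall_2 beta_components inner_add_right perp)
  ultimately show "x \<in> beta g1 g2 ` N.face o'" by (metis image_eqI)
qed

text \<open>
  A point of the polytope can be moved along \<open>- a o'\<close> to the opposite facet, where the pairing with
  \<open>b o'\<close> is 1; on that facet the component along \<open>a o'\<close> is \<open>- 1\<close>.
\<close>
lemma coords_mod_P:
  assumes k2: "k o' = 2" and t0: "triple g1 g2 (a o') \<noteq> 0" and perp: "g1 \<bullet> b o' = 0" "g2 \<bullet> b o' = 0"
  shows "coords_mod g1 g2 (a o') ` D.P = {q. plane_combination g1 g2 q - a o' \<in> D.P}"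
proof (intro set_eqI iffI)
  fix q assume "q \<in> coords_mod g1 g2 (a o') ` D.P"
  then obtain m where m: "m \<in> D.P" "q = coords_mod g1 g2 (a o') m" by blast
  obtain s where s: "m = plane_combination g1 g2 q + s *\<^sub>R a o'"
    unfolding m(2) by (rule coords_mod_decompose[OF t0])
  let ?K = "plane_combination g1 g2 q"
  have Kb: "?K \<bullet> b o' = 0" unfolding plane_combination_def by (simp add: inner_add_left perp)
  have le: "m \<bullet> b j \<le> 1" for j using m(1) unfolding D.P_eq by simp
  have s1: "- 1 \<le> s" using le[of o'] Kb unfolding s by (simp add: inner_add_left D.pairing k2)
  have "(?K - a o') \<bullet> b j \<le> 1" for j
    using le[of j] s1 Kb unfolding s by (cases "j = o'") (simp_all add: inner_add_left inner_diff_left D.pairing k2)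
  then show "q \<in> {q. plane_combination g1 g2 q - a o' \<in> D.P}" unfolding D.P_eq by simp
next
  fix q assume "q \<in> {q. plane_combination g1 g2 q - a o' \<in> D.P}"
  moreover have "coords_mod g1 g2 (a o') (plane_combination g1 g2 q - a o') = q"
    using coords_mod_combination[OF t0, of q "-1"] by simp
  ultimately show "q \<in> coords_mod g1 g2 (a o') ` D.P" by (metis image_eqI mem_Collect_eq)
qed

text \<open>
  Let \<open>u\<close> be the potential of the transport from the projection \<open>X\<close> of the facet of \<open>a o'\<close> to the image
  \<open>Y\<close> of the polytope modulo \<open>a o'\<close>. The function \<open>v\<close> has all its slopes in the facet opposite \<open>a o'\<close>,
  so it is too small where \<open>a o' \<bullet> n\<close> exceeds the pairings with the other vertices. The maximum with
  \<open>a o' \<bullet> n - C\<close> repairs the growth, and for large \<open>C\<close> it agrees with \<open>v\<close> on the boundary of the dual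
  polytope. On the interior of the facet of \<open>a i\<close>, the
  term \<open>a o' \<bullet> n\<close> only shifts the slopes modulo \<open>a i\<close> by a constant \<open>r\<close>, so the equation follows from
  the one for \<open>u\<close>.
\<close>
theorem MA_solution_exists:
  assumes g: "\<And>i. \<bar>triple g1 g2 (a i)\<bar> = 1"
    and perp: "g1 \<bullet> b o' = 0" "g2 \<bullet> b o' = 0" and k2: "k o' = 2"
    and \<nu>: "\<And>i E. E \<in> sets borel \<Longrightarrow> E \<subseteq> facet_interior i \<Longrightarrow>
      emeasure \<nu> E = ennreal (c * measure lebesgue (beta g1 g2 ` E))"
    and c: "0 \<le> c"
    and full: "measure lebesgue (coords_mod g1 g2 (a o') ` D.P) = c * measure lebesgue (beta g1 g2 ` N.face o')"
  shows "\<exists>\<Psi>\<in>P_class D.P. MA_equation D.P \<Psi> \<nu>"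
proof -
  let ?K = "plane_combination g1 g2" and ?\<beta> = "beta g1 g2" and ?co = "\<lambda>l. coords_mod g1 g2 (a l)"
  have t0: "triple g1 g2 (a l) \<noteq> 0" for l using g[of l] by auto
  define X where "X = ?\<beta> ` N.face o'"
  define Y where "Y = ?co o' ` D.P"
  have Y_eq: "Y = {q. ?K q - a o' \<in> D.P}" unfolding Y_def by (rule coords_mod_P[OF k2 t0 perp])
  have cont_lin: "continuous_on S f" if "linear f" for f :: "real^3 \<Rightarrow> real^2" and S
    using that linear_continuous_on[of f] by (simp add: linear_conv_bounded_linear)
  have cX: "compact X" unfolding X_def by (rule compact_continuous_image[OF cont_lin[OF linear_beta] N.compact_face])
  have cY: "compact Y" unfolding Y_def by (rule compact_continuous_image[OF cont_lin[OF linear_coords_mod] D.compact_P])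
  have convY: "convex Y" unfolding Y_def by (rule convex_linear_image[OF linear_coords_mod D.convex_P])
  have "a (o' + 1) \<in> D.P" "b (o' + 1) \<in> N.face o'" using D.a_in_P N.a_in_P by (simp_all add: N.face_def N.pairing)
  then have ne: "X \<noteq> {}" "Y \<noteq> {}" unfolding X_def Y_def by auto
  have bt: "balanced_transport X Y c"
    by unfold_locales (use cX cY ne c full in \<open>simp_all add: X_def Y_def borel_compact\<close>)
  obtain u h where tp: "transport_potential X Y c u h" by (rule transport_potential_exists[OF bt])
  interpret transport_potential X Y c u h by (rule tp)
  have ch: "continuous_on Y h" by (rule continuous_on_subset[OF g subset_UNIV])
  have bh: "bdd_below (h ` Y)" by (rule bdd_below_image_compact[OF cY ch])
  have convu: "convex_on UNIV u" unfolding u by (rule convex_on_legendre[OF bounded_XY(2) bh ne(2)])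
  have slopes: "supports UNIV u p x \<longleftrightarrow> p \<in> Y \<and> supports X u p x" if "D \<subseteq> X" "open D" "x \<in> D" for D p x
  proof
    assume p: "supports UNIV u p x"
    have "p \<in> Y" by (rule legendre_slope_in_set[OF cY convY ne(2) ch p[unfolded u]])
    then show "p \<in> Y \<and> supports X u p x" using supports_mono[OF p] by simp
  next
    assume "p \<in> Y \<and> supports X u p x"
    then have "supports D u p x" using supports_mono[OF _ that(1)] by simp
    then show "supports UNIV u p x" by (rule supports_open_imp_UNIV[OF convu that(2,3)])
  qed
  obtain M where M: "\<And>q. q \<in> Y \<Longrightarrow> \<bar>h q\<bar> \<le> M"
    using compact_imp_bounded[OF compact_continuous_image[OF ch cY]] unfolding bounded_iff by auto
  obtain L where L: "\<And>x. x \<in> X \<Longrightarrow> L \<le> u x"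
    using bdd_below_image_compact[OF cX cont_u] unfolding bdd_below_def by auto
  \<comment> \<open>on the boundary of the dual polytope \<open>a o' \<bullet> n \<le> 1\<close>, so \<open>a o' \<bullet> n - C \<le> L - a o' \<bullet> n \<le> v n\<close>\<close>
  define C where "C = max 0 (2 - L)"
  define v where "v n = u (?\<beta> n) - a o' \<bullet> n" for n
  define \<Psi> where "\<Psi> n = max (v n) (a o' \<bullet> n - C)" for n
  have \<beta>X: "?\<beta> n \<in> X" if "n \<in> N.face i" for n i
    unfolding X_def by (rule subsetD[OF projected_faces_subset[OF perp k2] imageI[OF that]])
  have \<Psi>_face: "\<Psi> n = v n" if "n \<in> N.face i" for n i
  proof -
    have "n \<bullet> a o' \<le> 1" using that unfolding N.face_def N.P_eq by simp
    moreover have "L \<le> u (?\<beta> n)" by (rule L[OF \<beta>X[OF that]])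
    ultimately show ?thesis unfolding \<Psi>_def v_def C_def by (simp add: inner_commute max_def)
  qed
  have in_class: "\<Psi> \<in> P_class D.P"
    unfolding P_class_def
  proof (intro CollectI conjI)
    show "convex_on UNIV \<Psi>"
    proof (rule convex_onI)
      fix t :: real and x y :: "real^3" assume t: "0 < t" "t < 1"
      let ?z = "(1 - t) *\<^sub>R x + t *\<^sub>R y"
      have lin: "?\<beta> ?z = (1 - t) *\<^sub>R ?\<beta> x + t *\<^sub>R ?\<beta> y"
        using linear_beta[of g1 g2] by (simp add: linear_add linear_scale)
      have "u (?\<beta> ?z) \<le> (1 - t) * u (?\<beta> x) + t * u (?\<beta> y)"
        using convu t unfolding lin convex_on_def by simp
      then have "v ?z \<le> (1 - t) * v x + t * v y"
        unfolding v_def by (simp add: inner_add_right algebra_simps)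
      also have "\<dots> \<le> (1 - t) * \<Psi> x + t * \<Psi> y"
        unfolding \<Psi>_def using t by (intro add_mono mult_left_mono) auto
      finally have 1: "v ?z \<le> (1 - t) * \<Psi> x + t * \<Psi> y" .
      have "a o' \<bullet> ?z - C = (1 - t) * (a o' \<bullet> x - C) + t * (a o' \<bullet> y - C)"
        by (simp add: inner_add_right algebra_simps)
      also have "\<dots> \<le> (1 - t) * \<Psi> x + t * \<Psi> y"
        unfolding \<Psi>_def using t by (intro add_mono mult_left_mono) auto
      finally have 2: "a o' \<bullet> ?z - C \<le> (1 - t) * \<Psi> x + t * \<Psi> y" .
      show "\<Psi> ?z \<le> (1 - t) * \<Psi> x + t * \<Psi> y"
        unfolding \<Psi>_def[of ?z] using 1 2 by (rule max.boundedI)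
    qed simp
  next
    let ?H = "\<lambda>n. SUP m\<in>D.P \<inter> int_lattice. m \<bullet> n"
    show "bdd_above (range (\<lambda>n. \<bar>\<Psi> n - ?H n\<bar>))"
    proof (rule bdd_aboveI2)
      fix n :: "real^3"
      have bdd: "bdd_above ((\<lambda>m. m \<bullet> n) ` (D.P \<inter> int_lattice))"
      proof -
        have "bounded ((\<lambda>m. m \<bullet> n) ` D.P)"
          by (intro compact_imp_bounded compact_continuous_image D.compact_P continuous_intros)
        then have "bounded ((\<lambda>m. m \<bullet> n) ` (D.P \<inter> int_lattice))" by (rule bounded_subset) blast
        then show ?thesis by (rule bounded_imp_bdd_above)
      qed
      have aH: "a i \<bullet> n \<le> ?H n" for i
        using D.a_in_P D.lattice(1) by (intro cSUP_upper[OF _ bdd]) simp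
      have PH: "m \<bullet> n \<le> ?H n" if "m \<in> D.P" for m
      proof -
        have "range a \<subseteq> {m. n \<bullet> m \<le> ?H n}" using aH by (auto simp: inner_commute)
        then have "D.P \<subseteq> {m. n \<bullet> m \<le> ?H n}"
          unfolding D.P_def by (rule hull_minimal) (rule convex_halfspace_le)
        then show ?thesis using that by (auto simp: inner_commute)
      qed
      have vle: "v n \<le> ?H n + M"
      proof -
        have "u (?\<beta> n) \<le> ?H n + M + a o' \<bullet> n"
          unfolding u
        proof (rule legendre_least[OF ne(2)])
          fix q assume q: "q \<in> Y"
          have "(?K q - a o') \<bullet> n \<le> ?H n" using q unfolding Y_eq by (intro PH) simp
          moreover have "?\<beta> n \<bullet> q = ?K q \<bullet> n"
            unfolding inner_commute[of "?\<beta> n"] inner_beta plane_combination_def ..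
          ultimately show "?\<beta> n \<bullet> q - h q \<le> ?H n + M + a o' \<bullet> n"
            using M[OF q] by (simp add: inner_diff_left)
        qed
        then show ?thesis unfolding v_def by simp
      qed
      have vge: "a i \<bullet> n - M \<le> v n" if i: "i \<noteq> o'" for i
      proof -
        define q where "q = ?co o' (a i)"
        have qY: "q \<in> Y" unfolding q_def Y_def by (rule imageI[OF D.a_in_P])
        obtain s where s: "a i = ?K q + s *\<^sub>R a o'" unfolding q_def by (rule coords_mod_decompose[OF t0])
        have "?K q \<bullet> b o' = 0" unfolding plane_combination_def by (simp add: inner_add_left perp)
        then have "a i \<bullet> b o' = - s" unfolding s by (simp add: inner_add_left D.pairing k2)
        \<comment> \<open>the other vertices lie in the facet opposite \<open>a o'\<close>\<close>
        then have "s = - 1" using i by (simp add: D.pairing)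
        then have Kq: "?K q \<bullet> n = a i \<bullet> n + a o' \<bullet> n" using s by (simp add: inner_diff_left)
        have "?\<beta> n \<bullet> q - h q \<le> u (?\<beta> n)" unfolding u by (rule legendre_upper[OF bounded_XY(2) bh qY])
        moreover have "?\<beta> n \<bullet> q = ?K q \<bullet> n"
          unfolding inner_commute[of "?\<beta> n"] inner_beta plane_combination_def ..
        ultimately show ?thesis using M[OF qY] Kq unfolding v_def by simp
      qed
      have aPsi: "a i \<bullet> n - (M + C) \<le> \<Psi> n" for i
      proof (cases "i = o'")
        case True
        have "0 \<le> M" using M ne(2) by force
        then show ?thesis unfolding True \<Psi>_def by simp
      next
        case False
        then show ?thesis using vge[OF False] unfolding \<Psi>_def C_def by simp
      qed
      have "?H n \<le> \<Psi> n + (M + C)"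
      proof (rule cSUP_least)
        have "a o' \<in> D.P \<inter> int_lattice" using D.a_in_P D.lattice(1) by simp
        then show "D.P \<inter> int_lattice \<noteq> {}" by auto
        fix m assume m: "m \<in> D.P \<inter> int_lattice"
        have "n \<bullet> a i \<le> \<Psi> n + (M + C)" for i using aPsi[of i] by (simp add: inner_commute)
        then have "range a \<subseteq> {m. n \<bullet> m \<le> \<Psi> n + (M + C)}" by auto
        then have "D.P \<subseteq> {m. n \<bullet> m \<le> \<Psi> n + (M + C)}"
          unfolding D.P_def by (rule hull_minimal) (rule convex_halfspace_le)
        then show "m \<bullet> n \<le> \<Psi> n + (M + C)" using m by (auto simp: inner_commute)
      qed
      moreover have "\<Psi> n \<le> ?H n + (M + C)"
      proof -
        have "0 \<le> M" using M ne(2) by force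
        moreover have "0 \<le> C" unfolding C_def by simp
        ultimately show ?thesis unfolding \<Psi>_def using vle aH[of o'] by (intro max.boundedI) linarith+
      qed
      ultimately show "\<bar>\<Psi> n - ?H n\<bar> \<le> M + C" by simp
    qed
  qed
  have "MA_equation D.P \<Psi> \<nu>"
  proof (rule slope_measure_imp_MA[OF assms(1)])
    fix i E assume E: "E \<in> sets borel" "E \<subseteq> facet_interior i"
    let ?R = "facet_interior i"
    have RF: "?R \<subseteq> N.face i" by (rule rel_interior_subset)
    have opR: "open (?\<beta> ` ?R)" using open_beta_image[OF assms(1) open_UNIV] by simp
    have RX: "?\<beta> ` ?R \<subseteq> X"
    proof
      fix x assume "x \<in> ?\<beta> ` ?R"
      then obtain n where "n \<in> ?R" "x = ?\<beta> n" by auto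
      then show "x \<in> X" using \<beta>X[OF subsetD[OF RF]] by simp
    qed
    define r where "r = ?co i (a o')"
    obtain s where s: "a o' = ?K r + s *\<^sub>R a i" unfolding r_def by (rule coords_mod_decompose[OF t0])
    have ao: "a o' \<bullet> (y - n) = r \<bullet> (?\<beta> y - ?\<beta> n)" if "y \<in> ?R" "n \<in> ?R" for y n
    proof -
      have "a i \<bullet> (y - n) = 0"
        using facet_interior_plane[OF that(1)] facet_interior_plane[OF that(2)] by (simp add: inner_diff_right inner_commute)
      then have "a o' \<bullet> (y - n) = ?K r \<bullet> (y - n)" unfolding s by (simp add: inner_add_left)
      also have "\<dots> = r \<bullet> ?\<beta> (y - n)" unfolding inner_beta plane_combination_def ..
      finally show ?thesis using linear_diff[OF linear_beta] by metis
    qed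
    have supp: "supports ?R \<Psi> (?K q) n \<longleftrightarrow> supports (?\<beta> ` ?R) u (r + q) (?\<beta> n)" if n: "n \<in> ?R" for q n
    proof -
      have iff: "\<Psi> n + ?K q \<bullet> (y - n) \<le> \<Psi> y \<longleftrightarrow> u (?\<beta> n) + (r + q) \<bullet> (?\<beta> y - ?\<beta> n) \<le> u (?\<beta> y)" if y: "y \<in> ?R" for y
      proof -
        have "?K q \<bullet> (y - n) = q \<bullet> (?\<beta> y - ?\<beta> n)"
          unfolding linear_diff[OF linear_beta, symmetric] inner_beta plane_combination_def ..
        then show ?thesis
          using ao[OF y n] \<Psi>_face[OF subsetD[OF RF y]] \<Psi>_face[OF subsetD[OF RF n]]
          unfolding v_def by (simp add: inner_add_left inner_diff_right[of "a o'"]) linarith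
      qed
      show ?thesis unfolding supports_def by (simp add: iff)
    qed
    have eq: "slope_set \<Psi> ?R E g1 g2 = (+) (- r) ` (Y \<inter> contact_slopes X u (?\<beta> ` E))"
    proof (intro set_eqI)
      fix q
      have "q \<in> slope_set \<Psi> ?R E g1 g2 \<longleftrightarrow> (\<exists>n\<in>E. supports (?\<beta> ` ?R) u (r + q) (?\<beta> n))"
        unfolding slope_set_alt mem_Collect_eq by (rule bex_cong[OF refl]) (rule supp[OF subsetD[OF E(2)]])
      also have "\<dots> \<longleftrightarrow> (\<exists>n\<in>E. r + q \<in> Y \<and> supports X u (r + q) (?\<beta> n))"
      proof (rule bex_cong[OF refl])
        fix n assume "n \<in> E"
        then have n: "?\<beta> n \<in> ?\<beta> ` ?R" by (rule imageI[OF subsetD[OF E(2)]])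
        have "supports (?\<beta> ` ?R) u (r + q) (?\<beta> n) \<longleftrightarrow> supports UNIV u (r + q) (?\<beta> n)"
          by (intro iffI supports_open_imp_UNIV[OF convu opR n]) (simp_all add: supports_mono[where X = UNIV])
        then show "supports (?\<beta> ` ?R) u (r + q) (?\<beta> n) \<longleftrightarrow> r + q \<in> Y \<and> supports X u (r + q) (?\<beta> n)"
          using slopes[OF RX opR n] by simp
      qed
      also have "\<dots> \<longleftrightarrow> r + q \<in> Y \<inter> contact_slopes X u (?\<beta> ` E)" unfolding contact_slopes_def by auto
      also have "\<dots> \<longleftrightarrow> q \<in> (+) (- r) ` (Y \<inter> contact_slopes X u (?\<beta> ` E))"
        unfolding mem_translation_iff ..
      finally show "q \<in> slope_set \<Psi> ?R E g1 g2 \<longleftrightarrow> q \<in> (+) (- r) ` (Y \<inter> contact_slopes X u (?\<beta> ` E))" .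
    qed
    have plane: "y \<bullet> a i = 1" if "y \<in> E" for y by (rule facet_interior_plane[OF subsetD[OF E(2) that]])
    have \<beta>E: "?\<beta> ` E \<in> sets borel" by (rule beta_image_borel[OF t0 plane E(1)])
    have "?\<beta> ` E \<subseteq> X" using image_mono[OF E(2)] RX by (rule order_trans)
    note cm = contact_measure[OF \<beta>E this]
    show "slope_set \<Psi> ?R E g1 g2 \<in> lmeasurable \<and>
      ennreal (measure lebesgue (slope_set \<Psi> ?R E g1 g2)) = emeasure \<nu> E"
      unfolding eq \<nu>[OF E] measure_translation conjunct2[OF cm]
      by (intro conjI refl measurable_translation conjunct1[OF cm])
  qed
  with in_class show ?thesis by blast
qed

end

section \<open>The simplex with vertices e0, e1, e2 and -3 e0 - e1 - e2\<close>

lemma measure_triangle: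
  fixes p q r :: "real^2"
  assumes "p \<noteq> q" "p \<noteq> r" "q \<noteq> r"
  shows "measure lebesgue (convex hull {p, q, r}) =
    \<bar>(q $ 1 - p $ 1) * (r $ 2 - p $ 2) - (r $ 1 - p $ 1) * (q $ 2 - p $ 2)\<bar> / 2"
proof -
  define f :: "2 \<Rightarrow> real^2" where "f i = (if i = 1 then q else r)" for i
  have f: "f 1 = q" "f 2 = r" by (simp_all add: f_def)
  have "bij_betw f UNIV ({p, q, r} - {p})"
    using assms f unfolding bij_betw_def inj_on_def UNIV_2 by auto
  then have "measure lborel (convex hull {p, q, r}) = \<bar>det (\<chi> i. \<chi> j. f j $ i - p $ i)\<bar> / fact CARD(2)"
    using assms by (intro content_simplex) auto
  moreover have "measure lebesgue (convex hull {p, q, r}) = measure lborel (convex hull {p, q, r})"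
    by (intro measure_completion) (simp add: borel_compact finite_imp_compact_convex_hull)
  ultimately show ?thesis by (simp add: det_2 f)
qed

definition vec3 :: "real \<Rightarrow> real \<Rightarrow> real \<Rightarrow> real^3" where
  "vec3 x y z = (\<chi> i. if i = 0 then x else if i = 1 then y else z)"

lemma vec3_components [simp]: "vec3 x y z $ 0 = x" "vec3 x y z $ 1 = y" "vec3 x y z $ 2 = z"
  by (simp_all add: vec3_def)

lemma forall_3_zero: "(\<forall>i::3. P i) \<longleftrightarrow> P 0 \<and> P 1 \<and> P 2"
proof -
  have "(3::3) = 0" by simp
  then have "P 3 = P 0" by (rule arg_cong)
  then show ?thesis unfolding forall_3 by blast
qed

lemma vec3_eq_iff: "x = y \<longleftrightarrow> x $ 0 = y $ 0 \<and> x $ 1 = y $ 1 \<and> x $ 2 = y $ 2" for x y :: "real^3"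
  unfolding vec_eq_iff by (rule forall_3_zero)

lemma vec3_in_int_lattice: "vec3 (of_int x) (of_int y) (of_int z) \<in> int_lattice"
  unfolding int_lattice_def mem_Collect_eq forall_3_zero by simp

lemma triple_eq: "triple x y z = x $ 0 * (y $ 1 * z $ 2 - y $ 2 * z $ 1)
   + x $ 1 * (y $ 2 * z $ 0 - y $ 0 * z $ 2) + x $ 2 * (y $ 0 * z $ 1 - y $ 1 * z $ 0)"
proof -
  have "v $ 0 = v $ 3" for v :: "real^3" by (rule arg_cong[of 0 3 "($) v"]) simp
  then show ?thesis by (simp add: triple_def inner_vec_def sum_3 cross_components algebra_simps)
qed

text \<open>
  The index 0 is the distinguished vertex; \<open>normal i\<close> belongs to the facet opposite \<open>vertex i\<close>, and is a
  vertex of the dual polytope.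
\<close>
definition vertex :: "4 \<Rightarrow> real^3" where
  "vertex i = (if i = 0 then vec3 1 0 0 else if i = 1 then vec3 0 1 0 else if i = 2 then vec3 0 0 1 else vec3 (-3) (-1) (-1))"

definition normal :: "4 \<Rightarrow> real^3" where
  "normal i = (if i = 0 then vec3 (-1) 1 1 else if i = 1 then vec3 1 (-5) 1 else if i = 2 then vec3 1 1 (-5) else vec3 1 1 1)"

definition height :: "4 \<Rightarrow> real" where
  "height i = (if i = 0 then 2 else 6)"

lemma index4_cases: "i = 0 \<or> i = 1 \<or> i = 2 \<or> i = (3::4)"
proof -
  have "(4::4) = 0" by simp
  then show ?thesis using exhaust_4[of i] by metis
qed

lemma sum_index4: "(\<Sum>i\<in>UNIV. f i) = f 0 + f 1 + f 2 + f (3::4)"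
proof -
  have "f 4 = f 0" by (rule arg_cong[of 4 0 f]) simp
  then show ?thesis unfolding sum_4 by (simp add: ac_simps)
qed

lemma vertex_simps [simp]: "vertex 0 = vec3 1 0 0" "vertex 1 = vec3 0 1 0" "vertex 2 = vec3 0 0 1" "vertex 3 = vec3 (-3) (-1) (-1)"
  by (simp_all add: vertex_def)

lemma normal_simps [simp]: "normal 0 = vec3 (-1) 1 1" "normal 1 = vec3 1 (-5) 1" "normal 2 = vec3 1 1 (-5)" "normal 3 = vec3 1 1 1"
  by (simp_all add: normal_def)

lemma height_simps [simp]: "height 0 = 2" "height 1 = 6" "height 2 = 6" "height 3 = 6"
  by (simp_all add: height_def)

lemma vertex_normal: "vertex j \<bullet> normal i = (if i = j then 1 - height i else 1)"
  using index4_cases[of i] index4_cases[of j] by (elim disjE) (simp_all add: inner_3)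

lemma vertex_lattice: "vertex i \<in> int_lattice" and normal_lattice: "normal i \<in> int_lattice"
  using index4_cases[of i] vec3_in_int_lattice[of 1 0 0] vec3_in_int_lattice[of 0 1 0] vec3_in_int_lattice[of 0 0 1]
    vec3_in_int_lattice[of "-3" "-1" "-1"] vec3_in_int_lattice[of "-1" 1 1] vec3_in_int_lattice[of 1 "-5" 1]
    vec3_in_int_lattice[of 1 1 "-5"] vec3_in_int_lattice[of 1 1 1] by auto

lemma triple_normal: "\<bar>triple (vec3 0 1 0) (vec3 0 0 1) (normal i)\<bar> = 1"
  using index4_cases[of i] by (elim disjE) (simp_all add: triple_eq)

lemma triple_vertex: "\<bar>triple (vec3 1 1 0) (vec3 1 0 1) (vertex i)\<bar> = 1"
  using index4_cases[of i] by (elim disjE) (simp_all add: triple_eq)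

interpretation polar_tetrahedra vertex normal height
proof
  have lat: "vec3 0 1 0 \<in> int_lattice" "vec3 0 0 1 \<in> int_lattice" "vec3 1 1 0 \<in> int_lattice" "vec3 1 0 1 \<in> int_lattice"
    using vec3_in_int_lattice[of 0 1 0] vec3_in_int_lattice[of 0 0 1] vec3_in_int_lattice[of 1 1 0] vec3_in_int_lattice[of 1 0 1] by simp_all
  fix i j :: 4 and x :: "real^3"
  show "vertex j \<bullet> normal i = (if i = j then 1 - height i else 1)" by (rule vertex_normal)
  show "normal j \<bullet> vertex i = (if i = j then 1 - height i else 1)"
    using vertex_normal[of i j] by (simp add: inner_commute)
  show "1 < height i" by (simp add: height_def)
  show "(\<Sum>i\<in>UNIV. (1 - x \<bullet> normal i) / height i) = 1" "(\<Sum>i\<in>UNIV. (1 - x \<bullet> vertex i) / height i) = 1"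
    unfolding sum_index4 by (simp_all add: inner_3 field_simps)
  show "(\<Sum>i\<in>UNIV. ((1 - x \<bullet> normal i) / height i) *\<^sub>R vertex i) = x"
    "(\<Sum>i\<in>UNIV. ((1 - x \<bullet> vertex i) / height i) *\<^sub>R normal i) = x"
    unfolding sum_index4 by (simp_all add: vec3_eq_iff inner_3 field_simps)
  show "vertex i \<in> int_lattice" "normal i \<in> int_lattice"
    by (rule vertex_lattice normal_lattice)+
  show "\<exists>x\<in>int_lattice. \<exists>y\<in>int_lattice. \<bar>triple x y (normal i)\<bar> = 1" using lat triple_normal by blast
  show "\<exists>x\<in>int_lattice. \<exists>y\<in>int_lattice. \<bar>triple x y (vertex i)\<bar> = 1" using lat triple_vertex by blast
qed

definition vec2 :: "real \<Rightarrow> real \<Rightarrow> real^2" where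
  "vec2 x y = (\<chi> i. if i = 1 then x else y)"

lemma vec2_components [simp]: "vec2 x y $ 1 = x" "vec2 x y $ 2 = y"
  by (simp_all add: vec2_def)

lemma vec2_eq_iff [simp]: "vec2 x y = vec2 x' y' \<longleftrightarrow> x = x' \<and> y = y'"
  by (simp add: vec_eq_iff forall_2)

lemma beta_vec3: "beta m1 m2 (vec3 x y z) = vec2 (m1 \<bullet> vec3 x y z) (m2 \<bullet> vec3 x y z)"
  by (simp add: vec_eq_iff forall_2 beta_components)

lemma UNIV_index4: "UNIV = {0, 1, 2, 3::4}"
  using index4_cases by auto

lemma compl_index4: "- {0::4} = {1, 2, 3}" "- {1::4} = {0, 2, 3}" "- {2::4} = {0, 1, 3}" "- {3::4} = {0, 1, 2}"
  unfolding Compl_eq_Diff_UNIV UNIV_index4 by auto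

lemma beta_hull: "beta m1 m2 ` (convex hull (f ` S)) = convex hull ((\<lambda>i. beta m1 m2 (f i)) ` S)"
  unfolding convex_hull_linear_image[OF linear_beta] image_image ..

text \<open>
  The pair \<open>vec3 1 1 0\<close>, \<open>vec3 1 0 1\<close> is a lattice basis of the plane orthogonal to \<open>normal 0\<close> and at the
  same time unimodular with every vertex.
\<close>
lemma dual_face_areas:
  "measure lebesgue (beta (vec3 1 1 0) (vec3 1 0 1) ` N.face 0) = 18"
  "measure lebesgue (beta (vec3 1 1 0) (vec3 1 0 1) ` N.face 1) = 6"
  "measure lebesgue (beta (vec3 1 1 0) (vec3 1 0 1) ` N.face 2) = 6"
  "measure lebesgue (beta (vec3 1 1 0) (vec3 1 0 1) ` N.face 3) = 6"
  unfolding N.face_eq_hull beta_hull compl_index4 by (simp_all add: beta_vec3 inner_3 measure_triangle)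

lemma face_areas:
  "measure lebesgue (beta (vec3 0 1 0) (vec3 0 0 1) ` D.face 0) = 3 / 2"
  "measure lebesgue (beta (vec3 0 1 0) (vec3 0 0 1) ` D.face 1) = 1 / 2"
  "measure lebesgue (beta (vec3 0 1 0) (vec3 0 0 1) ` D.face 2) = 1 / 2"
  "measure lebesgue (beta (vec3 0 1 0) (vec3 0 0 1) ` D.face 3) = 1 / 2"
  unfolding D.face_eq_hull beta_hull compl_index4 by (simp_all add: beta_vec3 inner_3 measure_triangle)

text \<open>
  This area is the mass \<open>18 / 12\<close> of the facet dual to \<open>vertex 0\<close>, which makes that facet use up all
  slopes modulo \<open>vertex 0\<close>.
\<close>
lemma star_area:
  "measure lebesgue (coords_mod (vec3 1 1 0) (vec3 1 0 1) (vertex 0) ` D.P) = 3 / 2"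
proof -
  have v3: "vec3 x y z $ 3 = x" for x y z
  proof -
    have "vec3 x y z $ 3 = vec3 x y z $ 0" by (rule arg_cong[of 3 0 "($) (vec3 x y z)"]) simp
    then show ?thesis by simp
  qed
  have co: "coords_mod (vec3 1 1 0) (vec3 1 0 1) (vertex 0) = beta (vec3 0 1 0) (vec3 0 0 1)"
  proof
    fix m
    have "triple (vec3 1 1 0) (vec3 1 0 1) (vertex 0) = 1" by (simp add: triple_eq)
    then show "coords_mod (vec3 1 1 0) (vec3 1 0 1) (vertex 0) m = beta (vec3 0 1 0) (vec3 0 0 1) m"
      by (simp add: coords_mod_def vec_eq_iff forall_2 beta_components inner_vec_def sum_3 cross_components v3)
  qed
  have "beta (vec3 0 1 0) (vec3 0 0 1) ` D.P = convex hull (insert (vec2 0 0) {vec2 1 0, vec2 0 1, vec2 (-1) (-1)})"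
    unfolding D.P_def beta_hull UNIV_index4 by (simp add: beta_vec3 inner_3)
  also have "\<dots> = convex hull {vec2 1 0, vec2 0 1, vec2 (-1) (-1)}"
  proof (rule hull_redundant)
    have "vec2 0 0 = (1/3) *\<^sub>R vec2 1 0 + (1/3) *\<^sub>R vec2 0 1 + (1/3) *\<^sub>R vec2 (-1) (-1)"
      by (simp add: vec_eq_iff forall_2)
    then show "vec2 0 0 \<in> convex hull {vec2 1 0, vec2 0 1, vec2 (-1) (-1)}"
      unfolding convex_hull_3 mem_Collect_eq by (intro exI[of _ "1/3"] conjI) simp_all
  qed
  finally show ?thesis unfolding co by (simp add: measure_triangle)
qed

theorem lemma25:
  fixes e :: "3 \<Rightarrow> real^3"
    and \<Delta> A B :: "(real^3) set"
    and c :: ennreal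
    and \<nu> :: "(real^3) measure"
  assumes "e = (\<lambda>i. axis i 1)"
    and "\<Delta> = convex hull {e 0, e 1, e 2, - 3 *\<^sub>R e 0 - e 1 - e 2}"
    and "A = frontier \<Delta>"
    and "B = frontier (dual_polytope \<Delta>)"
    and "c = emeasure (boundary_measure \<Delta>) A /
             emeasure (boundary_measure (dual_polytope \<Delta>)) B"
    and "\<nu> = scale_measure c (boundary_measure (dual_polytope \<Delta>))"
  shows "(\<exists>\<Psi>\<in>P_class \<Delta>. MA_equation \<Delta> \<Psi> \<nu>) \<and>
         (\<forall>\<Psi>\<in>P_class \<Delta>. MA_equation \<Delta> \<Psi> \<nu> \<longrightarrow> \<not> connected (B - singular_set \<Delta> \<Psi>))"
proof -
  have "e 0 = vertex 0" "e 1 = vertex 1" "e 2 = vertex 2" "- 3 *\<^sub>R e 0 - e 1 - e 2 = vertex 3"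
    unfolding assms(1) by (simp_all add: vec3_eq_iff axis_def)
  then have \<Delta>: "\<Delta> = D.P"
    unfolding assms(2) D.P_def UNIV_index4 by simp
  have B: "B = frontier N.P" unfolding assms(4) \<Delta> dual_P ..
  have "emeasure (boundary_measure D.P) (frontier D.P) = ennreal 3"
    by (subst D.emeasure_boundary_frontier[OF triple_normal]) (simp add: sum_index4 face_areas)
  moreover have "emeasure (boundary_measure N.P) (frontier N.P) = ennreal 36"
    by (subst N.emeasure_boundary_frontier[OF triple_vertex]) (simp add: sum_index4 dual_face_areas)
  ultimately have c: "c = ennreal (1 / 12)"
    unfolding assms(5) assms(3) B \<Delta> dual_P by (simp only: divide_ennreal) simp
  have \<nu>: "emeasure \<nu> E = ennreal (1 / 12 * measure lebesgue (beta (vec3 1 1 0) (vec3 1 0 1) ` E))"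
    if "E \<in> sets borel" "E \<subseteq> rel_interior (N.face i)" for i E
    unfolding assms(6) c \<Delta> dual_P emeasure_scale_measure N.emeasure_boundary_face[OF triple_vertex that]
    by (rule ennreal_mult[symmetric]) simp_all
  have "\<exists>\<Psi>\<in>P_class D.P. MA_equation D.P \<Psi> \<nu>"
    by (rule MA_solution_exists[where o' = 0 and c = "1 / 12", OF triple_vertex _ _ _ \<nu>])
      (simp_all add: inner_3 star_area dual_face_areas del: vertex_simps)
  moreover have "\<not> connected (frontier N.P - singular_set D.P \<Psi>)"
    if "\<Psi> \<in> P_class D.P" "MA_equation D.P \<Psi> \<nu>" for \<Psi>
    by (rule not_connected_complement_singular_set[where o' = 0 and c = "1 / 12", OF that triple_vertex \<nu>])
      (simp_all add: star_area dual_face_areas measure_beta_facet_interior[OF triple_vertex] del: vertex_simps)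
  ultimately show ?thesis unfolding B \<Delta> by blast
qed

end
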